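(* Let $(\Sigma,\sigma)$ be a transitive countable Markov shift and let $\mu$ be an ergodic $\sigma$-invariant Borel probability measure on $\Sigma$ such that $H_\mu(\mathcal{B})$ is finite. Then there exists $\phi\in\mathrm{UC}_d(\Sigma)$ such that $\mu$ is the unique equilibrium measure for $\phi$.
   Context: Countable Markov shift: let $M$ be an $\mathbb{N}\times\mathbb{N}$ matrix with entries in $\{0,1\}$, $\mathbb{N}=\{1,2,\dots\}$; $\Sigma=\{(x_1,x_2,\dots)\in\mathbb{N}^{\mathbb{N}}: M(x_i,x_{i+1})=1\ \forall i\in\mathbb{N}\}$ with the topology induced by the product of discrete topologies, and $\sigma(x_1,x_2,\dots)=(x_2,x_3,\dots)$. An admissible word is a finite string $a_1\dots a_N$ in $\mathbb{N}$ with $M(a_i,a_{i+1})=1$ for $1\le i<N$. The shift is transitive if for all $a,b\in\mathbb{N}$ there is an admissible word starting with $a$ and ending with $b$ (in particular $\Sigma$ is non-compact). $\mathcal{M}(\Sigma,\sigma)$ is the set of $\sigma$-invariant Borel probability measures on $\Sigma$. $\mathcal{B}=\{[n]:n\in\mathbb{N}\}$, where $[n]=\{x\in\Sigma:x_1=n\}$, and $H_\mu(\mathcal{B})=-\sum_{n=1}^\infty\mu([n])\log\mu([n])$ (with $0\log 0=0$). The metric $d$ on $\Sigma$: $d(x,x)=0$ and, for $x\ne y$, $d(x,y)=2^{-(m-1)}$ with $m=\min\{i:x_i\ne y_i\}$; $\mathrm{UC}_d(\Sigma)$ is the space of real-valued functions on $\Sigma$ uniformly continuous with respect to $d$. $h(\nu)$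 is the measure-theoretic entropy of $\nu$. For continuous $\phi:\Sigma\to\mathbb{R}$, $P(\phi)=\sup\{h(\nu)+\int\phi\,d\nu:\nu\in\mathcal{M}(\Sigma,\sigma),\ \int\phi\,d\nu>-\infty\}$; a measure $\nu\in\mathcal{M}(\Sigma,\sigma)$ with $\int\phi\,d\nu>-\infty$ attaining this supremum is an equilibrium measure for $\phi$. *)

theory Defs
  imports "HOL-Probability.Probability"
begin

text \<open>
  The alphabet is the type \<^typ>\<open>nat\<close> and sequences are functions on \<^typ>\<open>nat\<close>, so both letters
  and positions are numbered from 0 instead of 1. The topology on \<^typ>\<open>nat \<Rightarrow> nat\<close> is the
  library's product topology, with \<^typ>\<open>nat\<close> discrete.
\<close>

definition markov_shift :: "(nat \<Rightarrow> nat \<Rightarrow> nat) \<Rightarrow> (nat \<Rightarrow> nat) set" where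
  "markov_shift M = {x. \<forall>i. M (x i) (x (Suc i)) = 1}"

definition shift_map :: "(nat \<Rightarrow> nat) \<Rightarrow> nat \<Rightarrow> nat" where
  "shift_map x = (\<lambda>i. x (Suc i))"

definition admissible_word :: "(nat \<Rightarrow> nat \<Rightarrow> nat) \<Rightarrow> nat list \<Rightarrow> bool" where
  "admissible_word M w \<longleftrightarrow> (\<forall>i. Suc i < length w \<longrightarrow> M (w ! i) (w ! Suc i) = 1)"

definition transitive_shift :: "(nat \<Rightarrow> nat \<Rightarrow> nat) \<Rightarrow> bool" where
  "transitive_shift M \<longleftrightarrow>
    (\<forall>a b. \<exists>w. w \<noteq> [] \<and> admissible_word M w \<and> hd w = a \<and> last w = b)"

definition shift_cylinder :: "(nat \<Rightarrow> nat \<Rightarrow> nat) \<Rightarrow> nat \<Rightarrow> (nat \<Rightarrow> nat) set" where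
  "shift_cylinder M n = {x \<in> markov_shift M. x 0 = n}"

definition cylinder_partition :: "(nat \<Rightarrow> nat \<Rightarrow> nat) \<Rightarrow> (nat \<Rightarrow> nat) set set" where
  "cylinder_partition M = range (shift_cylinder M)"

text \<open>With positions numbered from 0, the exponent \<open>m - 1\<close> is the first position of disagreement.\<close>

definition shift_dist :: "(nat \<Rightarrow> nat) \<Rightarrow> (nat \<Rightarrow> nat) \<Rightarrow> real" where
  "shift_dist x y = (if x = y then 0 else 1 / 2 ^ (LEAST i. x i \<noteq> y i))"

lemma shift_dist_self: "shift_dist x x = 0"
  by (simp add: shift_dist_def)

lemma shift_dist_neq: "x \<noteq> y \<Longrightarrow> shift_dist x y = 1 / 2 ^ (LEAST i. x i \<noteq> y i)"
  by (simp only: shift_dist_def if_False)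

lemma shift_dist_nonneg: "0 \<le> shift_dist x y"
proof (cases "x = y")
  case False
  show ?thesis unfolding shift_dist_neq[OF False] by simp
qed (simp add: shift_dist_self)

lemma shift_dist_eq_0_iff: "shift_dist x y = 0 \<longleftrightarrow> x = y"
proof (cases "x = y")
  case False
  have "shift_dist x y \<noteq> 0" unfolding shift_dist_neq[OF False] by simp
  with False show ?thesis by blast
qed (simp add: shift_dist_self)

lemma shift_dist_commute: "shift_dist x y = shift_dist y x"
proof -
  have "(\<lambda>i. x i \<noteq> y i) = (\<lambda>i. y i \<noteq> x i)" by (intro ext) (rule neq_commute)
  then show ?thesis
    unfolding shift_dist_def by (simp only: eq_commute[of x y])
qed

lemma shift_dist_ge: "x i \<noteq> y i \<Longrightarrow> 1 / 2 ^ i \<le> shift_dist x y"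
proof -
  assume neq: "x i \<noteq> y i"
  then have "(LEAST i. x i \<noteq> y i) \<le> i" by (rule Least_le)
  then have "(1::real) / 2 ^ i \<le> 1 / 2 ^ (LEAST i. x i \<noteq> y i)"
    by (intro divide_left_mono power_increasing) simp_all
  moreover from neq have "x \<noteq> y" by blast
  ultimately show "1 / 2 ^ i \<le> shift_dist x y" by (metis shift_dist_neq)
qed

lemma shift_dist_triangle: "shift_dist x z \<le> shift_dist x y + shift_dist y z"
proof (cases "x = z")
  case True
  then show ?thesis by (simp add: shift_dist_self shift_dist_nonneg)
next
  case False
  define k where "k = (LEAST i. x i \<noteq> z i)"
  from False have "\<exists>i. x i \<noteq> z i" by blast
  then have "x k \<noteq> z k" unfolding k_def by (rule LeastI_ex)
  then have "x k \<noteq> y k \<or> y k \<noteq> z k" by metis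
  then have "1 / 2 ^ k \<le> shift_dist x y + shift_dist y z"
    using shift_dist_ge[of x k y] shift_dist_ge[of y k z]
      shift_dist_nonneg[of x y] shift_dist_nonneg[of y z] by linarith
  then show ?thesis unfolding shift_dist_neq[OF False] k_def .
qed

text \<open>This justifies forming the abstract metric \<open>metric (markov_shift M, shift_dist)\<close> below.\<close>

lemma Metric_space_shift_dist: "Metric_space S shift_dist"
  by (rule Metric_space.intro)
    (rule shift_dist_nonneg shift_dist_commute shift_dist_eq_0_iff shift_dist_triangle)+

text \<open>Values of the functions outside \<open>markov_shift M\<close> are irrelevant.\<close>

definition UC_shift :: "(nat \<Rightarrow> nat \<Rightarrow> nat) \<Rightarrow> ((nat \<Rightarrow> nat) \<Rightarrow> real) set" where
  "UC_shift M =
    {\<phi>. uniformly_continuous_map (metric (markov_shift M, shift_dist)) euclidean_metric \<phi>}"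

lemma UC_shift_iff:
  "\<phi> \<in> UC_shift M \<longleftrightarrow>
    (\<forall>e>0. \<exists>\<delta>>0. \<forall>x\<in>markov_shift M. \<forall>y\<in>markov_shift M.
      shift_dist y x < \<delta> \<longrightarrow> \<bar>\<phi> y - \<phi> x\<bar> < e)"
proof -
  have "mspace (metric (markov_shift M, shift_dist)) = markov_shift M"
    and "mdist (metric (markov_shift M, shift_dist)) = shift_dist"
    by (rule Metric_space.mspace_metric[OF Metric_space_shift_dist]
        Metric_space.mdist_metric[OF Metric_space_shift_dist])+
  then show ?thesis
    by (simp add: UC_shift_def uniformly_continuous_map_def dist_real_def)
qed

definition invariant_measures :: "(nat \<Rightarrow> nat \<Rightarrow> nat) \<Rightarrow> (nat \<Rightarrow> nat) measure set" where
  "invariant_measures M =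
    {\<nu>. sets \<nu> = sets (restrict_space borel (markov_shift M)) \<and> prob_space \<nu> \<and>
        shift_map \<in> measurable \<nu> \<nu> \<and> distr \<nu> \<nu> shift_map = \<nu>}"

definition ergodic_measure :: "(nat \<Rightarrow> nat) measure \<Rightarrow> bool" where
  "ergodic_measure \<nu> \<longleftrightarrow>
    (\<forall>A\<in>sets \<nu>. shift_map -` A \<inter> space \<nu> = A \<longrightarrow> measure \<nu> A = 0 \<or> measure \<nu> A = 1)"

text \<open>
  Entropy of a finite or countable measurable partition of a probability space. Each summand is
  nonnegative, and \<open>0 * ln 0 = 0\<close>.
\<close>

definition partition_entropy :: "'a measure \<Rightarrow> 'a set set \<Rightarrow> ennreal" where
  "partition_entropy \<nu> \<P> = (\<Sum>\<^sub>\<infinity>A\<in>\<P>. ennreal (- (measure \<nu> A * ln (measure \<nu> A))))"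

text \<open>
  The join of the preimages of \<open>\<P>\<close> under the first \<open>n\<close> iterates of \<open>T\<close>. It may contain the empty
  set, which does not contribute to the entropy.
\<close>

definition iterated_join :: "'a measure \<Rightarrow> ('a \<Rightarrow> 'a) \<Rightarrow> 'a set set \<Rightarrow> nat \<Rightarrow> 'a set set" where
  "iterated_join \<nu> T \<P> n =
    (\<lambda>A. {x \<in> space \<nu>. \<forall>i<n. (T ^^ i) x \<in> A i}) ` ({..<n} \<rightarrow> \<P>)"

definition partition_dynamical_entropy :: "'a measure \<Rightarrow> ('a \<Rightarrow> 'a) \<Rightarrow> 'a set set \<Rightarrow> ennreal" where
  "partition_dynamical_entropy \<nu> T \<P> =
    lim (\<lambda>n. partition_entropy \<nu> (iterated_join \<nu> T \<P> n) / of_nat n)"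

text \<open>The Kolmogorov--Sinai entropy.\<close>

definition measure_entropy :: "'a measure \<Rightarrow> ('a \<Rightarrow> 'a) \<Rightarrow> ennreal" where
  "measure_entropy \<nu> T =
    (SUP \<P>\<in>{\<P>. finite \<P> \<and> partition_on (space \<nu>) \<P> \<and> \<P> \<subseteq> sets \<nu>}.
      partition_dynamical_entropy \<nu> T \<P>)"

text \<open>
  The integral of \<open>\<phi>\<close> is defined and greater than \<open>-\<infinity>\<close> iff the negative part of \<open>\<phi>\<close> has finite
  integral. This has to be stated separately from \<open>extended_integral\<close>, since \<open>\<infinity> - \<infinity> = \<infinity>\<close> in
  \<^typ>\<open>ereal\<close>. The value \<open>+\<infinity>\<close> is allowed.
\<close>

definition extended_integral :: "'a measure \<Rightarrow> ('a \<Rightarrow> real) \<Rightarrow> ereal" where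
  "extended_integral \<nu> \<phi> =
    enn2ereal (\<integral>\<^sup>+ x. ennreal (\<phi> x) \<partial>\<nu>) - enn2ereal (\<integral>\<^sup>+ x. ennreal (- \<phi> x) \<partial>\<nu>)"

definition integral_gt_minus_infinity :: "'a measure \<Rightarrow> ('a \<Rightarrow> real) \<Rightarrow> bool" where
  "integral_gt_minus_infinity \<nu> \<phi> \<longleftrightarrow> (\<integral>\<^sup>+ x. ennreal (- \<phi> x) \<partial>\<nu>) < \<infinity>"

definition free_energy :: "(nat \<Rightarrow> nat) measure \<Rightarrow> ((nat \<Rightarrow> nat) \<Rightarrow> real) \<Rightarrow> ereal" where
  "free_energy \<nu> \<phi> = enn2ereal (measure_entropy \<nu> shift_map) + extended_integral \<nu> \<phi>"

definition pressure :: "(nat \<Rightarrow> nat \<Rightarrow> nat) \<Rightarrow> ((nat \<Rightarrow> nat) \<Rightarrow> real) \<Rightarrow> ereal" where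
  "pressure M \<phi> =
    (SUP \<nu>\<in>{\<nu> \<in> invariant_measures M. integral_gt_minus_infinity \<nu> \<phi>}. free_energy \<nu> \<phi>)"

definition equilibrium_measure ::
  "(nat \<Rightarrow> nat \<Rightarrow> nat) \<Rightarrow> ((nat \<Rightarrow> nat) \<Rightarrow> real) \<Rightarrow> (nat \<Rightarrow> nat) measure \<Rightarrow> bool" where
  "equilibrium_measure M \<phi> \<nu> \<longleftrightarrow>
    \<nu> \<in> invariant_measures M \<and> integral_gt_minus_infinity \<nu> \<phi> \<and> free_energy \<nu> \<phi> = pressure M \<phi>"

end

theory Submission
  imports Defs
begin

text \<open>
  For a potential \<open>\<phi>\<close> with bounded partition functions, Gibbs' inequality gives
  \<open>h(\<nu>) + \<integral>\<phi> d\<nu> \<le> 0\<close> for all invariant \<open>\<nu>\<close>, so \<open>\<mu>\<close> is an equilibrium measure as soon as the defect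
  \<open>D(\<phi>) = - h(\<mu>) - \<integral>\<phi> d\<mu>\<close> vanishes. Start with \<open>\<phi>(x) = ln p(x\<^sub>0)\<close> for positive weights \<open>p\<close> comparable
  to \<open>\<mu>[n]\<close>; the defect is finite because \<open>H\<^sub>\<mu>\<close> is. By ergodicity and the Shannon--McMillan theorem
  there is a set \<open>T\<close> of long words of length \<open>N\<close> that carries almost all of \<open>\<mu>\<close>, has about \<open>exp (N h(\<mu>))\<close>
  elements, and on which the Birkhoff averages of \<open>\<phi>\<close> are close to \<open>\<integral>\<phi> d\<mu>\<close>. Hence \<open>\<phi>\<close> can be raised
  by nearly \<open>D(\<phi>)\<close> on \<open>T\<close> and lowered by a tiny constant off \<open>T\<close> while the partition functions stay
  bounded, and this makes the defect as small as desired at the price of a change of size about \<open>D(\<phi>)\<close>.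
  The iteration converges uniformly to a potential of defect 0.

  For uniqueness, lower \<open>\<phi>\<close> off the \<open>m\<close>-th set \<open>T\<^sub>m\<close> by a little more than necessary, and make all later
  defects much smaller than that. Then every equilibrium measure \<open>\<nu>\<close> satisfies \<open>\<nu>(T\<^sub>m) \<rightarrow> 1\<close>. As the
  words of \<open>T\<^sub>m\<close> can be chosen typical for the frequencies of more and more cylinders, \<open>\<nu>\<close> and \<open>\<mu>\<close> agree
  on cylinders.
\<close>

section \<open>Sums over words\<close>

text \<open>Entropies are handled as means of the information function \<open>info\<close>, so an
  upper estimate amounts to choosing trial weights: Gibbs' inequality bounds entropy by the cost of
  a code. This also avoids counting typical words. \<open>T\<close> consists of words to which
  weights of total mass at most 1 give at least \<open>exp (- N * (h + \<eta>))\<close>; the mass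
  bound replaces the count.

  The obstacle to changing \<open>\<phi>\<close> on long words is that changes at neighbouring
  positions overlap, so the new partition functions do not factor. Keeping one residue class of
  positions restores independence but multiplies the change by \<open>N\<close>. The exponents just
  fit: on a typical word \<open>N * D\<close> cancels against \<open>N * \<integral>\<phi>\<close>
  and the \<open>N * h\<close> of the weights, and a margin linear in \<open>N\<close> absorbs the
  distortion constant.

  The approximants see finitely many letters and stay at bounded distance from \<open>ln p\<close>,
  hence have bounded distortion. No such bound is available for the limit, so the inequalities are
  proved before passing to it. At stage \<open>m\<close> the lowering is of order
  \<open>4^-m\<close> and the defect at most \<open>8^-m\<close>: both are summable, and the ratio
  \<open>2^-m\<close> bounds the mass an equilibrium measure leaves outside the typical
  words.\<close>

definition words :: "nat \<Rightarrow> nat list set" where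
  "words n = {w. length w = n}"

lemma words_0 [simp]: "words 0 = {[]}"
  by (auto simp: words_def)

lemma bij_betw_words_append:
  "bij_betw (\<lambda>(u, v). u @ v) (words n \<times> words m) (words (n + m))"
  by (rule bij_betw_byWitness[where f' = "\<lambda>w. (take n w, drop n w)"]) (auto simp: words_def)

lemma nn_integral_count_space_Times:
  "(\<integral>\<^sup>+z. F z \<partial>count_space (A \<times> B)) = (\<integral>\<^sup>+u. \<integral>\<^sup>+v. F (u, v) \<partial>count_space B \<partial>count_space A)"
proof -
  have "(\<integral>\<^sup>+z. F z \<partial>count_space (A \<times> B)) = (\<integral>\<^sup>+z. F z * indicator (A \<times> B) z \<partial>count_space UNIV)"
    by (subst nn_integral_restrict_space[symmetric]) (auto simp: restrict_count_space)
  also have "\<dots> = (\<integral>\<^sup>+u. \<integral>\<^sup>+v. F (u, v) * indicator (A \<times> B) (u, v) \<partial>count_space UNIV \<partial>count_space UNIV)"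
    by (rule nn_integral_fst_count_space[symmetric])
  also have "\<dots> = (\<integral>\<^sup>+u. (\<integral>\<^sup>+v. F (u, v) * indicator B v \<partial>count_space UNIV) * indicator A u \<partial>count_space UNIV)"
    by (intro nn_integral_cong) (auto simp: indicator_def)
  also have "\<dots> = (\<integral>\<^sup>+u. (\<integral>\<^sup>+v. F (u, v) * indicator B v \<partial>count_space UNIV) \<partial>count_space A)"
    by (subst nn_integral_restrict_space[symmetric]) (auto simp: restrict_count_space)
  also have "\<dots> = (\<integral>\<^sup>+u. \<integral>\<^sup>+v. F (u, v) \<partial>count_space B \<partial>count_space A)"
    by (intro nn_integral_cong) (subst nn_integral_restrict_space[symmetric], auto simp: restrict_count_space)
  finally show ?thesis .
qed

lemma nn_integral_words_add:
  "(\<integral>\<^sup>+w. F w \<partial>count_space (words (n + m))) =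
    (\<integral>\<^sup>+u. \<integral>\<^sup>+v. F (u @ v) \<partial>count_space (words m) \<partial>count_space (words n))"
  using nn_integral_bij_count_space[OF bij_betw_words_append[of n m], where f = F]
  by (simp add: nn_integral_count_space_Times case_prod_beta')

lemma nn_integral_words_1:
  "(\<integral>\<^sup>+w. F w \<partial>count_space (words (Suc 0))) = (\<integral>\<^sup>+a. F [a] \<partial>count_space UNIV)"
proof -
  have "bij_betw (\<lambda>a. [a]) UNIV (words (Suc 0))"
    by (rule bij_betw_byWitness[where f' = hd]) (auto simp: words_def length_Suc_conv)
  from nn_integral_bij_count_space[OF this, where f = F] show ?thesis by simp
qed

lemma nn_integral_words_snoc:
  "(\<integral>\<^sup>+w. F w \<partial>count_space (words (Suc n))) =
    (\<integral>\<^sup>+u. \<integral>\<^sup>+a. F (u @ [a]) \<partial>count_space UNIV \<partial>count_space (words n))"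
  using nn_integral_words_add[where F = F and n = n and m = "Suc 0"] by (simp add: nn_integral_words_1)

section \<open>Gibbs' inequality\<close>

definition fiber_prob :: "'a measure \<Rightarrow> ('a \<Rightarrow> 'c) \<Rightarrow> 'c \<Rightarrow> real" where
  "fiber_prob M X c = measure M (X -` {c} \<inter> space M)"

text \<open>The information function; its mean is the Shannon entropy of a countably valued
  \<open>X\<close>. On null fibres \<open>ln 0 = 0\<close> gives the value 0.\<close>

definition info :: "'a measure \<Rightarrow> ('a \<Rightarrow> 'c) \<Rightarrow> 'a \<Rightarrow> real" where
  "info M X x = - ln (fiber_prob M X (X x))"

lemma fiber_prob_nonneg [simp]: "0 \<le> fiber_prob M X c"
  by (simp add: fiber_prob_def)

context prob_space
begin

lemma fiber_prob_le_1 [simp]: "fiber_prob M X c \<le> 1"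
  by (simp add: fiber_prob_def)

lemma info_nonneg: "0 \<le> info M X x"
  unfolding info_def using fiber_prob_nonneg[of M X "X x"] fiber_prob_le_1[of X "X x"]
  by (cases "fiber_prob M X (X x) = 0") (auto simp: less_le)

lemma borel_measurable_info [measurable]:
  assumes "X \<in> measurable M (count_space UNIV)"
  shows "info M X \<in> borel_measurable M"
  unfolding info_def[abs_def] using measurable_compose[OF assms, of "\<lambda>c. - ln (fiber_prob M X c)" borel] by simp

lemma nn_integral_discrete:
  fixes X :: "'a \<Rightarrow> 'c::countable"
  assumes X [measurable]: "X \<in> measurable M (count_space UNIV)"
  shows "(\<integral>\<^sup>+x. g (X x) \<partial>M) = (\<integral>\<^sup>+c. g c * ennreal (fiber_prob M X c) \<partial>count_space UNIV)"
proof -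
  have "(\<integral>\<^sup>+x. g (X x) \<partial>M) = (\<integral>\<^sup>+x. (\<integral>\<^sup>+c. g c * indicator (X -` {c} \<inter> space M) x \<partial>count_space UNIV) \<partial>M)"
  proof (rule nn_integral_cong)
    fix x assume "x \<in> space M"
    then have "(\<integral>\<^sup>+c. g c * indicator (X -` {c} \<inter> space M) x \<partial>count_space UNIV) =
      (\<integral>\<^sup>+c. g c * indicator {X x} c \<partial>count_space UNIV)"
      by (intro nn_integral_cong) (auto simp: indicator_def)
    also have "\<dots> = (\<integral>\<^sup>+c. g (X x) * indicator {X x} c \<partial>count_space UNIV)"
      by (intro nn_integral_cong) (auto simp: indicator_def)
    also have "\<dots> = g (X x)"
      by (subst nn_integral_cmult_indicator) auto
    finally show "g (X x) = (\<integral>\<^sup>+c. g c * indicator (X -` {c} \<inter> space M) x \<partial>count_space UNIV)" by simp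
  qed
  also have "\<dots> = (\<integral>\<^sup>+c. (\<integral>\<^sup>+x. g c * indicator (X -` {c} \<inter> space M) x \<partial>M) \<partial>count_space UNIV)"
    by (rule nn_integral_count_space_nn_integral) auto
  also have "\<dots> = (\<integral>\<^sup>+c. g c * ennreal (fiber_prob M X c) \<partial>count_space UNIV)"
    by (intro nn_integral_cong)
      (subst nn_integral_cmult_indicator, auto simp: fiber_prob_def emeasure_eq_measure)
  finally show ?thesis .
qed

text \<open>The values are countable, so the null fibres have a null union.\<close>

lemma AE_fiber_prob_pos:
  fixes X :: "'a \<Rightarrow> 'c::countable"
  assumes X [measurable]: "X \<in> measurable M (count_space UNIV)"
  shows "AE x in M. 0 < fiber_prob M X (X x)"
proof -
  have "(\<integral>\<^sup>+x. indicator {c. fiber_prob M X c = 0} (X x) \<partial>M) = 0"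
    by (subst nn_integral_discrete[OF X]) (auto simp: nn_integral_0_iff_AE AE_count_space indicator_def)
  moreover have "(\<lambda>x. indicator {c. fiber_prob M X c = 0} (X x) :: ennreal) \<in> borel_measurable M"
    using measurable_compose[OF X, of "\<lambda>c. indicator {c. fiber_prob M X c = 0} c" borel] by simp
  ultimately have "AE x in M. indicator {c. fiber_prob M X c = 0} (X x) = (0::ennreal)"
    by (simp add: nn_integral_0_iff_AE)
  then show ?thesis
    by eventually_elim (auto simp: indicator_def less_le split: if_splits)
qed

text \<open>Every entropy inequality below is an instance of this one, for a suitable weight \<open>q\<close>.\<close>

lemma Gibbs_inequality:
  fixes X :: "'a \<Rightarrow> 'c::countable" and q :: "'c \<Rightarrow> real"
  assumes X [measurable]: "X \<in> measurable M (count_space UNIV)"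
    and XS: "\<And>x. x \<in> space M \<Longrightarrow> X x \<in> S"
    and q: "\<And>c. 0 \<le> q c" and Z: "0 < Z"
    and sum: "(\<integral>\<^sup>+c. ennreal (q c) \<partial>count_space S) \<le> ennreal Z"
    and pos: "AE x in M. 0 < q (X x)"
    and int: "integrable M (\<lambda>x. ln (q (X x)))"
  shows "integrable M (info M X)" and "(\<integral>x. info M X x \<partial>M) \<le> ln Z - (\<integral>x. ln (q (X x)) \<partial>M)"
proof -
  \<comment> \<open>The density of \<open>q\<close> with respect to the law of \<open>X\<close>. Its
    mean is the mass of \<open>q\<close> on charged values, hence at most \<open>Z\<close>; values
    outside \<open>S\<close> have empty fibres.\<close>
  define r where "r c = q c / fiber_prob M X c" for c
  have r0: "0 \<le> r c" for c by (simp add: r_def q)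
  have [measurable]: "(\<lambda>x. r (X x)) \<in> borel_measurable M"
    using measurable_compose[OF X, of r borel] by simp
  have "(\<integral>\<^sup>+x. ennreal (r (X x)) \<partial>M) = (\<integral>\<^sup>+c. ennreal (r c) * ennreal (fiber_prob M X c) \<partial>count_space UNIV)"
    by (rule nn_integral_discrete[OF X])
  also have "\<dots> = (\<integral>\<^sup>+c. ennreal (r c) * ennreal (fiber_prob M X c) \<partial>count_space S)"
  proof (rule nn_integral_count_space_eq)
    fix c assume "c \<in> UNIV - S"
    with XS have "X -` {c} \<inter> space M = {}" by auto
    then show "ennreal (r c) * ennreal (fiber_prob M X c) = 0" by (simp add: fiber_prob_def)
  qed auto
  also have "\<dots> \<le> (\<integral>\<^sup>+c. ennreal (q c) \<partial>count_space S)"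
    by (intro nn_integral_mono)
      (auto simp: r_def q simp flip: ennreal_mult intro!: ennreal_leI)
  also have "\<dots> \<le> ennreal Z" by (rule sum)
  finally have le: "(\<integral>\<^sup>+x. ennreal (r (X x)) \<partial>M) \<le> ennreal Z" .
  have ir: "integrable M (\<lambda>x. r (X x))"
    by (rule integrableI_bounded) (use le r0 in \<open>auto simp: top_unique less_top[symmetric]\<close>)
  have "ennreal (\<integral>x. r (X x) \<partial>M) \<le> ennreal Z"
    using le by (subst nn_integral_eq_integral[symmetric, OF ir]) (auto simp: r0)
  then have rZ: "(\<integral>x. r (X x) \<partial>M) \<le> Z" using Z by (simp add: ennreal_le_iff)
  \<comment> \<open>This comes from \<open>ln t \<le> t - 1\<close> at \<open>t = r / Z\<close>; the
    last bracket has mean at most 0.\<close>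
  define b where "b x = ln Z - ln (q (X x)) + (r (X x) / Z - 1)" for x
  have ib: "integrable M b" unfolding b_def[abs_def] using int ir by auto
  have AE: "AE x in M. info M X x \<le> b x"
    using AE_fiber_prob_pos[OF X] pos
  proof eventually_elim
    case (elim x)
    have "ln (r (X x) / Z) \<le> r (X x) / Z - 1"
      by (rule ln_le_minus_one) (use elim Z in \<open>simp add: r_def\<close>)
    moreover have "ln (r (X x) / Z) = ln (q (X x)) - ln (fiber_prob M X (X x)) - ln Z"
      using elim Z by (simp add: r_def ln_div ln_mult)
    ultimately show ?case by (simp add: b_def info_def)
  qed
  show ii: "integrable M (info M X)"
    by (rule Bochner_Integration.integrable_bound[OF ib])
      (use AE info_nonneg[of X] in \<open>auto elim!: eventually_mono intro: order_trans[OF _ abs_ge_self]\<close>)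
  have "(\<integral>x. info M X x \<partial>M) \<le> (\<integral>x. b x \<partial>M)"
    by (rule integral_mono_AE[OF ii ib AE])
  also have "\<dots> = ln Z - (\<integral>x. ln (q (X x)) \<partial>M) + ((\<integral>x. r (X x) \<partial>M) / Z - 1)"
    unfolding b_def[abs_def] using int ir by (simp add: prob_space)
  also have "\<dots> \<le> ln Z - (\<integral>x. ln (q (X x)) \<partial>M)" using rZ Z by (simp add: field_simps)
  finally show "(\<integral>x. info M X x \<partial>M) \<le> ln Z - (\<integral>x. ln (q (X x)) \<partial>M)" .
qed

end

section \<open>The ergodic theorem\<close>

definition birkhoff_sum :: "('a \<Rightarrow> 'a) \<Rightarrow> ('a \<Rightarrow> real) \<Rightarrow> nat \<Rightarrow> 'a \<Rightarrow> real" where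
  "birkhoff_sum T f n x = (\<Sum>i<n. f ((T ^^ i) x))"

lemma birkhoff_sum_0 [simp]: "birkhoff_sum T f 0 x = 0"
  by (simp add: birkhoff_sum_def)

lemma birkhoff_sum_add:
  "birkhoff_sum T f (m + n) x = birkhoff_sum T f m x + birkhoff_sum T f n ((T ^^ m) x)"
  by (induction n) (simp_all add: birkhoff_sum_def add.commute[of m] funpow_add)

lemma birkhoff_sum_Suc:
  "birkhoff_sum T f (Suc n) x = f x + birkhoff_sum T f n (T x)"
  using birkhoff_sum_add[of T f 1 n x] by (simp add: birkhoff_sum_def)

locale measure_preserving = prob_space M for M :: "'a measure" +
  fixes T :: "'a \<Rightarrow> 'a"
  assumes measurable_T [measurable]: "T \<in> measurable M M"
    and distr_T: "distr M M T = M"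
begin

lemma measurable_funpow [measurable]: "T ^^ n \<in> measurable M M"
proof (induction n)
  case (Suc n)
  have "T ^^ Suc n = (\<lambda>x. T ((T ^^ n) x))" by (simp add: fun_eq_iff)
  then show ?case using measurable_compose[OF Suc measurable_T] by simp
qed (simp add: id_def)

lemma distr_funpow: "distr M M (T ^^ n) = M"
proof (induction n)
  case 0
  show ?case by (simp add: id_def distr_id2)
next
  case (Suc n)
  have "distr (distr M M (T ^^ n)) M T = distr M M (T \<circ> (T ^^ n))"
    by (rule distr_distr) measurable
  then show ?case using Suc distr_T by (simp add: comp_def)
qed

lemma integrable_funpow:
  fixes f :: "'a \<Rightarrow> real"
  assumes "integrable M f"
  shows "integrable M (\<lambda>x. f ((T ^^ n) x))"
  using integrable_distr[of "T ^^ n" M M f] assms by (simp add: distr_funpow)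

lemma integral_funpow:
  fixes f :: "'a \<Rightarrow> real"
  assumes "integrable M f"
  shows "(\<integral>x. f ((T ^^ n) x) \<partial>M) = (\<integral>x. f x \<partial>M)"
  using integral_distr[of "T ^^ n" M M f] assms by (simp add: distr_funpow)

lemma integrable_birkhoff_sum: "integrable M f \<Longrightarrow> integrable M (birkhoff_sum T f n)"
  unfolding birkhoff_sum_def[abs_def] by (intro Bochner_Integration.integrable_sum integrable_funpow)

lemma integral_birkhoff_sum: "integrable M f \<Longrightarrow> (\<integral>x. birkhoff_sum T f n x \<partial>M) = n * (\<integral>x. f x \<partial>M)"
  unfolding birkhoff_sum_def[abs_def] by (simp add: Bochner_Integration.integral_sum integrable_funpow integral_funpow)

end

locale ergodic_map = measure_preserving +
  assumes ergodic: "A \<in> sets M \<Longrightarrow> T -` A \<inter> space M = A \<Longrightarrow> measure M A = 0 \<or> measure M A = 1"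
begin

text \<open>A Garsia-type argument. \<open>F n\<close> is the maximum of the Birkhoff sums of
  lengths 1 to \<open>n + 1\<close>, and the set where these maxima are unbounded is invariant. If
  it had full measure, the increments of \<open>\<integral>F n\<close>, which are nonnegative, would
  converge to \<open>\<integral>f < 0\<close>.\<close>

lemma AE_birkhoff_sum_bounded_above:
  assumes f: "integrable M f" and neg: "(\<integral>x. f x \<partial>M) < 0"
  shows "AE x in M. \<exists>C. \<forall>n. birkhoff_sum T f n x \<le> C"
proof -
  define F where "F = rec_nat f (\<lambda>n g x. f x + max 0 (g (T x)))"
  have F_0: "F 0 = f" and F_Suc: "F (Suc n) x = f x + max 0 (F n (T x))" for n x
    by (simp_all add: F_def)
  note integrable_T = integrable_funpow[of _ 1, simplified]
  have iF: "integrable M (F n)" for n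
  proof (induction n)
    case (Suc n)
    have "F (Suc n) = (\<lambda>x. f x + max 0 (F n (T x)))" by (simp add: fun_eq_iff F_Suc)
    then show ?case using f integrable_T[OF Suc] by simp
  qed (simp add: F_0 f)
  then have [measurable]: "F n \<in> borel_measurable M" for n by blast
  have inc: "F n x \<le> F (Suc n) x" for n x
  proof (induction n arbitrary: x)
    case (Suc n)
    from Suc[of "T x"] show ?case by (simp add: F_Suc)
  qed (simp add: F_Suc F_0)
  have mono: "F n x \<le> F m x" if "n \<le> m" for n m x
    using that by (rule lift_Suc_mono_le[of "\<lambda>n. F n x", rotated]) (rule inc)
  have bs: "birkhoff_sum T f (Suc n) x \<le> F n x" for n x
  proof (induction n arbitrary: x)
    case 0
    show ?case by (simp add: birkhoff_sum_def F_0)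
  next
    case (Suc n)
    have "birkhoff_sum T f (Suc (Suc n)) x = f x + birkhoff_sum T f (Suc n) (T x)"
      by (rule birkhoff_sum_Suc)
    also have "\<dots> \<le> F (Suc n) x" using Suc[of "T x"] by (simp add: F_Suc)
    finally show ?case .
  qed
  \<comment> \<open>Unboundedness is tested against natural \<open>C\<close>, so that measurability
    involves only countable quantifiers.\<close>
  define A where "A = {x \<in> space M. \<forall>C::nat. \<exists>n. real C < F n x}"
  have [measurable]: "A \<in> sets M" unfolding A_def by measurable
  have A_T: "x \<in> A \<longleftrightarrow> T x \<in> A" if x: "x \<in> space M" for x
  proof -
    have Tx: "T x \<in> space M" using x measurable_space[OF measurable_T] by blast
    have "(\<forall>C::nat. \<exists>n. real C < F n x) \<longleftrightarrow> (\<forall>C::nat. \<exists>n. real C < F n (T x))"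
    proof safe
      fix C :: nat assume *: "\<forall>C::nat. \<exists>n. real C < F n x"
      obtain D :: nat where D: "real C + \<bar>f x\<bar> \<le> real D" using real_arch_simple by blast
      from * obtain n where n: "real D < F n x" by blast
      then have "real D < F (Suc n) x" using inc[of n x] by simp
      then have "real C < max 0 (F n (T x))" using D by (simp add: F_Suc)
      then show "\<exists>n. real C < F n (T x)" by (intro exI[of _ n]) (auto simp: max_def split: if_splits)
    next
      fix C :: nat assume *: "\<forall>C::nat. \<exists>n. real C < F n (T x)"
      obtain D :: nat where D: "real C + \<bar>f x\<bar> \<le> real D" using real_arch_simple by blast
      from * obtain n where n: "real D < F n (T x)" by blast
      then show "\<exists>n. real C < F n x" using D by (intro exI[of _ "Suc n"]) (simp add: F_Suc)
    qed
    then show ?thesis using x Tx by (simp add: A_def)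
  qed
  have "T -` A \<inter> space M = A" using A_T by (auto simp: A_def)
  moreover have "measure M A \<noteq> 1"
  proof
    assume 1: "measure M A = 1"
    then have AEA: "AE x in M. x \<in> A" by (simp add: AE_in_set_eq_1)
    \<comment> \<open>By invariance \<open>G n\<close> has the same mean as
      \<open>F (Suc n) - F n\<close>. It equals \<open>f x\<close> as soon as
      \<open>F n (T x)\<close> is positive, and \<open>F n \<ge> f\<close> gives the dominating
      function.\<close>
    define G where "G n x = F (Suc n) x - F n (T x)" for n x
    have G: "G n x = f x + max 0 (- F n (T x))" for n x by (simp add: G_def F_Suc)
    have iG: "integrable M (G n)" for n unfolding G_def[abs_def] using iF integrable_T by auto
    have nonneg: "0 \<le> (\<integral>x. G n x \<partial>M)" for n
    proof -
      have "(\<integral>x. F n (T x) \<partial>M) = (\<integral>x. F n x \<partial>M)" using integral_funpow[OF iF, of n 1] by simp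
      moreover have "(\<integral>x. F n x \<partial>M) \<le> (\<integral>x. F (Suc n) x \<partial>M)" by (rule integral_mono[OF iF iF inc])
      ultimately show ?thesis unfolding G_def[abs_def] using iF integrable_T by simp
    qed
    have "(\<lambda>n. \<integral>x. G n x \<partial>M) \<longlonglongrightarrow> (\<integral>x. f x \<partial>M)"
    proof (rule integral_dominated_convergence[where w = "\<lambda>x. \<bar>f x\<bar> + \<bar>f (T x)\<bar>"])
      show "AE x in M. (\<lambda>n. G n x) \<longlonglongrightarrow> f x"
        using AEA AE_space
      proof eventually_elim
        case (elim x)
        then have "T x \<in> A" using A_T by blast
        then obtain N where N: "real 0 < F N (T x)" unfolding A_def by blast
        have "G n x = f x" if "n \<ge> N" for n
          using mono[OF that, of "T x"] N by (simp add: G)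
        then show ?case by (intro tendsto_eventually) (auto simp: eventually_sequentially)
      qed
      show "AE x in M. norm (G n x) \<le> \<bar>f x\<bar> + \<bar>f (T x)\<bar>" for n
      proof (rule AE_I2)
        fix x
        have "f (T x) \<le> F n (T x)" using mono[of 0 n "T x"] by (simp add: F_0)
        then show "norm (G n x) \<le> \<bar>f x\<bar> + \<bar>f (T x)\<bar>" unfolding G real_norm_def by linarith
      qed
      show "integrable M (\<lambda>x. \<bar>f x\<bar> + \<bar>f (T x)\<bar>)" using f integrable_T by auto
    qed (use iG f in auto)
    then have "0 \<le> (\<integral>x. f x \<partial>M)" by (rule LIMSEQ_le_const) (use nonneg in auto)
    with neg show False by simp
  qed
  ultimately have "measure M A = 0" using ergodic[of A] by auto
  then have "AE x in M. x \<notin> A" by (subst AE_iff_measurable[OF \<open>A \<in> sets M\<close>]) (auto simp: A_def emeasure_eq_measure)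
  then show ?thesis
    using AE_space
  proof eventually_elim
    case (elim x)
    then obtain C :: nat where C: "\<And>n. F n x \<le> real C" unfolding A_def by (auto simp: not_less)
    have "birkhoff_sum T f n x \<le> real C" for n
    proof (cases n)
      case (Suc k)
      then show ?thesis using bs[of k x] C[of k] by simp
    qed simp
    then show ?case by blast
  qed
qed

text \<open>Subtracting slightly more than the mean makes the mean negative, and a bounded sum is
  eventually below \<open>n * e / 2\<close>. One half of the ergodic theorem; the other half is the
  same statement for \<open>- g\<close>.\<close>

lemma AE_birkhoff_sum_le:
  assumes g: "integrable M g" and e: "0 < e"
  shows "AE x in M. \<forall>\<^sub>F n in sequentially. birkhoff_sum T g n x \<le> n * ((\<integral>x. g x \<partial>M) + e)"
proof -
  define f where "f x = g x - ((\<integral>x. g x \<partial>M) + e / 2)" for x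
  have f: "integrable M f" unfolding f_def[abs_def] using g by auto
  have "(\<integral>x. f x \<partial>M) = - (e / 2)" unfolding f_def[abs_def] using g by (simp add: prob_space)
  then have "AE x in M. \<exists>C. \<forall>n. birkhoff_sum T f n x \<le> C"
    using e by (intro AE_birkhoff_sum_bounded_above[OF f]) simp
  then show ?thesis
  proof eventually_elim
    case (elim x)
    then obtain C where C: "\<And>n. birkhoff_sum T f n x \<le> C" by blast
    obtain N :: nat where N: "2 * C / e \<le> real N" using real_arch_simple by blast
    have "birkhoff_sum T g n x \<le> n * ((\<integral>x. g x \<partial>M) + e)" if "n \<ge> N" for n
    proof -
      have "birkhoff_sum T g n x = birkhoff_sum T f n x + n * ((\<integral>x. g x \<partial>M) + e / 2)"
        by (simp add: birkhoff_sum_def f_def sum_subtractf)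
      moreover have "C \<le> real n * (e / 2)"
      proof -
        have "2 * C / e \<le> real n" using N that by linarith
        then show ?thesis using e by (simp add: field_simps)
      qed
      ultimately show ?thesis using C[of n] by (simp add: field_simps)
    qed
    then show ?case unfolding eventually_sequentially by blast
  qed
qed

end

lemma (in prob_space) prob_tendsto_1:
  assumes [measurable]: "\<And>n::nat. Measurable.pred M (P n)"
    and "AE x in M. \<forall>\<^sub>F n in sequentially. P n x"
  shows "(\<lambda>n. prob {x \<in> space M. P n x}) \<longlonglongrightarrow> 1"
proof -
  have "(\<lambda>n. \<integral>x. indicator {x \<in> space M. P n x} x \<partial>M) \<longlonglongrightarrow> (\<integral>x. 1 \<partial>M :: real)"
  proof (rule integral_dominated_convergence[where w = "\<lambda>_. 1"])
    show "AE x in M. (\<lambda>n. indicator {x \<in> space M. P n x} x) \<longlonglongrightarrow> (1::real)"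
      using assms(2) AE_space
      by eventually_elim (auto intro!: tendsto_eventually elim!: eventually_mono)
  qed (auto simp: indicator_def)
  then show ?thesis by (simp add: prob_space)
qed

section \<open>Entropy of a measure-preserving map\<close>

text \<open>Connects the \<open>infsum\<close> in \<open>partition_entropy\<close> with integrals.
  Both are suprema over finite sets, and the sets \<open>D n\<close> exhaust the countable
  type.\<close>

lemma nn_integral_count_space_infsum:
  fixes g :: "'c::countable \<Rightarrow> ennreal"
  shows "(\<integral>\<^sup>+c. g c \<partial>count_space UNIV) = (\<Sum>\<^sub>\<infinity>c. g c)"
proof (rule antisym)
  define D where "D n = {c::'c. to_nat c < n}" for n :: nat
  have "finite (to_nat ` D n)" for n by (rule finite_subset[of _ "{..<n}"]) (auto simp: D_def)
  then have D: "finite (D n)" for n by (rule finite_imageD) (auto intro: inj_on_subset[OF inj_to_nat])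
  have sup: "(\<Sum>\<^sub>\<infinity>c. g c) = (SUP F\<in>{F. finite F \<and> F \<subseteq> UNIV}. sum g F)"
    by (rule nonneg_infsum_complete) simp
  have "(\<integral>\<^sup>+c. g c \<partial>count_space UNIV) = (\<integral>\<^sup>+c. (SUP n. g c * indicator (D n) c) \<partial>count_space UNIV)"
  proof (rule nn_integral_cong)
    fix c :: 'c
    show "g c = (SUP n. g c * indicator (D n) c)"
      by (intro antisym SUP_upper2[of "Suc (to_nat c)"] SUP_least) (auto simp: D_def indicator_def)
  qed
  also have "\<dots> = (SUP n. \<integral>\<^sup>+c. g c * indicator (D n) c \<partial>count_space UNIV)"
    by (rule nn_integral_monotone_convergence_SUP) (auto simp: incseq_def le_fun_def D_def indicator_def)
  also have "\<dots> \<le> (\<Sum>\<^sub>\<infinity>c. g c)"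
  proof (rule SUP_least)
    fix n
    have "(\<integral>\<^sup>+c. g c * indicator (D n) c \<partial>count_space UNIV) = (\<integral>\<^sup>+c. g c \<partial>count_space (D n))"
      by (subst nn_integral_restrict_space[symmetric]) (auto simp: restrict_count_space)
    also have "\<dots> = sum g (D n)" by (rule nn_integral_count_space_finite[OF D])
    finally show "(\<integral>\<^sup>+c. g c * indicator (D n) c \<partial>count_space UNIV) \<le> (\<Sum>\<^sub>\<infinity>c. g c)"
      unfolding sup using D by (auto intro: SUP_upper)
  qed
  finally show "(\<integral>\<^sup>+c. g c \<partial>count_space UNIV) \<le> (\<Sum>\<^sub>\<infinity>c. g c)" .
  show "(\<Sum>\<^sub>\<infinity>c. g c) \<le> (\<integral>\<^sup>+c. g c \<partial>count_space UNIV)"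
    unfolding sup
  proof (rule SUP_least)
    fix F :: "'c set" assume "F \<in> {F. finite F \<and> F \<subseteq> UNIV}"
    then have "sum g F = (\<integral>\<^sup>+c. g c \<partial>count_space F)" by (simp add: nn_integral_count_space_finite)
    also have "\<dots> = (\<integral>\<^sup>+c. g c * indicator F c \<partial>count_space UNIV)"
      by (subst nn_integral_restrict_space[symmetric]) (auto simp: restrict_count_space)
    also have "\<dots> \<le> (\<integral>\<^sup>+c. g c \<partial>count_space UNIV)"
      by (intro nn_integral_mono) (auto simp: indicator_def)
    finally show "sum g F \<le> (\<integral>\<^sup>+c. g c \<partial>count_space UNIV)" .
  qed
qed

lemma nn_integral_words_prod:
  fixes \<rho> :: "nat \<Rightarrow> nat \<Rightarrow> ennreal"
  assumes "\<And>i. (\<integral>\<^sup>+a. \<rho> i a \<partial>count_space UNIV) \<le> 1"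
  shows "(\<integral>\<^sup>+w. (\<Prod>i<n. \<rho> i (w ! i)) \<partial>count_space (words n)) \<le> 1"
proof (induction n)
  case (Suc n)
  have "(\<integral>\<^sup>+w. (\<Prod>i<Suc n. \<rho> i (w ! i)) \<partial>count_space (words (Suc n))) =
    (\<integral>\<^sup>+u. \<integral>\<^sup>+a. (\<Prod>i<n. \<rho> i (u ! i)) * \<rho> n a \<partial>count_space UNIV \<partial>count_space (words n))"
    unfolding nn_integral_words_snoc
    by (intro nn_integral_cong) (auto simp: words_def nth_append intro!: arg_cong2[where f = "(*)"] prod.cong)
  also have "\<dots> = (\<integral>\<^sup>+u. (\<Prod>i<n. \<rho> i (u ! i)) * (\<integral>\<^sup>+a. \<rho> n a \<partial>count_space UNIV) \<partial>count_space (words n))"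
    by (simp add: nn_integral_cmult)
  also have "\<dots> \<le> (\<integral>\<^sup>+u. (\<Prod>i<n. \<rho> i (u ! i)) * 1 \<partial>count_space (words n))"
    by (intro nn_integral_mono mult_left_mono assms) auto
  also have "\<dots> \<le> 1" using Suc by simp
  finally show ?case .
qed (simp add: nn_integral_count_space_finite)

section \<open>Entropy estimates for pairs of discrete variables\<close>

context prob_space
begin

lemma sum_fiber_prob:
  fixes X :: "'a \<Rightarrow> 'c::countable"
  assumes X: "X \<in> measurable M (count_space UNIV)"
  shows "(\<integral>\<^sup>+c. ennreal (fiber_prob M X c) \<partial>count_space S) \<le> 1"
proof -
  have "(\<integral>\<^sup>+c. ennreal (fiber_prob M X c) \<partial>count_space S) =
      (\<integral>\<^sup>+c. ennreal (fiber_prob M X c) * indicator S c \<partial>count_space UNIV)"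
    by (subst nn_integral_restrict_space[symmetric]) (auto simp: restrict_count_space)
  also have "\<dots> \<le> (\<integral>\<^sup>+c. 1 * ennreal (fiber_prob M X c) \<partial>count_space UNIV)"
    by (intro nn_integral_mono) (auto simp: indicator_def)
  also have "\<dots> = 1"
    by (subst nn_integral_discrete[OF X, symmetric]) (simp add: emeasure_space_1)
  finally show ?thesis .
qed

lemma measurable_count_space_Pair:
  fixes X :: "'a \<Rightarrow> 'c::countable" and Y :: "'a \<Rightarrow> 'd::countable"
  assumes [measurable]: "X \<in> measurable M (count_space UNIV)" "Y \<in> measurable M (count_space UNIV)"
  shows "(\<lambda>x. (X x, Y x)) \<in> measurable M (count_space UNIV)"
  unfolding measurable_count_space_eq2_countable
proof (intro conjI ballI)
  fix z :: "'c \<times> 'd"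
  have "(\<lambda>x. (X x, Y x)) -` {z} \<inter> space M = (X -` {fst z} \<inter> space M) \<inter> (Y -` {snd z} \<inter> space M)"
    by (cases z) auto
  also have "\<dots> \<in> sets M" by measurable
  finally show "(\<lambda>x. (X x, Y x)) -` {z} \<inter> space M \<in> sets M" .
qed auto

lemma AE_info_le_info_Pair:
  fixes X :: "'a \<Rightarrow> 'c::countable" and Y :: "'a \<Rightarrow> 'd::countable"
  assumes X [measurable]: "X \<in> measurable M (count_space UNIV)"
    and Y [measurable]: "Y \<in> measurable M (count_space UNIV)"
  shows "AE x in M. info M Y x \<le> info M (\<lambda>x. (X x, Y x)) x"
  using AE_fiber_prob_pos[OF measurable_count_space_Pair[OF X Y]]
proof eventually_elim
  case (elim x)
  have "fiber_prob M (\<lambda>x. (X x, Y x)) (X x, Y x) \<le> fiber_prob M Y (Y x)"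
    unfolding fiber_prob_def by (intro finite_measure_mono) auto
  with elim show ?case by (simp add: info_def)
qed

text \<open>\<open>Y\<close> has at most the entropy of the pair \<open>(X, Y)\<close>, and the pair
  can be coded by coding \<open>X\<close> optimally and then \<open>Y\<close> with the kernel
  \<open>q (X x)\<close>. Formally this is Gibbs' inequality for the weight \<open>Q\<close>, the
  law of \<open>X\<close> times the kernel.\<close>

lemma conditional_Gibbs_inequality:
  fixes X :: "'a \<Rightarrow> 'c::countable" and Y :: "'a \<Rightarrow> 'd::countable" and q :: "'c \<Rightarrow> 'd \<Rightarrow> real"
  assumes X [measurable]: "X \<in> measurable M (count_space UNIV)"
    and Y [measurable]: "Y \<in> measurable M (count_space UNIV)"
    and YS: "\<And>x. x \<in> space M \<Longrightarrow> Y x \<in> S"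
    and q: "\<And>c d. 0 \<le> q c d"
    and sum: "\<And>c. (\<integral>\<^sup>+d. ennreal (q c d) \<partial>count_space S) \<le> 1"
    and pos: "AE x in M. 0 < q (X x) (Y x)"
    and intX: "integrable M (info M X)"
    and int: "integrable M (\<lambda>x. ln (q (X x) (Y x)))"
  shows "integrable M (info M Y)"
    and "(\<integral>x. info M Y x \<partial>M) \<le> (\<integral>x. info M X x \<partial>M) - (\<integral>x. ln (q (X x) (Y x)) \<partial>M)"
proof -
  define V where "V x = (X x, Y x)" for x
  define Q where "Q z = fiber_prob M X (fst z) * q (fst z) (snd z)" for z
  have V [measurable]: "V \<in> measurable M (count_space UNIV)"
    unfolding V_def[abs_def] by (rule measurable_count_space_Pair) measurable
  have "(\<integral>\<^sup>+z. ennreal (Q z) \<partial>count_space (UNIV \<times> S)) =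
      (\<integral>\<^sup>+c. ennreal (fiber_prob M X c) * (\<integral>\<^sup>+d. ennreal (q c d) \<partial>count_space S) \<partial>count_space UNIV)"
    unfolding nn_integral_count_space_Times Q_def fst_conv snd_conv
    by (intro nn_integral_cong) (simp add: ennreal_mult q nn_integral_cmult)
  also have "\<dots> \<le> (\<integral>\<^sup>+c. ennreal (fiber_prob M X c) * 1 \<partial>count_space UNIV)"
    by (intro nn_integral_mono mult_left_mono sum) auto
  also have "\<dots> \<le> 1" using sum_fiber_prob[OF X, of UNIV] by simp
  finally have Q: "(\<integral>\<^sup>+z. ennreal (Q z) \<partial>count_space (UNIV \<times> S)) \<le> ennreal 1" by simp
  have posQ: "AE x in M. 0 < Q (V x)"
    using pos AE_fiber_prob_pos[OF X] by eventually_elim (simp add: Q_def V_def)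
  have lnQ: "AE x in M. ln (Q (V x)) = ln (q (X x) (Y x)) - info M X x"
    using pos AE_fiber_prob_pos[OF X] by eventually_elim (simp add: Q_def V_def info_def ln_mult)
  have [measurable]: "(\<lambda>x. ln (Q (V x))) \<in> borel_measurable M"
    using measurable_compose[OF V, of "\<lambda>z. ln (Q z)" borel] by simp
  have intQ: "integrable M (\<lambda>x. ln (Q (V x)))"
    by (subst integrable_cong_AE[OF _ _ lnQ]) (use int intX in auto)
  have VS: "V x \<in> UNIV \<times> S" if "x \<in> space M" for x using YS[OF that] by (simp add: V_def)
  have Q0: "0 \<le> Q z" for z by (simp add: Q_def q)
  note G = Gibbs_inequality[OF V VS Q0 zero_less_one Q posQ intQ]
  have le: "AE x in M. info M Y x \<le> info M V x"
    unfolding V_def[abs_def] by (rule AE_info_le_info_Pair[OF X Y])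
  show i: "integrable M (info M Y)"
    by (rule Bochner_Integration.integrable_bound[OF G(1)])
      (use le info_nonneg[of Y] in \<open>auto elim!: eventually_mono intro: order_trans[OF _ abs_ge_self]\<close>)
  have "(\<integral>x. info M Y x \<partial>M) \<le> (\<integral>x. info M V x \<partial>M)" by (rule integral_mono_AE[OF i G(1) le])
  also have "\<dots> \<le> - (\<integral>x. ln (Q (V x)) \<partial>M)" using G(2) by simp
  also have "(\<integral>x. ln (Q (V x)) \<partial>M) = (\<integral>x. ln (q (X x) (Y x)) - info M X x \<partial>M)"
    by (rule integral_cong_AE[OF _ _ lnQ]) (use int intX in auto)
  finally show "(\<integral>x. info M Y x \<partial>M) \<le> (\<integral>x. info M X x \<partial>M) - (\<integral>x. ln (q (X x) (Y x)) \<partial>M)"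
    using int intX by simp
qed

end

section \<open>Itineraries and their block entropies\<close>

definition itinerary :: "('a \<Rightarrow> 'a) \<Rightarrow> ('a \<Rightarrow> nat) \<Rightarrow> nat \<Rightarrow> 'a \<Rightarrow> nat list" where
  "itinerary T f n x = map (\<lambda>i. f ((T ^^ i) x)) [0..<n]"

lemma length_itinerary [simp]: "length (itinerary T f n x) = n"
  by (simp add: itinerary_def)

lemma itinerary_in_words: "itinerary T f n x \<in> words n"
  by (simp add: words_def)

lemma nth_itinerary: "i < n \<Longrightarrow> itinerary T f n x ! i = f ((T ^^ i) x)"
  by (simp add: itinerary_def)

lemma itinerary_add: "itinerary T f (m + n) x = itinerary T f m x @ itinerary T f n ((T ^^ m) x)"
  by (rule nth_equalityI) (auto simp: nth_itinerary nth_append funpow_add[symmetric, THEN fun_cong, simplified])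

lemma take_drop_itinerary:
  "m + k \<le> n \<Longrightarrow> take k (drop m (itinerary T f n x)) = itinerary T f k ((T ^^ m) x)"
  by (rule nth_equalityI)
    (auto simp: nth_itinerary funpow_add[symmetric, THEN fun_cong, simplified] add.commute)

context measure_preserving
begin

lemma measurable_itinerary:
  assumes [measurable]: "f \<in> measurable M (count_space UNIV)"
  shows "itinerary T f n \<in> measurable M (count_space UNIV)"
  unfolding measurable_count_space_eq2_countable
proof (intro conjI ballI)
  fix w :: "nat list"
  have "itinerary T f n -` {w} \<inter> space M = {x \<in> space M. n = length w \<and> (\<forall>i<n. f ((T ^^ i) x) = w ! i)}"
    by (auto simp: list_eq_iff_nth_eq nth_itinerary)
  also have "\<dots> \<in> sets M" by measurable
  finally show "itinerary T f n -` {w} \<inter> space M \<in> sets M" .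
qed auto

lemma AE_funpow: "AE x in M. P x \<Longrightarrow> AE x in M. P ((T ^^ n) x)"
  by (rule AE_distrD[OF measurable_funpow[of n]]) (subst distr_funpow)

text \<open>The trial weight is the product of the laws of the prefix and the suffix; invariance
  turns the cost of the suffix into an entropy at time 0.\<close>

lemma info_itinerary_add:
  assumes f [measurable]: "f \<in> measurable M (count_space UNIV)"
    and m: "integrable M (info M (itinerary T f m))" and n: "integrable M (info M (itinerary T f n))"
  shows "integrable M (info M (itinerary T f (m + n)))"
    and "(\<integral>x. info M (itinerary T f (m + n)) x \<partial>M) \<le>
      (\<integral>x. info M (itinerary T f m) x \<partial>M) + (\<integral>x. info M (itinerary T f n) x \<partial>M)"
proof -
  note meas = measurable_itinerary[OF f]
  let ?r = "\<lambda>n. fiber_prob M (itinerary T f n)"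
  define q where "q w = ?r m (take m w) * ?r n (drop m w)" for w
  have "(\<integral>\<^sup>+w. ennreal (q w) \<partial>count_space (words (m + n))) =
      (\<integral>\<^sup>+u. \<integral>\<^sup>+v. ennreal (?r m u) * ennreal (?r n v) \<partial>count_space (words n) \<partial>count_space (words m))"
    unfolding nn_integral_words_add
    by (intro nn_integral_cong) (simp add: q_def words_def ennreal_mult)
  also have "\<dots> = (\<integral>\<^sup>+u. ennreal (?r m u) * (\<integral>\<^sup>+v. ennreal (?r n v) \<partial>count_space (words n)) \<partial>count_space (words m))"
    by (simp add: nn_integral_cmult)
  also have "\<dots> \<le> (\<integral>\<^sup>+u. ennreal (?r m u) * 1 \<partial>count_space (words m))"
    by (intro nn_integral_mono mult_left_mono sum_fiber_prob meas) auto
  also have "\<dots> \<le> ennreal 1" using sum_fiber_prob[OF meas] by simp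
  finally have sum: "(\<integral>\<^sup>+w. ennreal (q w) \<partial>count_space (words (m + n))) \<le> ennreal 1" .
  have q_it: "q (itinerary T f (m + n) x) = ?r m (itinerary T f m x) * ?r n (itinerary T f n ((T ^^ m) x))" for x
    by (simp add: q_def itinerary_add)
  have p1: "AE x in M. 0 < ?r m (itinerary T f m x)" by (rule AE_fiber_prob_pos[OF meas])
  have p2: "AE x in M. 0 < ?r n (itinerary T f n ((T ^^ m) x))"
    by (rule AE_funpow) (rule AE_fiber_prob_pos[OF meas])
  have pos: "AE x in M. 0 < q (itinerary T f (m + n) x)"
    using p1 p2 by eventually_elim (simp add: q_it)
  have lnq: "AE x in M. ln (q (itinerary T f (m + n) x)) =
      - info M (itinerary T f m) x - info M (itinerary T f n) ((T ^^ m) x)"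
    using p1 p2 by eventually_elim (simp add: q_it info_def ln_mult)
  have [measurable]: "(\<lambda>x. ln (q (itinerary T f (m + n) x))) \<in> borel_measurable M"
    using measurable_compose[OF meas, of "\<lambda>w. ln (q w)" borel] by simp
  note nT = integrable_funpow[OF n, of m]
  have int: "integrable M (\<lambda>x. ln (q (itinerary T f (m + n) x)))"
    by (subst integrable_cong_AE[OF _ _ lnq]) (use m nT in auto)
  have "0 \<le> q w" for w by (simp add: q_def)
  note G = Gibbs_inequality[OF meas itinerary_in_words this zero_less_one sum pos int]
  show "integrable M (info M (itinerary T f (m + n)))" by (rule G(1))
  have "(\<integral>x. ln (q (itinerary T f (m + n) x)) \<partial>M) =
      (\<integral>x. - info M (itinerary T f m) x - info M (itinerary T f n) ((T ^^ m) x) \<partial>M)"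
    by (rule integral_cong_AE[OF _ _ lnq]) (use m nT in auto)
  also have "\<dots> = - (\<integral>x. info M (itinerary T f m) x \<partial>M) - (\<integral>x. info M (itinerary T f n) x \<partial>M)"
    using m nT integral_funpow[OF n, of m] by simp
  finally show "(\<integral>x. info M (itinerary T f (m + n)) x \<partial>M) \<le>
      (\<integral>x. info M (itinerary T f m) x \<partial>M) + (\<integral>x. info M (itinerary T f n) x \<partial>M)"
    using G(2) by simp
qed

lemma info_itinerary_0: "x \<in> space M \<Longrightarrow> info M (itinerary T f 0) x = 0"
proof -
  have "itinerary T f 0 -` {[]} \<inter> space M = space M" by (auto simp: itinerary_def)
  then show ?thesis by (simp add: info_def fiber_prob_def prob_space itinerary_def)
qed

lemma integrable_info_itinerary_0: "integrable M (info M (itinerary T f 0))"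
proof -
  have "integrable M (info M (itinerary T f 0)) \<longleftrightarrow> integrable M (\<lambda>_. 0 :: real)"
    by (rule Bochner_Integration.integrable_cong[OF refl info_itinerary_0])
  then show ?thesis by simp
qed

lemma integral_info_itinerary_0: "(\<integral>x. info M (itinerary T f 0) x \<partial>M) = 0"
  by (subst Bochner_Integration.integral_cong[OF refl info_itinerary_0]) auto

lemma info_itinerary_1: "info M (itinerary T f (Suc 0)) = info M f"
proof -
  have "itinerary T f (Suc 0) = (\<lambda>x. [f x])" by (simp add: itinerary_def fun_eq_iff)
  then show ?thesis by (simp add: info_def fiber_prob_def fun_eq_iff vimage_def)
qed

lemma integrable_info_itinerary:
  assumes f: "f \<in> measurable M (count_space UNIV)" and i: "integrable M (info M f)"
  shows "integrable M (info M (itinerary T f n))"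
proof (induction n)
  case (Suc n)
  then show ?case using info_itinerary_add(1)[OF f Suc, of "Suc 0"] i by (simp add: info_itinerary_1)
qed (rule integrable_info_itinerary_0)

text \<open>Coding letter by letter: given \<open>X\<close>, the letter at time \<open>i\<close> is
  coded with the weights \<open>\<rho> (X x) i\<close>, at a cost that is \<open>l\<close> along the
  orbit. The total cost is a Birkhoff sum, so its mean is \<open>n\<close> times that of
  \<open>l\<close>. Both comparisons between the entropies of different partitions below rest on
  this.\<close>

lemma conditional_Gibbs_itinerary:
  fixes X :: "'a \<Rightarrow> 'c::countable" and \<rho> :: "'c \<Rightarrow> nat \<Rightarrow> nat \<Rightarrow> real"
  assumes X: "X \<in> measurable M (count_space UNIV)" and f: "f \<in> measurable M (count_space UNIV)"
    and \<rho>: "\<And>c i a. 0 \<le> \<rho> c i a"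
    and sum: "\<And>c i. (\<integral>\<^sup>+a. ennreal (\<rho> c i a) \<partial>count_space UNIV) \<le> 1"
    and intX: "integrable M (info M X)"
    and l: "integrable M l"
    and rho_log: "AE x in M. \<forall>i<n. 0 < \<rho> (X x) i (f ((T ^^ i) x)) \<and> ln (\<rho> (X x) i (f ((T ^^ i) x))) = - l ((T ^^ i) x)"
  shows "integrable M (info M (itinerary T f n))"
    and "(\<integral>x. info M (itinerary T f n) x \<partial>M) \<le> (\<integral>x. info M X x \<partial>M) + n * (\<integral>x. l x \<partial>M)"
proof -
  define q where "q c w = (\<Prod>i<n. \<rho> c i (w ! i))" for c w
  have q0: "0 \<le> q c w" for c w by (simp add: q_def prod_nonneg \<rho>)
  have sumq: "(\<integral>\<^sup>+w. ennreal (q c w) \<partial>count_space (words n)) \<le> 1" for c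
    using nn_integral_words_prod[of "\<lambda>i a. ennreal (\<rho> c i a)" n] sum
    by (simp add: q_def prod_ennreal \<rho>)
  note Y = measurable_itinerary[OF f, of n]
  have pos: "AE x in M. 0 < q (X x) (itinerary T f n x)"
    using rho_log by eventually_elim (auto simp: q_def nth_itinerary intro!: prod_pos)
  have lnq: "AE x in M. ln (q (X x) (itinerary T f n x)) = - birkhoff_sum T l n x"
    using rho_log
  proof eventually_elim
    case (elim x)
    then have "ln (q (X x) (itinerary T f n x)) = (\<Sum>i<n. ln (\<rho> (X x) i (f ((T ^^ i) x))))"
      unfolding q_def by (subst ln_prod) (auto simp: nth_itinerary)
    also have "\<dots> = (\<Sum>i<n. - l ((T ^^ i) x))" using elim by (intro sum.cong) auto
    finally show ?case by (simp add: birkhoff_sum_def sum_negf)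
  qed
  note ib = integrable_birkhoff_sum[OF l, of n]
  have [measurable]: "(\<lambda>x. ln (q (X x) (itinerary T f n x))) \<in> borel_measurable M"
    using measurable_compose[OF measurable_count_space_Pair[OF X Y], of "\<lambda>(c, w). ln (q c w)" borel] by simp
  have int: "integrable M (\<lambda>x. ln (q (X x) (itinerary T f n x)))"
    by (subst integrable_cong_AE[OF _ _ lnq]) (use ib in auto)
  note G = conditional_Gibbs_inequality[OF X Y itinerary_in_words q0 sumq pos intX int]
  show "integrable M (info M (itinerary T f n))" by (rule G(1))
  have "(\<integral>x. ln (q (X x) (itinerary T f n x)) \<partial>M) = (\<integral>x. - birkhoff_sum T l n x \<partial>M)"
    by (rule integral_cong_AE[OF _ _ lnq]) (use ib in auto)
  then show "(\<integral>x. info M (itinerary T f n) x \<partial>M) \<le> (\<integral>x. info M X x \<partial>M) + n * (\<integral>x. l x \<partial>M)"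
    using G(2) by (simp add: integral_birkhoff_sum[OF l])
qed

end

text \<open>Fekete's lemma: divide \<open>n\<close> with remainder by an \<open>m\<close> that
  almost attains the infimum. Convergence matters because \<open>partition_dynamical_entropy\<close>
  is defined by \<open>lim\<close>.\<close>

lemma Fekete_convergent:
  fixes H :: "nat \<Rightarrow> real"
  assumes nonneg: "\<And>n. 0 \<le> H n" and sub: "\<And>m n. H (m + n) \<le> H m + H n"
  shows "convergent (\<lambda>n. H n / n)"
proof -
  define L where "L = (INF n\<in>{1..}. H n / real n)"
  have bdd: "bdd_below ((\<lambda>n. H n / real n) ` {1..})"
    by (rule bdd_belowI[of _ 0]) (auto simp: nonneg)
  have "\<exists>N. \<forall>n\<ge>N. norm (H n / n - L) < e" if e: "0 < e" for e
  proof -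
    have "(INF n\<in>{1..}. H n / real n) < L + e / 2" using e by (simp add: L_def)
    then obtain m where m: "1 \<le> m" "H m / m < L + e / 2"
      using cINF_less_iff[of "{1..}" "\<lambda>n. H n / real n" "L + e / 2"] bdd by auto
    define C where "C = (\<Sum>r<m. H r)"
    have C: "H r \<le> C" if "r < m" for r
      unfolding C_def by (rule member_le_sum) (use that nonneg in auto)
    have mult: "H (q * m + r) \<le> q * H m + H r" for q r
    proof (induction q)
      case (Suc q)
      have "H (Suc q * m + r) = H (m + (q * m + r))" by (simp add: algebra_simps)
      also have "\<dots> \<le> H m + H (q * m + r)" by (rule sub)
      finally show ?case using Suc by (simp add: algebra_simps)
    qed simp
    obtain N :: nat where N: "2 * C / e < real N" using reals_Archimedean2 by blast
    have "norm (H n / n - L) < e" if n: "n \<ge> Suc N" for n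
    proof -
      have "H n \<le> (n div m) * H m + C"
        using mult[of "n div m" "n mod m"] C[of "n mod m"] m by simp
      also have "real (n div m) * H m \<le> real n / real m * H m"
        by (intro mult_right_mono of_nat_div_le_of_nat nonneg)
      finally have "H n / n \<le> (real n / real m * H m + C) / n" by (simp add: divide_right_mono)
      also have "\<dots> = H m / m + C / n" using n by (simp add: add_divide_distrib)
      finally have "H n / n \<le> H m / m + C / n" .
      moreover have "C / n < e / 2"
      proof -
        have "2 * C / e < real n" using N n by linarith
        then show ?thesis using e n by (simp add: field_simps)
      qed
      moreover have "L \<le> H n / n"
        unfolding L_def by (rule cINF_lower[OF bdd]) (use n in auto)
      ultimately have "H n / n - L < e" "L \<le> H n / n" using m(2) by linarith+
      then show ?thesis by simp
    qed
    then show ?thesis by blast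
  qed
  then have "(\<lambda>n. H n / n) \<longlonglongrightarrow> L" by (auto simp: LIMSEQ_iff)
  then show ?thesis by (rule convergentI)
qed

text \<open>The partition is compared with the fibres only up to the empty set, which iterated joins
  and \<open>cylinder_partition\<close> may contain and which contributes 0.\<close>

lemma (in prob_space) partition_entropy_fibers:
  fixes X :: "'a \<Rightarrow> 'c::countable"
  assumes X: "X \<in> measurable M (count_space UNIV)"
    and Q: "Q - {{}} = (\<lambda>c. X -` {c} \<inter> space M) ` X ` space M"
  shows "partition_entropy M Q = (\<integral>\<^sup>+x. ennreal (info M X x) \<partial>M)"
proof -
  define F where "F A = ennreal (- (measure M A * ln (measure M A)))" for A
  let ?fib = "\<lambda>c. X -` {c} \<inter> space M"
  have inj: "inj_on ?fib (X ` space M)" by (rule inj_onI) blast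
  have "partition_entropy M Q = (\<Sum>\<^sub>\<infinity>A\<in>Q. F A)" by (simp add: partition_entropy_def F_def)
  also have "\<dots> = (\<Sum>\<^sub>\<infinity>A\<in>Q - {{}}. F A)" by (rule infsum_cong_neutral) (auto simp: F_def)
  also have "\<dots> = (\<Sum>\<^sub>\<infinity>c\<in>X ` space M. (F \<circ> ?fib) c)" unfolding Q by (rule infsum_reindex[OF inj])
  also have "\<dots> = (\<Sum>\<^sub>\<infinity>c. ennreal (- (fiber_prob M X c * ln (fiber_prob M X c))))"
  proof (rule infsum_cong_neutral)
    fix c assume "c \<in> UNIV - X ` space M"
    then have "X -` {c} \<inter> space M = {}" by auto
    then show "ennreal (- (fiber_prob M X c * ln (fiber_prob M X c))) = 0" by (simp add: fiber_prob_def)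
  qed (auto simp: F_def fiber_prob_def)
  also have "\<dots> = (\<integral>\<^sup>+c. ennreal (- (fiber_prob M X c * ln (fiber_prob M X c))) \<partial>count_space UNIV)"
    by (rule nn_integral_count_space_infsum[symmetric])
  also have "\<dots> = (\<integral>\<^sup>+c. ennreal (- ln (fiber_prob M X c)) * ennreal (fiber_prob M X c) \<partial>count_space UNIV)"
    by (intro nn_integral_cong) (simp add: ennreal_mult'[symmetric] ennreal_mult''[symmetric] mult.commute)
  also have "\<dots> = (\<integral>\<^sup>+x. ennreal (info M X x) \<partial>M)"
    unfolding info_def by (rule nn_integral_discrete[OF X, symmetric])
  finally show ?thesis .
qed

lemma (in prob_space) finite_partition_labelling:
  assumes fin: "finite P" and P: "partition_on (space M) P" and sets: "P \<subseteq> sets M"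
  obtains f :: "'a \<Rightarrow> nat" and K where "f \<in> measurable M (count_space UNIV)"
    "\<And>x. x \<in> space M \<Longrightarrow> f x < K" "P = (\<lambda>c. f -` {c} \<inter> space M) ` f ` space M"
proof -
  obtain e where e: "bij_betw e P {0..<card P}" using ex_bij_betw_finite_nat[OF fin] by blast
  define f where "f x = e (THE A. A \<in> P \<and> x \<in> A)" for x
  have f: "f x = e A" if "A \<in> P" "x \<in> A" for x A
  proof -
    have "(THE B. B \<in> P \<and> x \<in> B) = A"
      using that partition_onD2[OF P] by (intro the_equality) (auto dest: disjointD)
    then show ?thesis by (simp add: f_def)
  qed
  have cover: "\<exists>A\<in>P. x \<in> A" if "x \<in> space M" for x
    using partition_onD1[OF P] that by auto
  have sub: "A \<subseteq> space M" if "A \<in> P" for A using partition_onD1[OF P] that by auto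
  have inj: "inj_on e P" using e by (rule bij_betw_imp_inj_on)
  have fib: "f -` {f x} \<inter> space M = A" if "A \<in> P" "x \<in> A" for x A
  proof (intro equalityI subsetI)
    fix y assume "y \<in> f -` {f x} \<inter> space M"
    then have y: "f y = f x" "y \<in> space M" by auto
    then obtain B where "B \<in> P" "y \<in> B" using cover by blast
    then show "y \<in> A" using y f that inj by (metis inj_onD)
  next
    fix y assume "y \<in> A"
    then show "y \<in> f -` {f x} \<inter> space M" using f that sub by auto
  qed
  show thesis
  proof
    show "f \<in> measurable M (count_space UNIV)"
      unfolding measurable_count_space_eq2_countable
    proof (intro conjI ballI)
      fix c :: nat
      show "f -` {c} \<inter> space M \<in> sets M"
      proof (cases "c \<in> f ` space M")
        case True
        then obtain x where "x \<in> space M" "c = f x" by auto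
        with cover fib sets show ?thesis by (metis subsetD)
      next
        case False
        then have "f -` {c} \<inter> space M = {}" by auto
        then show ?thesis by (metis sets.empty_sets)
      qed
    qed auto
    show "f x < card P" if "x \<in> space M" for x
      using cover[OF that] f e by (metis atLeastLessThan_iff bij_betwE)
    show "P = (\<lambda>c. f -` {c} \<inter> space M) ` f ` space M"
    proof (intro equalityI subsetI)
      fix A assume A: "A \<in> P"
      then obtain x where "x \<in> A" using partition_onD3[OF P] by (metis ex_in_conv)
      then show "A \<in> (\<lambda>c. f -` {c} \<inter> space M) ` f ` space M" using fib[OF A] sub[OF A] by blast
    next
      fix A assume "A \<in> (\<lambda>c. f -` {c} \<inter> space M) ` f ` space M"
      then show "A \<in> P" using cover fib by auto
    qed
  qed
qed

section \<open>Finite partitions against a countable generator\<close>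

context measure_preserving
begin

lemma funpow_in_space: "x \<in> space M \<Longrightarrow> (T ^^ i) x \<in> space M"
  using measurable_space[OF measurable_funpow] .

lemma iterated_join_fibers:
  fixes f :: "'a \<Rightarrow> nat"
  assumes P: "P = (\<lambda>c. f -` {c} \<inter> space M) ` f ` space M"
  shows "iterated_join M T P n - {{}} = (\<lambda>c. itinerary T f n -` {c} \<inter> space M) ` itinerary T f n ` space M"
proof -
  have fib: "itinerary T f n -` {itinerary T f n x} \<inter> space M =
      {y \<in> space M. \<forall>i<n. f ((T ^^ i) y) = f ((T ^^ i) x)}" for x
    by (auto simp: list_eq_iff_nth_eq nth_itinerary)
  show ?thesis
  proof (intro equalityI subsetI)
    fix Q assume "Q \<in> iterated_join M T P n - {{}}"
    then obtain A x where A: "\<And>i. i < n \<Longrightarrow> A i \<in> P" and Q: "Q = {y \<in> space M. \<forall>i<n. (T ^^ i) y \<in> A i}"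
      and x: "x \<in> Q" by (auto simp: iterated_join_def Pi_iff)
    have "(T ^^ i) y \<in> A i \<longleftrightarrow> f ((T ^^ i) y) = f ((T ^^ i) x)" if "i < n" "y \<in> space M" for i y
      using A[OF that(1)] x that funpow_in_space[OF that(2), of i] unfolding Q P by auto
    then have "Q = itinerary T f n -` {itinerary T f n x} \<inter> space M" unfolding fib Q by auto
    then show "Q \<in> (\<lambda>c. itinerary T f n -` {c} \<inter> space M) ` itinerary T f n ` space M"
      using x Q by blast
  next
    fix Q assume "Q \<in> (\<lambda>c. itinerary T f n -` {c} \<inter> space M) ` itinerary T f n ` space M"
    then obtain x where x: "x \<in> space M" and Q: "Q = itinerary T f n -` {itinerary T f n x} \<inter> space M" by auto
    define A where "A i = f -` {f ((T ^^ i) x)} \<inter> space M" for i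
    have "A \<in> {..<n} \<rightarrow> P" unfolding P A_def using funpow_in_space[OF x] by auto
    moreover have "Q = {y \<in> space M. \<forall>i<n. (T ^^ i) y \<in> A i}"
      unfolding Q fib A_def using funpow_in_space by auto
    moreover have "x \<in> Q" using x by (simp add: Q)
    ultimately show "Q \<in> iterated_join M T P n - {{}}" by (auto simp: iterated_join_def)
  qed
qed

lemma integrable_info_finite_range:
  fixes f :: "'a \<Rightarrow> nat"
  assumes f: "f \<in> measurable M (count_space UNIV)" and K: "\<And>x. x \<in> space M \<Longrightarrow> f x < K"
  shows "integrable M (info M f)"
proof -
  \<comment> \<open>The trial weight is constantly 1; \<open>Suc K\<close> instead of
    \<open>K\<close> keeps the mass bound positive without a case distinction.\<close>
  have "(\<integral>\<^sup>+c. ennreal 1 \<partial>count_space {..<K}) \<le> ennreal (real (Suc K))"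
    by (simp add: nn_integral_count_space_finite ennreal_of_nat_eq_real_of_nat)
  from Gibbs_inequality(1)[OF f _ _ _ this] K show ?thesis by simp
qed

lemma partition_dynamical_entropy_tendsto:
  fixes f :: "'a \<Rightarrow> nat"
  assumes f: "f \<in> measurable M (count_space UNIV)" and K: "\<And>x. x \<in> space M \<Longrightarrow> f x < K"
    and P: "P = (\<lambda>c. f -` {c} \<inter> space M) ` f ` space M"
  obtains L where "(\<lambda>n. (\<integral>x. info M (itinerary T f n) x \<partial>M) / n) \<longlonglongrightarrow> L"
    "partition_dynamical_entropy M T P = ennreal L"
proof -
  define H where "H n = (\<integral>x. info M (itinerary T f n) x \<partial>M)" for n
  have "integrable M (info M f)" by (rule integrable_info_finite_range[OF f]) (rule K)
  note i = integrable_info_itinerary[OF f this]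
  have H0: "0 \<le> H n" for n unfolding H_def by (simp add: info_nonneg)
  have "convergent (\<lambda>n. H n / n)"
    by (rule Fekete_convergent[OF H0]) (simp add: H_def info_itinerary_add(2)[OF f i i])
  then obtain L where L: "(\<lambda>n. H n / n) \<longlonglongrightarrow> L" by (auto simp: convergent_def)
  have pe: "partition_entropy M (iterated_join M T P n) = ennreal (H n)" for n
    unfolding partition_entropy_fibers[OF measurable_itinerary[OF f] iterated_join_fibers[OF P]] H_def
    by (rule nn_integral_eq_integral[OF i]) (simp add: info_nonneg)
  have "(\<lambda>n. ennreal (H n / n)) \<longlonglongrightarrow> ennreal L" using L by (rule tendsto_ennrealI)
  moreover have "eventually (\<lambda>n. ennreal (H n / n) = partition_entropy M (iterated_join M T P n) / of_nat n) sequentially"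
    unfolding eventually_sequentially
    by (rule exI[of _ 1]) (auto simp: pe ennreal_of_nat_eq_real_of_nat divide_ennreal H0)
  ultimately have "(\<lambda>n. partition_entropy M (iterated_join M T P n) / of_nat n) \<longlonglongrightarrow> ennreal L"
    by (rule Lim_transform_eventually)
  then have "partition_dynamical_entropy M T P = ennreal L"
    unfolding partition_dynamical_entropy_def by (rule limI)
  with L show thesis using that unfolding H_def by blast
qed

text \<open>The Kolmogorov-Sinai theorem on generators, by explicit coding. A long
  \<open>g\<close>-word predicts the letters of any finite-valued \<open>f\<close> with rare errors;
  a correct prediction is almost free, and the errors are too rare to matter.\<close>

lemma measure_entropy_le:
  fixes g :: "'a \<Rightarrow> nat" and a C :: real
  assumes g: "g \<in> measurable M (count_space UNIV)" and ig: "integrable M (info M g)"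
    and generating: "\<And>f (K :: nat) \<delta>. f \<in> measurable M (count_space UNIV) \<Longrightarrow> (\<And>x. x \<in> space M \<Longrightarrow> f x < K) \<Longrightarrow>
      0 < \<delta> \<Longrightarrow> \<exists>k Y. prob {x \<in> space M. f x \<noteq> Y (itinerary T g k x)} \<le> \<delta>"
    and bound: "\<And>n. (\<integral>x. info M (itinerary T g n) x \<partial>M) \<le> n * a + C"
  shows "measure_entropy M T \<le> ennreal a"
  unfolding measure_entropy_def
proof (rule SUP_least)
  fix P assume "P \<in> {P. finite P \<and> partition_on (space M) P \<and> P \<subseteq> sets M}"
  then obtain f :: "'a \<Rightarrow> nat" and K where f: "f \<in> measurable M (count_space UNIV)"
    and K: "\<And>x. x \<in> space M \<Longrightarrow> f x < K" and P: "P = (\<lambda>c. f -` {c} \<inter> space M) ` f ` space M"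
    using finite_partition_labelling by blast
  obtain L where L: "(\<lambda>n. (\<integral>x. info M (itinerary T f n) x \<partial>M) / n) \<longlonglongrightarrow> L"
    and PL: "partition_dynamical_entropy M T P = ennreal L"
    using partition_dynamical_entropy_tendsto[OF f K P] by blast
  note [measurable] = f g
  have "L \<le> a + e" if e: "0 < e" for e :: real
  proof -
    \<comment> \<open>Chosen so that a correct prediction costs \<open>- ln (1 - d) = e / 2\<close>.
      An error costs \<open>ln (K / d)\<close>, and its probability is made so small that errors
      cost another \<open>e / 2\<close> on average.\<close>
    define d where "d = 1 - exp (- (e / 2))"
    have d: "0 < d" "d < 1" using e by (auto simp: d_def)
    have K1: "1 \<le> K" using K not_empty by fastforce
    then have Kd: "1 < K / d" using d by (simp add: field_simps)
    then have lnKd: "0 < ln (K / d)" by (rule ln_gt_zero)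
    obtain k Y where kY: "prob {x \<in> space M. f x \<noteq> Y (itinerary T g k x)} \<le> e / 2 / ln (K / d)"
      using generating[of f K "e / 2 / ln (K / d)"] f K e lnKd by auto
    \<comment> \<open>The predicted label gets \<open>1 - d\<close>, and \<open>d\<close> is spread
      over all \<open>K\<close> labels. The prediction at time \<open>i\<close> reads the
      \<open>k\<close> letters from position \<open>i\<close> on.\<close>
    define \<rho> where "\<rho> w i b = (if b < K then if b = Y (take k (drop i w)) then 1 - d else d / K else 0)"
      for w :: "nat list" and i b :: nat
    define y where "y = (\<lambda>x. Y (itinerary T g k x))"
    have [measurable]: "y \<in> measurable M (count_space UNIV)"
      unfolding y_def by (rule measurable_compose[where f = "itinerary T g k" and g = Y, OF measurable_itinerary[OF g]]) simp
    define B where "B = {x \<in> space M. f x \<noteq> y x}"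
    have y: "y \<in> measurable M (count_space UNIV)" by measurable
    have "B = (\<lambda>x. (f x, y x)) -` {z. fst z \<noteq> snd z} \<inter> space M" by (auto simp: B_def)
    then have [measurable]: "B \<in> sets M"
      using measurable_sets[OF measurable_count_space_Pair[OF f y], of "{z. fst z \<noteq> snd z}"] by simp
    define l where "l x = (if x \<in> B then ln (K / d) else e / 2)" for x
    have il: "integrable M l"
      by (rule integrable_const_bound[where B = "\<bar>e / 2\<bar> + \<bar>ln (K / d)\<bar>"]) (auto simp: l_def[abs_def])
    have "(\<integral>x. l x \<partial>M) \<le> (\<integral>x. e / 2 + ln (K / d) * indicator B x \<partial>M)"
    proof (rule integral_mono[OF il])
      show "integrable M (\<lambda>x. e / 2 + ln (K / d) * indicator B x)"
        by (simp add: emeasure_eq_measure)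
    qed (use e lnKd in \<open>auto simp: l_def\<close>)
    also have "\<dots> = e / 2 + ln (K / d) * prob B"
      by (subst Bochner_Integration.integral_add) (auto simp: prob_space emeasure_eq_measure)
    also have "\<dots> \<le> e / 2 + ln (K / d) * (e / 2 / ln (K / d))"
      using kY lnKd unfolding B_def y_def by (intro add_left_mono mult_left_mono) auto
    finally have l_le: "(\<integral>x. l x \<partial>M) \<le> e" using lnKd by simp
    have sum: "(\<integral>\<^sup>+b. ennreal (\<rho> w i b) \<partial>count_space UNIV) \<le> 1" for w i
    proof -
      define y where "y = Y (take k (drop i w))"
      have "(\<integral>\<^sup>+b. ennreal (\<rho> w i b) \<partial>count_space UNIV) = (\<integral>\<^sup>+b. ennreal (\<rho> w i b) \<partial>count_space {..<K})"
        by (rule nn_integral_count_space_eq) (auto simp: \<rho>_def)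
      also have "\<dots> = ennreal (\<Sum>b<K. \<rho> w i b)"
        using d by (subst nn_integral_count_space_finite) (auto simp: \<rho>_def intro!: sum_ennreal)
      also have "(\<Sum>b<K. \<rho> w i b) \<le> (\<Sum>b<K. (if b = y then 1 - d else 0) + d / K)"
        using d by (intro sum_mono) (auto simp: \<rho>_def y_def)
      also have "\<dots> \<le> 1" using d K1 by (simp add: sum.distrib)
      finally show ?thesis by (simp add: ennreal_leI)
    qed
    have rho: "0 < \<rho> (itinerary T g (n + k) x) i (f ((T ^^ i) x)) \<and>
        ln (\<rho> (itinerary T g (n + k) x) i (f ((T ^^ i) x))) = - l ((T ^^ i) x)"
      if "x \<in> space M" "i < n" for x i n
      using K[OF funpow_in_space[OF that(1), of i]] funpow_in_space[OF that(1), of i] that(2) d K1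
      by (auto simp: \<rho>_def l_def y_def B_def take_drop_itinerary ln_div d_def)
    \<comment> \<open>The windows at times below \<open>n\<close> reach up to position
      \<open>n + k\<close>; the cost of the \<open>k\<close> extra letters vanishes after division
      by \<open>n\<close>.\<close>
    have bound2: "(\<integral>x. info M (itinerary T f n) x \<partial>M) \<le> (n + k) * a + C + n * e" for n
    proof -
      have "(\<integral>x. info M (itinerary T f n) x \<partial>M) \<le> (\<integral>x. info M (itinerary T g (n + k)) x \<partial>M) + n * (\<integral>x. l x \<partial>M)"
        by (rule conditional_Gibbs_itinerary(2)[where \<rho> = \<rho> and l = l, OF measurable_itinerary[OF g] f _ sum
              integrable_info_itinerary[OF g ig] il])
          (use d rho in \<open>auto simp: \<rho>_def[of _ _ b for b] intro!: AE_I2\<close>)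
      also have "\<dots> \<le> real (n + k) * a + C + n * e" by (intro add_mono bound mult_left_mono l_le) simp
      finally show ?thesis .
    qed
    have "(\<integral>x. info M (itinerary T f n) x \<partial>M) / n \<le> a + e + (k * a + C) / n" if "n \<ge> 1" for n
      using divide_right_mono[OF bound2[of n], of "real n"] that by (simp add: field_simps)
    moreover have "(\<lambda>n. a + e + (k * a + C) / real n) \<longlonglongrightarrow> a + e + 0"
      by (intro tendsto_add tendsto_const lim_const_over_n)
    ultimately show ?thesis using LIMSEQ_le[OF L] by (metis add_0_right)
  qed
  then have "L \<le> a" by (rule field_le_epsilon)
  then show "partition_dynamical_entropy M T P \<le> ennreal a" unfolding PL by (rule ennreal_leI)
qed

text \<open>\<open>g\<close> may have infinitely many values, whereas \<open>measure_entropy\<close>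
  allows finite partitions only. Truncating \<open>g\<close> at \<open>K\<close> loses information
  only where \<open>g\<close> is at least \<open>K\<close>; there it is recovered at cost
  \<open>- ln (p (g x))\<close>, whose contribution is small for large \<open>K\<close> by
  integrability.\<close>

lemma measure_entropy_ge:
  fixes g :: "'a \<Rightarrow> nat" and p :: "nat \<Rightarrow> real" and h :: real
  assumes g: "g \<in> measurable M (count_space UNIV)"
    and p: "\<And>c. 0 < p c" and sum_p: "(\<integral>\<^sup>+c. ennreal (p c) \<partial>count_space UNIV) \<le> 1"
    and ip: "integrable M (\<lambda>x. ln (p (g x)))"
    and bound: "\<And>n. n * h \<le> (\<integral>x. info M (itinerary T g n) x \<partial>M)"
  shows "ennreal h \<le> measure_entropy M T"
proof -
  note [measurable] = g
  have p1: "p c \<le> 1" for c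
    using nn_integral_ge_point[of c UNIV "\<lambda>c. ennreal (p c)"] sum_p p[of c]
    by (metis UNIV_I ennreal_le_1 order_trans)
  have *: "ennreal (h - e) \<le> measure_entropy M T" if e: "0 < e" for e :: real
  proof -
    define l where "l K x = (if g x < K then 0 else - ln (p (g x)))" for K x
    have il: "integrable M (l K)" for K
      by (rule Bochner_Integration.integrable_bound[OF ip]) (auto simp: l_def[abs_def])
    have "(\<lambda>K. \<integral>x. l K x \<partial>M) \<longlonglongrightarrow> (\<integral>x. 0 \<partial>M)"
    proof (rule integral_dominated_convergence[where w = "\<lambda>x. \<bar>ln (p (g x))\<bar>"])
      show "AE x in M. (\<lambda>K. l K x) \<longlonglongrightarrow> 0"
      proof (rule AE_I2)
        fix x
        show "(\<lambda>K. l K x) \<longlonglongrightarrow> 0"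
          by (rule tendsto_eventually) (auto simp: l_def eventually_sequentially intro!: exI[of _ "Suc (g x)"])
      qed
    qed (use ip il in \<open>auto simp: l_def\<close>)
    then have "eventually (\<lambda>K. (\<integral>x. l K x \<partial>M) < e) sequentially"
      using e by (intro order_tendstoD(2)[where a = e]) auto
    then obtain K where K: "(\<integral>x. l K x \<partial>M) < e" by (auto simp: eventually_sequentially)
    define f where "f x = min (g x) K" for x
    have f: "f \<in> measurable M (count_space UNIV)" unfolding f_def[abs_def] by measurable
    have fK: "f x < Suc K" for x by (simp add: f_def)
    define P where "P = (\<lambda>c. f -` {c} \<inter> space M) ` f ` space M"
    obtain L where L: "(\<lambda>n. (\<integral>x. info M (itinerary T f n) x \<partial>M) / n) \<longlonglongrightarrow> L"
      and PL: "partition_dynamical_entropy M T P = ennreal L"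
      using partition_dynamical_entropy_tendsto[OF f fK P_def] by blast
    \<comment> \<open>A truncated letter below \<open>K\<close> determines the true one. The letter
      \<open>K\<close> stands for all \<open>a \<ge> K\<close>, which are coded with
      \<open>p\<close>.\<close>
    define \<rho> where "\<rho> v i a = (if min a K = v ! i then if a < K then 1 else p a else 0)"
      for v :: "nat list" and i a :: nat
    have sum: "(\<integral>\<^sup>+a. ennreal (\<rho> v i a) \<partial>count_space UNIV) \<le> 1" for v i
    proof (cases "v ! i < K")
      case True
      have "(\<integral>\<^sup>+a. ennreal (\<rho> v i a) \<partial>count_space UNIV) = (\<integral>\<^sup>+a. ennreal (\<rho> v i a) \<partial>count_space {v ! i})"
        by (rule nn_integral_count_space_eq) (use True in \<open>auto simp: \<rho>_def min_def\<close>)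
      also have "\<dots> \<le> 1" using True by (simp add: nn_integral_count_space_finite \<rho>_def)
      finally show ?thesis .
    next
      case False
      have "(\<integral>\<^sup>+a. ennreal (\<rho> v i a) \<partial>count_space UNIV) \<le> (\<integral>\<^sup>+a. ennreal (p a) \<partial>count_space UNIV)"
        by (intro nn_integral_mono ennreal_leI) (use False p in \<open>auto simp: \<rho>_def less_imp_le\<close>)
      then show ?thesis using sum_p by simp
    qed
    have rho: "0 < \<rho> (itinerary T f n x) i (g ((T ^^ i) x)) \<and>
        ln (\<rho> (itinerary T f n x) i (g ((T ^^ i) x))) = - l K ((T ^^ i) x)"
      if "i < n" for x i n
      using that p by (auto simp: \<rho>_def l_def nth_itinerary f_def)
    have "h - e \<le> (\<integral>x. info M (itinerary T f n) x \<partial>M) / n" if "n \<ge> 1" for n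
    proof -
      have "(\<integral>x. info M (itinerary T g n) x \<partial>M) \<le> (\<integral>x. info M (itinerary T f n) x \<partial>M) + n * (\<integral>x. l K x \<partial>M)"
        by (rule conditional_Gibbs_itinerary(2)[where \<rho> = \<rho> and l = "l K", OF measurable_itinerary[OF f] g _ sum
              integrable_info_itinerary[OF f integrable_info_finite_range[OF f fK]] il])
          (use p rho in \<open>auto simp: \<rho>_def[of _ _ b for b] less_imp_le intro!: AE_I2\<close>)
      also have "\<dots> \<le> (\<integral>x. info M (itinerary T f n) x \<partial>M) + n * e"
        using K by (intro add_left_mono mult_left_mono) auto
      finally have "n * h \<le> (\<integral>x. info M (itinerary T f n) x \<partial>M) + n * e" using bound[of n] by linarith
      then show ?thesis using that by (simp add: field_simps)
    qed
    then have "h - e \<le> L" by (intro LIMSEQ_le_const[OF L]) auto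
    have "ennreal L \<le> measure_entropy M T"
      unfolding measure_entropy_def PL[symmetric]
    proof (rule SUP_upper, safe)
      have "f ` space M \<subseteq> {..<Suc K}" using fK by blast
      then have "finite (f ` space M)" by (rule finite_subset) simp
      then show "finite P" unfolding P_def by (rule finite_imageI)
      show "partition_on (space M) P"
        by (rule partition_onI) (auto simp: P_def disjnt_def)
      show "A \<in> sets M" if "A \<in> P" for A using that f unfolding P_def by auto
    qed
    then show ?thesis using \<open>h - e \<le> L\<close> by (meson ennreal_leI order_trans)
  qed
  show ?thesis
  proof (rule ccontr)
    assume "\<not> ennreal h \<le> measure_entropy M T"
    then have lt: "measure_entropy M T < ennreal h" by simp
    then obtain r where r: "measure_entropy M T = ennreal r" "0 \<le> r"
      by (cases "measure_entropy M T") auto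
    with lt have "r < h" by (simp add: ennreal_less_iff)
    with *[of "(h - r) / 2"] r show False by (simp add: ennreal_le_iff field_simps)
  qed
qed

end

section \<open>The shift space\<close>

lemma shift_map_funpow: "(shift_map ^^ i) x = (\<lambda>j. x (i + j))"
  by (induction i) (auto simp: shift_map_def)

definition initial_word :: "nat \<Rightarrow> (nat \<Rightarrow> nat) \<Rightarrow> nat list" where
  "initial_word n x = map x [0..<n]"

text \<open>A representative sequence that begins with \<open>w\<close>. The tail of zeros is
  arbitrary and the sequence need not lie in the shift space; bounded distortion makes the choice
  harmless up to a constant.\<close>

definition pad :: "nat list \<Rightarrow> nat \<Rightarrow> nat" where
  "pad w i = (if i < length w then w ! i else 0)"

definition depends_on_first :: "nat \<Rightarrow> ((nat \<Rightarrow> nat) \<Rightarrow> 'b) \<Rightarrow> bool" where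
  "depends_on_first L f \<longleftrightarrow> (\<forall>x y. (\<forall>i<L. x i = y i) \<longrightarrow> f x = f y)"

lemma itinerary_shift_map: "itinerary shift_map (\<lambda>x. x 0) n = initial_word n"
  by (simp add: itinerary_def initial_word_def shift_map_funpow fun_eq_iff)

lemma length_initial_word [simp]: "length (initial_word n x) = n"
  by (simp add: initial_word_def)

lemma nth_initial_word: "i < n \<Longrightarrow> initial_word n x ! i = x i"
  by (simp add: initial_word_def)

lemma initial_word_in_words: "initial_word n x \<in> words n"
  by (simp add: words_def)

lemma initial_word_eq_iff: "initial_word n x = w \<longleftrightarrow> length w = n \<and> (\<forall>i<n. x i = w ! i)"
  by (auto simp: list_eq_iff_nth_eq nth_initial_word)

lemma initial_word_eqI: "(\<And>i. i < n \<Longrightarrow> x i = y i) \<Longrightarrow> initial_word n x = initial_word n y"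
  by (simp add: initial_word_def)

lemma take_initial_word: "k \<le> n \<Longrightarrow> take k (initial_word n x) = initial_word k x"
  by (simp add: initial_word_def take_map)

lemma depends_on_firstD: "depends_on_first L f \<Longrightarrow> (\<And>i. i < L \<Longrightarrow> x i = y i) \<Longrightarrow> f x = f y"
  by (simp add: depends_on_first_def)

lemma depends_on_first_initial_word: "depends_on_first n (\<lambda>x. F (initial_word n x))"
  unfolding depends_on_first_def by (metis initial_word_eqI)

lemma depends_on_first_pad: "depends_on_first L f \<Longrightarrow> f x = f (pad (initial_word L x))"
  by (rule depends_on_firstD[of L f]) (auto simp: pad_def nth_initial_word)

lemma measurable_coordinate_borel: "(\<lambda>x :: nat \<Rightarrow> nat. x i) \<in> measurable borel (count_space UNIV)"
proof -
  have eq: "measurable (borel :: (nat \<Rightarrow> nat) measure) (count_space UNIV) =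
      measurable borel (borel :: nat measure)"
    by (rule measurable_cong_sets[OF refl sets_borel_eq_count_space[symmetric]])
  show ?thesis
    unfolding eq by (rule borel_measurable_continuous_onI[OF continuous_on_product_coordinates])
qed

section \<open>Invariant measures and their cylinders\<close>

locale shift_invariant = measure_preserving M shift_map for M :: "(nat \<Rightarrow> nat) measure" +
  fixes \<Omega> :: "(nat \<Rightarrow> nat) set"
  assumes sets_M: "sets M = sets (restrict_space borel \<Omega>)"

lemma invariant_measures_iff: "\<nu> \<in> invariant_measures A \<longleftrightarrow> shift_invariant \<nu> (markov_shift A)"
  unfolding invariant_measures_def shift_invariant_def shift_invariant_axioms_def measure_preserving_def
    measure_preserving_axioms_def by auto

context shift_invariant
begin

lemma space_M: "space M = \<Omega>"
  using sets_eq_imp_space_eq[OF sets_M] by (simp add: space_restrict_space)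

lemma measurable_coordinate [measurable]: "(\<lambda>x. x i) \<in> measurable M (count_space UNIV)"
  by (subst measurable_cong_sets[OF sets_M refl])
    (rule measurable_restrict_space1[OF measurable_coordinate_borel])

lemma measurable_initial_word: "initial_word n \<in> measurable M (count_space UNIV)"
  using measurable_itinerary[OF measurable_coordinate[of 0], of n] by (simp add: itinerary_shift_map)

lemma measurable_depends_on_first:
  fixes f :: "(nat \<Rightarrow> nat) \<Rightarrow> 'b"
  assumes f: "depends_on_first L f" and N: "space N = UNIV"
  shows "f \<in> measurable M N"
proof -
  have "(\<lambda>x. f (pad (initial_word L x))) \<in> measurable M N"
    by (rule measurable_compose[where f = "initial_word L" and g = "\<lambda>w. f (pad w)", OF measurable_initial_word])
      (simp add: N)
  then show ?thesis using depends_on_first_pad[OF f] by (metis (no_types, lifting) ext)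
qed

definition cylinder :: "nat list \<Rightarrow> (nat \<Rightarrow> nat) set" where
  "cylinder w = {x \<in> space M. initial_word (length w) x = w}"

lemma cylinder_eq: "cylinder w = initial_word (length w) -` {w} \<inter> space M"
  by (auto simp: cylinder_def)

lemma sets_cylinder [measurable]: "cylinder w \<in> sets M"
  unfolding cylinder_eq by (rule measurable_sets[OF measurable_initial_word]) simp

text \<open>The Borel sets of this countable product form the product sigma-algebra, and each event
  that fixes one coordinate is a countable union of cylinders.\<close>

lemma sets_M_generated: "sets M = sigma_sets (space M) (insert {} (range cylinder))"
proof (intro equalityI subsetI)
  fix A assume "A \<in> sigma_sets (space M) (insert {} (range cylinder))"
  then show "A \<in> sets M" by (rule sets.sigma_sets_subset[THEN subsetD, rotated]) auto
next
  fix A assume A: "A \<in> sets M"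
  define G where "G = insert {} (range cylinder)"
  define N where "N = sigma (space M) G"
  have G: "G \<subseteq> Pow (space M)" using sets.sets_into_space[OF sets_cylinder] by (auto simp: G_def)
  have spN: "space N = space M" unfolding N_def by (rule space_measure_of[OF G])
  have setsN: "sets N = sigma_sets (space M) G" unfolding N_def by (rule sets_measure_of[OF G])
  have cyl: "cylinder w \<in> sets N" for w unfolding setsN G_def by (rule sigma_sets.Basic) simp
  have "(\<lambda>x i. x i) \<in> measurable N (Pi\<^sub>M UNIV (\<lambda>_. borel :: nat measure))"
  proof (rule measurable_PiM_single')
    fix i :: nat
    show "(\<lambda>x. x i) \<in> borel_measurable N"
      unfolding measurable_cong_sets[OF refl sets_borel_eq_count_space] measurable_count_space_eq2_countable
    proof (intro conjI ballI)
      fix a :: nat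
      have "(\<lambda>x. x i) -` {a} \<inter> space N = (\<Union>w\<in>{w. length w = Suc i \<and> w ! i = a}. cylinder w)"
        by (auto simp: spN cylinder_def nth_initial_word intro!: bexI[of _ "initial_word (Suc i) _"])
      also have "\<dots> \<in> sets N" by (rule sets.countable_UN'') (use cyl in auto)
      finally show "(\<lambda>x. x i) -` {a} \<inter> space N \<in> sets N" .
    qed auto
  qed auto
  then have id: "(\<lambda>x. x) \<in> measurable N borel"
    by (subst measurable_cong_sets[OF refl sets_PiM_equal_borel[symmetric]]) simp
  obtain B where B: "B \<in> sets borel" "A = B \<inter> \<Omega>"
    using A unfolding sets_M by (auto simp: sets_restrict_space)
  have "A = (\<lambda>x. x) -` B \<inter> space N" using B by (auto simp: spN space_M)
  also have "\<dots> \<in> sets N" by (rule measurable_sets[OF id B(1)])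
  finally show "A \<in> sigma_sets (space M) (insert {} (range cylinder))" by (simp add: setsN G_def)
qed

definition cylinder_error :: "(nat \<Rightarrow> nat) set \<Rightarrow> nat \<Rightarrow> nat list set \<Rightarrow> (nat \<Rightarrow> nat) set" where
  "cylinder_error A k W = {x \<in> space M. \<not> (x \<in> A \<longleftrightarrow> initial_word k x \<in> W)}"

lemma sets_cylinder_error [measurable]:
  assumes "A \<in> sets M"
  shows "cylinder_error A k W \<in> sets M"
proof -
  have W: "initial_word k -` W \<inter> space M \<in> sets M" by (rule measurable_sets[OF measurable_initial_word]) simp
  have "cylinder_error A k W = (A - (initial_word k -` W \<inter> space M)) \<union> ((initial_word k -` W \<inter> space M) - A)"
    using sets.sets_into_space[OF assms] by (auto simp: cylinder_error_def)
  then show ?thesis using W assms by auto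
qed

text \<open>Induction on the generation of \<open>A\<close>. Complements have the same error set. In
  a countable union finitely many sets already carry all but \<open>\<delta> / 2\<close> of the
  measure, and their approximations share the other half.\<close>

lemma cylinder_approximation:
  assumes "A \<in> sets M" "0 < \<delta>"
  shows "\<exists>k W. prob (cylinder_error A k W) < \<delta>"
proof -
  have "A \<in> sigma_sets (space M) (insert {} (range cylinder))" using assms(1) sets_M_generated by simp
  then show ?thesis
    using assms(2)
  proof (induction arbitrary: \<delta> rule: sigma_sets.induct)
    case (Basic A)
    have "\<exists>k W. cylinder_error A k W = {}"
    proof (cases "A = {}")
      case True
      then show ?thesis by (intro exI[of _ 0] exI[of _ "{}"]) (auto simp: cylinder_error_def)
    next
      case False
      with Basic obtain w where "A = cylinder w" by auto
      then show ?thesis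
        by (intro exI[of _ "length w"] exI[of _ "{w}"]) (auto simp: cylinder_error_def cylinder_def)
    qed
    with Basic show ?case by (metis measure_empty)
  next
    case Empty
    have "cylinder_error {} 0 {} = {}" by (auto simp: cylinder_error_def)
    with Empty show ?case by (metis measure_empty)
  next
    case (Compl A)
    then obtain k W where "prob (cylinder_error A k W) < \<delta>" by blast
    moreover have "cylinder_error (space M - A) k (- W) = cylinder_error A k W"
      by (auto simp: cylinder_error_def)
    ultimately show ?case by metis
  next
    case (Union A)
    have A [measurable]: "A i \<in> sets M" for i using Union.hyps sets_M_generated by simp
    define U where "U = (\<Union>i. A i)"
    have "(\<lambda>n. prob (\<Union>i<n. A i)) \<longlonglongrightarrow> prob (\<Union>n. \<Union>i<n. A i)"
      by (rule finite_Lim_measure_incseq) (auto 4 4 simp: incseq_def intro: order_less_le_trans)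
    moreover have "(\<Union>n. \<Union>i<n. A i) = U" by (auto simp: U_def)
    ultimately have "eventually (\<lambda>n. prob U - \<delta> / 2 < prob (\<Union>i<n. A i)) sequentially"
      using Union.prems by (intro order_tendstoD(1)[where y = "prob U"]) auto
    then obtain n where n: "prob U - \<delta> / 2 < prob (\<Union>i<n. A i)" by (auto simp: eventually_sequentially)
    have "\<forall>i. \<exists>k W. prob (cylinder_error (A i) k W) < \<delta> / (2 * real (Suc n))"
      using Union.IH Union.prems by simp
    then obtain k W where kW: "\<And>i. prob (cylinder_error (A i) (k i) (W i)) < \<delta> / (2 * real (Suc n))"
      by metis
    \<comment> \<open>The approximations use words of different lengths \<open>k i\<close>. A common
      length is any upper bound of them, and \<open>V\<close> then looks only at prefixes.\<close>
    define K where "K = (\<Sum>i<n. k i)"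
    define V where "V = {w. \<exists>i<n. take (k i) w \<in> W i}"
    have kK: "k i \<le> K" if "i < n" for i unfolding K_def by (rule member_le_sum) (use that in auto)
    have sub: "cylinder_error U K V \<subseteq> (U - (\<Union>i<n. A i)) \<union> (\<Union>i<n. cylinder_error (A i) (k i) (W i))"
    proof
      fix x assume x: "x \<in> cylinder_error U K V"
      have V: "initial_word K x \<in> V \<longleftrightarrow> (\<exists>i<n. initial_word (k i) x \<in> W i)"
        using kK by (auto simp: V_def take_initial_word)
      show "x \<in> (U - (\<Union>i<n. A i)) \<union> (\<Union>i<n. cylinder_error (A i) (k i) (W i))"
        using x unfolding cylinder_error_def mem_Collect_eq V by (auto simp: U_def)
    qed
    have "prob (cylinder_error U K V) \<le>
        prob ((U - (\<Union>i<n. A i)) \<union> (\<Union>i<n. cylinder_error (A i) (k i) (W i)))"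
      by (rule finite_measure_mono[OF sub]) (auto simp: U_def)
    also have "\<dots> \<le> prob (U - (\<Union>i<n. A i)) + prob (\<Union>i<n. cylinder_error (A i) (k i) (W i))"
      by (rule measure_Un_le) (auto simp: U_def)
    also have "prob (\<Union>i<n. cylinder_error (A i) (k i) (W i)) \<le> (\<Sum>i<n. prob (cylinder_error (A i) (k i) (W i)))"
      by (rule finite_measure_subadditive_finite) auto
    also have "\<dots> \<le> (\<Sum>i<n. \<delta> / (2 * real (Suc n)))" by (intro sum_mono less_imp_le kW)
    also have "\<dots> = real n * (\<delta> / (2 * real (Suc n)))" by simp
    also have "\<dots> \<le> \<delta> / 2" using Union.prems by (simp add: field_simps)
    also have "prob (U - (\<Union>i<n. A i)) = prob U - prob (\<Union>i<n. A i)"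
      by (rule finite_measure_Diff) (auto simp: U_def)
    finally have "prob (cylinder_error U K V) < \<delta>" using n by simp
    then show ?case unfolding U_def by blast
  qed
qed

text \<open>Supplies the generating hypothesis of \<open>measure_entropy_le\<close> for the zeroth
  coordinate.\<close>

lemma finite_range_approximation:
  fixes f :: "(nat \<Rightarrow> nat) \<Rightarrow> nat"
  assumes f: "f \<in> measurable M (count_space UNIV)" and K: "\<And>x. x \<in> space M \<Longrightarrow> f x < K" and \<delta>: "0 < \<delta>"
  shows "\<exists>k Y. prob {x \<in> space M. f x \<noteq> Y (initial_word k x)} \<le> \<delta>"
proof -
  define A where "A i = f -` {i} \<inter> space M" for i
  have [measurable]: "A i \<in> sets M" for i unfolding A_def by (rule measurable_sets[OF f]) simp
  have "\<forall>i. \<exists>k W. prob (cylinder_error (A i) k W) < \<delta> / Suc K"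
    using \<delta> by (intro allI cylinder_approximation) auto
  then obtain k W where kW: "\<And>i. prob (cylinder_error (A i) (k i) (W i)) < \<delta> / Suc K" by metis
  define L where "L = (\<Sum>i<K. k i)"
  have kL: "k i \<le> L" if "i < K" for i unfolding L_def by (rule member_le_sum) (use that in auto)
  \<comment> \<open>Outside the error sets exactly one label below \<open>K\<close> passes its test,
    so the description is unique there.\<close>
  define Y where "Y w = (THE i. i < K \<and> take (k i) w \<in> W i)" for w
  have sub: "{x \<in> space M. f x \<noteq> Y (initial_word L x)} \<subseteq> (\<Union>i<K. cylinder_error (A i) (k i) (W i))"
  proof (rule subsetI, rule ccontr)
    fix x assume x: "x \<in> {x \<in> space M. f x \<noteq> Y (initial_word L x)}"
      and "x \<notin> (\<Union>i<K. cylinder_error (A i) (k i) (W i))"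
    then have "initial_word (k i) x \<in> W i \<longleftrightarrow> f x = i" if "i < K" for i
      using that by (auto simp: cylinder_error_def A_def)
    then have "i < K \<and> take (k i) (initial_word L x) \<in> W i \<longleftrightarrow> i = f x" for i
      using K[of x] x kL by (auto simp: take_initial_word)
    then have "Y (initial_word L x) = f x" by (simp add: Y_def)
    with x show False by simp
  qed
  have "prob {x \<in> space M. f x \<noteq> Y (initial_word L x)} \<le> prob (\<Union>i<K. cylinder_error (A i) (k i) (W i))"
    by (rule finite_measure_mono[OF sub]) auto
  also have "\<dots> \<le> (\<Sum>i<K. prob (cylinder_error (A i) (k i) (W i)))"
    by (rule finite_measure_subadditive_finite) auto
  also have "\<dots> \<le> (\<Sum>i<K. \<delta> / Suc K)" by (intro sum_mono less_imp_le kW)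
  also have "\<dots> = real K * (\<delta> / real (Suc K))" by simp
  also have "\<dots> \<le> \<delta>" using \<delta> by (simp add: field_simps)
  finally show ?thesis by blast
qed

text \<open>Two cylinders are nested or disjoint, so together with the empty set they form a
  generator stable under intersection.\<close>

lemma measure_eqI_cylinder:
  assumes N: "shift_invariant N \<Omega>"
    and eq: "\<And>w. measure N (cylinder w) = measure M (cylinder w)"
  shows "N = M"
proof -
  interpret N: shift_invariant N \<Omega> by (rule N)
  have cyl: "N.cylinder = cylinder" by (simp add: fun_eq_iff N.cylinder_def cylinder_def space_M N.space_M)
  show ?thesis
  proof (rule measure_eqI_generator_eq)
    show "Int_stable (insert {} (range cylinder))"
    proof (rule Int_stableI)
      fix a b assume "a \<in> insert {} (range cylinder)" "b \<in> insert {} (range cylinder)"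
      moreover have "cylinder v \<inter> cylinder w \<in> insert {} (range cylinder)" if "length v \<le> length w" for v w
      proof (cases "cylinder v \<inter> cylinder w = {}")
        case False
        then obtain x where x: "initial_word (length v) x = v" "initial_word (length w) x = w"
          by (auto simp: cylinder_def)
        then have vw: "v = take (length v) w" using that by (metis take_initial_word)
        have "cylinder w \<subseteq> cylinder v"
          using that vw by (auto simp: cylinder_def) (metis take_initial_word)
        then have "cylinder v \<inter> cylinder w = cylinder w" by blast
        then show ?thesis by blast
      qed simp
      then have "cylinder v \<inter> cylinder w \<in> insert {} (range cylinder)" for v w
        by (metis Int_commute nat_le_linear)
      ultimately show "a \<inter> b \<in> insert {} (range cylinder)" by blast
    qed
    show "insert {} (range cylinder) \<subseteq> Pow (space M)" by (auto simp: cylinder_def)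
    show "emeasure N X = emeasure M X" if "X \<in> insert {} (range cylinder)" for X
      using that eq by (auto simp: emeasure_eq_measure N.emeasure_eq_measure)
    show "sets N = sigma_sets (space M) (insert {} (range cylinder))"
      using N.sets_M_generated by (simp add: cyl space_M N.space_M)
    show "sets M = sigma_sets (space M) (insert {} (range cylinder))" by (rule sets_M_generated)
    show "range (\<lambda>_. cylinder []) \<subseteq> insert {} (range cylinder)" by blast
    show "(\<Union>i. cylinder []) = space M" by (auto simp: cylinder_def initial_word_def)
    show "emeasure N (cylinder []) \<noteq> \<infinity>" for i :: nat by simp
  qed
qed

end

section \<open>Partition functions of potentials\<close>

abbreviation shift_sum :: "((nat \<Rightarrow> nat) \<Rightarrow> real) \<Rightarrow> nat \<Rightarrow> (nat \<Rightarrow> nat) \<Rightarrow> real" where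
  "shift_sum \<equiv> birkhoff_sum shift_map"

lemma shift_map_funpow_pad_append: "length u = n \<Longrightarrow> (shift_map ^^ n) (pad (u @ v)) = pad v"
  by (auto simp: shift_map_funpow pad_def nth_append fun_eq_iff)

text \<open>Bowen's condition. The bound is uniform in \<open>n\<close>, so evaluating Birkhoff sums
  at \<open>pad w\<close> changes exponential weights by a bounded factor.\<close>

definition distortion_bound :: "((nat \<Rightarrow> nat) \<Rightarrow> real) \<Rightarrow> real \<Rightarrow> bool" where
  "distortion_bound f K \<longleftrightarrow>
    (\<forall>n x y. (\<forall>i<n. x i = y i) \<longrightarrow> \<bar>shift_sum f n x - shift_sum f n y\<bar> \<le> K)"

lemma distortion_boundD:
  "distortion_bound f K \<Longrightarrow> (\<And>i. i < n \<Longrightarrow> x i = y i) \<Longrightarrow> shift_sum f n x \<le> shift_sum f n y + K"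
  unfolding distortion_bound_def by (smt (verit, best))

text \<open>A term at least \<open>L\<close> places before the end of the common word sees only
  common letters. The other terms, at most \<open>L\<close>, still share their first letter; hence
  \<open>f\<close> may be unbounded, as \<open>ln (p (x 0))\<close> is.\<close>

lemma distortion_bound_if_depends_on_first:
  assumes f: "depends_on_first L f" and c: "\<And>x y. x 0 = y 0 \<Longrightarrow> \<bar>f x - f y\<bar> \<le> c"
  shows "distortion_bound f (L * c)"
  unfolding distortion_bound_def
proof (intro allI impI)
  fix n and x y :: "nat \<Rightarrow> nat" assume xy: "\<forall>i<n. x i = y i"
  have c0: "0 \<le> c" using c[of x x] by simp
  have "\<bar>shift_sum f n x - shift_sum f n y\<bar> \<le> (\<Sum>i<n. \<bar>f ((shift_map ^^ i) x) - f ((shift_map ^^ i) y)\<bar>)"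
    unfolding birkhoff_sum_def sum_subtractf[symmetric] by (rule sum_abs)
  also have "\<dots> \<le> (\<Sum>i<n. if i \<in> {n - L..<n} then c else 0)"
  proof (rule sum_mono)
    fix i assume i: "i \<in> {..<n}"
    show "\<bar>f ((shift_map ^^ i) x) - f ((shift_map ^^ i) y)\<bar> \<le> (if i \<in> {n - L..<n} then c else 0)"
    proof (cases "i + L \<le> n")
      case True
      have "f ((shift_map ^^ i) x) = f ((shift_map ^^ i) y)"
        by (rule depends_on_firstD[OF f]) (use True xy in \<open>auto simp: shift_map_funpow\<close>)
      then show ?thesis using c0 by simp
    next
      case False
      then show ?thesis using i xy by (auto intro!: c simp: shift_map_funpow)
    qed
  qed
  also have "\<dots> = (\<Sum>i\<in>{..<n} \<inter> {n - L..<n}. c)" by (subst sum.inter_restrict) auto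
  also have "\<dots> = real (card ({..<n} \<inter> {n - L..<n})) * c" by simp
  also have "\<dots> \<le> L * c"
  proof (rule mult_right_mono[OF _ c0])
    have "card ({..<n} \<inter> {n - L..<n}) \<le> card {n - L..<n}" by (rule card_mono) auto
    then show "real (card ({..<n} \<inter> {n - L..<n})) \<le> real L" by simp
  qed
  finally show "\<bar>shift_sum f n x - shift_sum f n y\<bar> \<le> L * c" .
qed

text \<open>The bound \<open>C\<close> does not depend on the length, so the topological pressure of \<open>\<phi>\<close> is at most 0.\<close>

definition weight_bound :: "((nat \<Rightarrow> nat) \<Rightarrow> real) \<Rightarrow> real \<Rightarrow> bool" where
  "weight_bound \<phi> C \<longleftrightarrow> 0 < C \<and>
    (\<forall>n. (\<integral>\<^sup>+w. ennreal (exp (shift_sum \<phi> n (pad w))) \<partial>count_space (words n)) \<le> ennreal C)"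

lemma weight_bound_mono:
  assumes "weight_bound \<psi> C" "\<And>x. \<phi> x \<le> \<psi> x"
  shows "weight_bound \<phi> C"
proof -
  have "(\<integral>\<^sup>+w. ennreal (exp (shift_sum \<phi> n (pad w))) \<partial>count_space (words n)) \<le>
    (\<integral>\<^sup>+w. ennreal (exp (shift_sum \<psi> n (pad w))) \<partial>count_space (words n))" for n
    unfolding birkhoff_sum_def by (intro nn_integral_mono ennreal_leI) (simp add: sum_mono assms)
  with assms(1) show ?thesis unfolding weight_bound_def by (meson order_trans)
qed

lemma weight_bound_ln:
  assumes p: "\<And>a. 0 < p a" and sum: "(\<integral>\<^sup>+a. ennreal (p a) \<partial>count_space UNIV) \<le> 1"
  shows "weight_bound (\<lambda>x. ln (p (x 0))) 1"
proof -
  have "(\<integral>\<^sup>+w. ennreal (exp (shift_sum (\<lambda>x. ln (p (x 0))) n (pad w))) \<partial>count_space (words n)) \<le> 1" for n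
  proof -
    have "(\<integral>\<^sup>+w. ennreal (exp (shift_sum (\<lambda>x. ln (p (x 0))) n (pad w))) \<partial>count_space (words n)) =
      (\<integral>\<^sup>+w. (\<Prod>i<n. ennreal (p (w ! i))) \<partial>count_space (words n))"
      by (intro nn_integral_cong)
        (simp add: birkhoff_sum_def exp_sum shift_map_funpow pad_def words_def p prod_ennreal less_imp_le)
    also have "\<dots> \<le> 1" by (rule nn_integral_words_prod) (rule sum)
    finally show ?thesis .
  qed
  then show ?thesis by (simp add: weight_bound_def)
qed

text \<open>A sum of \<open>N\<close> terms is at most \<open>N\<close> times the largest, and one
  exponential is at most the sum of all. The factor \<open>N\<close> is the price for replacing all
  positions by one residue class.\<close>

lemma exp_sum_le:
  fixes a :: "nat \<Rightarrow> real"
  assumes "0 < N"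
  shows "exp (s + (\<Sum>r<N. a r)) \<le> (\<Sum>r<N. exp (s + N * a r))"
proof -
  have fin: "finite (a ` {..<N})" "a ` {..<N} \<noteq> {}" using assms by auto
  obtain r0 where r0: "r0 < N" "a r0 = Max (a ` {..<N})" using Max_in[OF fin] by auto
  have "(\<Sum>r<N. a r) \<le> (\<Sum>r<N. a r0)" by (intro sum_mono) (simp add: r0)
  then have "exp (s + (\<Sum>r<N. a r)) \<le> exp (s + N * a r0)" by simp
  also have "\<dots> \<le> (\<Sum>r<N. exp (s + N * a r))"
    by (rule member_le_sum[of r0 "{..<N}" "\<lambda>r. exp (s + N * a r)"]) (use r0 in auto)
  finally show ?thesis .
qed

text \<open>At a cut the Birkhoff sum of the prefix still sees letters of the suffix. Replacing
  these by padding costs \<open>K\<close>, which is charged to the prefix; after that the sum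
  factors.\<close>

lemma weight_prefix:
  assumes K: "distortion_bound \<phi> K"
    and pre: "(\<integral>\<^sup>+u. ennreal (exp (shift_sum \<phi> m (pad u) + K + g u)) \<partial>count_space (words m)) \<le> ennreal A"
    and suf: "(\<integral>\<^sup>+v. ennreal (exp (shift_sum \<phi> n (pad v) + h v)) \<partial>count_space (words n)) \<le> ennreal B"
    and A: "0 \<le> A"
  shows "(\<integral>\<^sup>+w. ennreal (exp (shift_sum \<phi> (m + n) (pad w) + (g (take m w) + h (drop m w))))
    \<partial>count_space (words (m + n))) \<le> ennreal (A * B)"
proof -
  have "(\<integral>\<^sup>+w. ennreal (exp (shift_sum \<phi> (m + n) (pad w) + (g (take m w) + h (drop m w))))
    \<partial>count_space (words (m + n))) \<le>
    (\<integral>\<^sup>+u. \<integral>\<^sup>+v. ennreal (exp (shift_sum \<phi> m (pad u) + K + g u)) * ennreal (exp (shift_sum \<phi> n (pad v) + h v))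
      \<partial>count_space (words n) \<partial>count_space (words m))"
    unfolding nn_integral_words_add
  proof (intro nn_integral_mono)
    fix u v assume "u \<in> space (count_space (words m))" "v \<in> space (count_space (words n))"
    then have l: "length u = m" "length v = n" by (auto simp: words_def)
    have "shift_sum \<phi> (m + n) (pad (u @ v)) = shift_sum \<phi> m (pad (u @ v)) + shift_sum \<phi> n (pad v)"
      by (simp add: birkhoff_sum_add shift_map_funpow_pad_append[OF l(1)])
    also have "shift_sum \<phi> m (pad (u @ v)) \<le> shift_sum \<phi> m (pad u) + K"
      by (rule distortion_boundD[OF K]) (simp add: pad_def nth_append l)
    finally show "ennreal (exp (shift_sum \<phi> (m + n) (pad (u @ v)) + (g (take m (u @ v)) + h (drop m (u @ v))))) \<le>
      ennreal (exp (shift_sum \<phi> m (pad u) + K + g u)) * ennreal (exp (shift_sum \<phi> n (pad v) + h v))"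
      by (simp add: l ennreal_mult[symmetric] exp_add[symmetric])
  qed
  also have "\<dots> = (\<integral>\<^sup>+u. ennreal (exp (shift_sum \<phi> m (pad u) + K + g u)) \<partial>count_space (words m)) *
      (\<integral>\<^sup>+v. ennreal (exp (shift_sum \<phi> n (pad v) + h v)) \<partial>count_space (words n))"
    by (simp add: nn_integral_cmult nn_integral_multc)
  also have "\<dots> \<le> ennreal A * ennreal B" by (intro mult_mono pre suf) auto
  finally show ?thesis using A by (simp add: ennreal_mult')
qed

text \<open>
  A sum over all positions is at most \<open>N\<close> times the largest of the \<open>N\<close> sums over the positions in
  one residue class modulo \<open>N\<close>; for one residue class the word splits into independent blocks.
\<close>

lemma weight_bound_block_modification:
  assumes K: "distortion_bound \<phi> K" and C: "weight_bound \<phi> C" and N: "0 < N"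
    and B: "\<And>w. \<bar>\<beta> w\<bar> \<le> B"
    and block: "(\<integral>\<^sup>+u. ennreal (exp (shift_sum \<phi> N (pad u) + K + N * \<beta> u)) \<partial>count_space (words N)) \<le> 1"
  shows "\<exists>C'. weight_bound (\<lambda>x. \<phi> x + \<beta> (initial_word N x)) C'"
proof -
  note C0 = C[unfolded weight_bound_def, THEN conjunct1]
  note Cn = C[unfolded weight_bound_def, THEN conjunct2, rule_format]
  have B0: "0 \<le> B" using B[of "[]"] by linarith
  define b where "b i x = \<beta> (initial_word N ((shift_map ^^ i) x))" for i x
  have b: "\<bar>b i x\<bar> \<le> B" for i x by (simp add: b_def B)
  have b_shift: "b (i + length u) (pad (u @ v)) = b i (pad v)" for i u v
    unfolding b_def funpow_add comp_def by (simp add: shift_map_funpow_pad_append)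
  \<comment> \<open>Modifications at multiples of \<open>N\<close> only. Each step splits off one
    block, whose sum is at most 1 by \<open>block\<close>, so the bound does not grow with
    \<open>q\<close>.\<close>
  have W: "(\<integral>\<^sup>+w. ennreal (exp (shift_sum \<phi> (q * N + s) (pad w) + N * (\<Sum>j<q. b (j * N) (pad w))))
      \<partial>count_space (words (q * N + s))) \<le> ennreal C" for q s
  proof (induction q)
    case 0
    then show ?case using Cn by simp
  next
    case (Suc q)
    have eq: "Suc q * N + s = N + (q * N + s)" by simp
    have "(\<integral>\<^sup>+w. ennreal (exp (shift_sum \<phi> (N + (q * N + s)) (pad w) + N * (\<Sum>j<Suc q. b (j * N) (pad w))))
      \<partial>count_space (words (N + (q * N + s)))) =
      (\<integral>\<^sup>+w. ennreal (exp (shift_sum \<phi> (N + (q * N + s)) (pad w) +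
        (N * \<beta> (take N w) + N * (\<Sum>j<q. b (j * N) (pad (drop N w)))))) \<partial>count_space (words (N + (q * N + s))))"
    proof (rule nn_integral_cong)
      fix w assume "w \<in> space (count_space (words (N + (q * N + s))))"
      then have "N \<le> length w" and l: "length (take N w) = N" by (auto simp: words_def)
      have w: "w = take N w @ drop N w" by simp
      have "initial_word N (pad w) = take N w"
        using \<open>N \<le> length w\<close> by (auto simp: initial_word_eq_iff pad_def)
      then have "b 0 (pad w) = \<beta> (take N w)" by (simp add: b_def)
      moreover have "b (Suc j * N) (pad w) = b (j * N) (pad (drop N w))" for j
        using b_shift[of "j * N" "take N w" "drop N w"] unfolding l w[symmetric] by (simp add: add.commute)
      ultimately have "(\<Sum>j<Suc q. b (j * N) (pad w)) = \<beta> (take N w) + (\<Sum>j<q. b (j * N) (pad (drop N w)))"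
        by (simp only: sum.lessThan_Suc_shift mult_0)
      then show "ennreal (exp (shift_sum \<phi> (N + (q * N + s)) (pad w) + N * (\<Sum>j<Suc q. b (j * N) (pad w)))) =
        ennreal (exp (shift_sum \<phi> (N + (q * N + s)) (pad w) +
          (N * \<beta> (take N w) + N * (\<Sum>j<q. b (j * N) (pad (drop N w))))))"
        by (simp only: distrib_left)
    qed
    also have "\<dots> \<le> ennreal (1 * C)"
      by (rule weight_prefix[OF K _ Suc]) (use block in auto)
    finally show ?case unfolding eq by simp
  qed
  \<comment> \<open>For residue \<open>r\<close> the first \<open>r\<close> letters are unmodified
    and are split off once, at the cost \<open>C * exp K\<close>.\<close>
  have R: "(\<integral>\<^sup>+w. ennreal (exp (shift_sum \<phi> (r + (q * N + s)) (pad w) + N * (\<Sum>j<q. b (j * N + r) (pad w))))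
      \<partial>count_space (words (r + (q * N + s)))) \<le> ennreal (C * exp K * C)" for r q s
  proof -
    have "(\<integral>\<^sup>+u. ennreal (exp (shift_sum \<phi> r (pad u) + K + 0)) \<partial>count_space (words r)) =
        ennreal (exp K) * (\<integral>\<^sup>+u. ennreal (exp (shift_sum \<phi> r (pad u))) \<partial>count_space (words r))"
      by (subst nn_integral_cmult[symmetric]) (auto simp: exp_add ennreal_mult' mult.commute)
    also have "\<dots> \<le> ennreal (exp K) * ennreal C" by (rule mult_left_mono[OF Cn]) simp
    also have "\<dots> = ennreal (C * exp K)" using C0 by (simp add: ennreal_mult' mult.commute)
    finally have pre: "(\<integral>\<^sup>+u. ennreal (exp (shift_sum \<phi> r (pad u) + K + 0)) \<partial>count_space (words r)) \<le>
      ennreal (C * exp K)" .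
    have "(\<integral>\<^sup>+w. ennreal (exp (shift_sum \<phi> (r + (q * N + s)) (pad w) + N * (\<Sum>j<q. b (j * N + r) (pad w))))
        \<partial>count_space (words (r + (q * N + s)))) =
      (\<integral>\<^sup>+w. ennreal (exp (shift_sum \<phi> (r + (q * N + s)) (pad w) +
        (0 + N * (\<Sum>j<q. b (j * N) (pad (drop r w)))))) \<partial>count_space (words (r + (q * N + s))))"
    proof (rule nn_integral_cong)
      fix w assume "w \<in> space (count_space (words (r + (q * N + s))))"
      then have l: "length (take r w) = r" by (auto simp: words_def)
      have w: "w = take r w @ drop r w" by simp
      have "b (j * N + r) (pad w) = b (j * N) (pad (drop r w))" for j
        using b_shift[of "j * N" "take r w" "drop r w"] unfolding l w[symmetric] .
      then show "ennreal (exp (shift_sum \<phi> (r + (q * N + s)) (pad w) + N * (\<Sum>j<q. b (j * N + r) (pad w)))) =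
        ennreal (exp (shift_sum \<phi> (r + (q * N + s)) (pad w) + (0 + N * (\<Sum>j<q. b (j * N) (pad (drop r w))))))"
        by simp
    qed
    also have "\<dots> \<le> ennreal (C * exp K * C)"
      by (rule weight_prefix[OF K pre W]) (use C0 in simp)
    finally show ?thesis .
  qed
  define \<psi> where "\<psi> x = \<phi> x + \<beta> (initial_word N x)" for x
  have \<psi>: "shift_sum \<psi> n x = shift_sum \<phi> n x + (\<Sum>i<n. b i x)" for n x
    by (simp add: \<psi>_def[abs_def] birkhoff_sum_def sum.distrib b_def)
  \<comment> \<open>The first summand serves lengths \<open>n \<ge> N\<close>, the second shorter
    words, on which the modification is at most \<open>N * B\<close>.\<close>
  define C' where "C' = exp (2 * N * B) * (N * (C * exp K * C)) + exp (N * B) * C"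
  have C'0: "0 < C'" using C0 by (simp add: C'_def add_nonneg_pos)
  have "(\<integral>\<^sup>+w. ennreal (exp (shift_sum \<psi> n (pad w))) \<partial>count_space (words n)) \<le> ennreal C'" for n
  proof (cases "n < N")
    case True
    have "(\<integral>\<^sup>+w. ennreal (exp (shift_sum \<psi> n (pad w))) \<partial>count_space (words n)) \<le>
      (\<integral>\<^sup>+w. ennreal (exp (N * B)) * ennreal (exp (shift_sum \<phi> n (pad w))) \<partial>count_space (words n))"
    proof (intro nn_integral_mono)
      fix w
      have "(\<Sum>i<n. b i (pad w)) \<le> (\<Sum>i<n. B)" by (intro sum_mono) (use b in \<open>simp add: abs_le_iff\<close>)
      also have "\<dots> \<le> N * B" using True B0 by (simp add: mult_right_mono)
      finally show "ennreal (exp (shift_sum \<psi> n (pad w))) \<le>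
          ennreal (exp (N * B)) * ennreal (exp (shift_sum \<phi> n (pad w)))"
        by (simp add: \<psi> ennreal_mult[symmetric] exp_add[symmetric])
    qed
    also have "\<dots> = ennreal (exp (N * B)) * (\<integral>\<^sup>+w. ennreal (exp (shift_sum \<phi> n (pad w))) \<partial>count_space (words n))"
      by (simp add: nn_integral_cmult)
    also have "\<dots> \<le> ennreal (exp (N * B)) * ennreal C" by (rule mult_left_mono[OF Cn]) simp
    also have "\<dots> \<le> ennreal C'"
      using C0 by (simp add: ennreal_mult[symmetric] C'_def ennreal_leI)
    finally show ?thesis .
  next
    case False
    \<comment> \<open>One block fewer than fits, so that for every \<open>r < N\<close> the
      \<open>q\<close> blocks starting at offset \<open>r\<close> stay inside the word. At most
      \<open>2 * N\<close> positions are left, and \<open>B\<close> bounds the modification at each,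
      even where it reads the padding.\<close>
    define q where "q = n div N - 1"
    have "1 \<le> n div N" using False N by (simp add: div_greater_zero_iff Suc_le_eq)
    then have "q * N + N = n div N * N" unfolding q_def by (metis Suc_diff_1 Suc_le_eq add.commute mult_Suc One_nat_def)
    moreover have "n div N * N \<le> n" "n < n div N * N + N"
      using dividend_less_div_times[OF N, of n] by (auto simp: add.commute)
    ultimately have q: "q * N + N \<le> n" "n - q * N \<le> 2 * N" by auto
    have "(\<integral>\<^sup>+w. ennreal (exp (shift_sum \<psi> n (pad w))) \<partial>count_space (words n)) \<le>
      (\<integral>\<^sup>+w. ennreal (exp (2 * N * B)) *
        (\<Sum>r<N. ennreal (exp (shift_sum \<phi> n (pad w) + N * (\<Sum>j<q. b (j * N + r) (pad w))))) \<partial>count_space (words n))"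
    proof (intro nn_integral_mono)
      fix w
      have "(\<Sum>i<n. b i (pad w)) = (\<Sum>i<q * N. b i (pad w)) + (\<Sum>i=q * N..<n. b i (pad w))"
        using q by (subst sum.atLeastLessThan_concat[symmetric, of 0 "q * N" n, unfolded atLeast0LessThan]) auto
      also have "(\<Sum>i=q * N..<n. b i (pad w)) \<le> (\<Sum>i=q * N..<n. B)"
        by (intro sum_mono) (use b in \<open>simp add: abs_le_iff\<close>)
      also have "\<dots> = real (n - q * N) * B" by simp
      also have "\<dots> \<le> real (2 * N) * B" by (intro mult_right_mono B0 of_nat_mono q(2))
      also have "(\<Sum>i<q * N. b i (pad w)) = (\<Sum>j<q. \<Sum>i = j * N..<j * N + N. b i (pad w))"
        by (rule sum.nat_group[symmetric])
      also have "\<dots> = (\<Sum>j<q. \<Sum>r<N. b (j * N + r) (pad w))"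
      proof (rule sum.cong[OF refl])
        fix j
        show "(\<Sum>i = j * N..<j * N + N. b i (pad w)) = (\<Sum>r<N. b (j * N + r) (pad w))"
          using sum.shift_bounds_nat_ivl[of "\<lambda>i. b i (pad w)" 0 "j * N" N]
          by (simp add: atLeast0LessThan add.commute)
      qed
      also have "\<dots> = (\<Sum>r<N. \<Sum>j<q. b (j * N + r) (pad w))" by (rule sum.swap)
      finally have "shift_sum \<psi> n (pad w) \<le>
        2 * N * B + (shift_sum \<phi> n (pad w) + (\<Sum>r<N. \<Sum>j<q. b (j * N + r) (pad w)))"
        by (simp add: \<psi>)
      then have "exp (shift_sum \<psi> n (pad w)) \<le>
        exp (2 * N * B) * exp (shift_sum \<phi> n (pad w) + (\<Sum>r<N. \<Sum>j<q. b (j * N + r) (pad w)))"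
        by (simp add: exp_add[symmetric])
      also have "\<dots> \<le> exp (2 * N * B) *
          (\<Sum>r<N. exp (shift_sum \<phi> n (pad w) + N * (\<Sum>j<q. b (j * N + r) (pad w))))"
        by (intro mult_left_mono exp_sum_le N) simp
      finally show "ennreal (exp (shift_sum \<psi> n (pad w))) \<le> ennreal (exp (2 * N * B)) *
          (\<Sum>r<N. ennreal (exp (shift_sum \<phi> n (pad w) + N * (\<Sum>j<q. b (j * N + r) (pad w)))))"
        by (simp add: ennreal_leI ennreal_mult[symmetric] sum_nonneg)
    qed
    also have "\<dots> = ennreal (exp (2 * N * B)) * (\<Sum>r<N. \<integral>\<^sup>+w. ennreal (exp (shift_sum \<phi> n (pad w) +
        N * (\<Sum>j<q. b (j * N + r) (pad w)))) \<partial>count_space (words n))"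
      by (subst nn_integral_cmult, simp, subst nn_integral_sum, simp_all del: sum_ennreal)
    also have "\<dots> \<le> ennreal (exp (2 * N * B)) * (\<Sum>r<N. ennreal (C * exp K * C))"
    proof (intro mult_left_mono sum_mono)
      fix r assume "r \<in> {..<N}"
      then have n: "r + (q * N + (n - q * N - r)) = n" using q by auto
      show "(\<integral>\<^sup>+w. ennreal (exp (shift_sum \<phi> n (pad w) + N * (\<Sum>j<q. b (j * N + r) (pad w)))) \<partial>count_space (words n))
        \<le> ennreal (C * exp K * C)"
        using R[of r q "n - q * N - r"] unfolding n .
    qed simp
    also have "\<dots> = ennreal (exp (2 * N * B) * (N * (C * exp K * C)))"
      using C0 by (simp add: ennreal_mult ennreal_of_nat_eq_real_of_nat)
    also have "\<dots> \<le> ennreal C'" using C0 by (simp add: C'_def ennreal_leI)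
    finally show ?thesis .
  qed
  with C'0 have "weight_bound \<psi> C'" unfolding weight_bound_def by blast
  then show ?thesis unfolding \<psi>_def by blast
qed

section \<open>Entropy of shift-invariant measures\<close>

context shift_invariant
begin

lemma info_initial_word_1: "info M (initial_word (Suc 0)) = info M (\<lambda>x. x 0)"
  using info_itinerary_1[of "\<lambda>x. x 0"] by (simp add: itinerary_shift_map)

lemma borel_measurable_initial_word_compose:
  fixes F :: "nat list \<Rightarrow> 'b::topological_space"
  shows "(\<lambda>x. F (initial_word n x)) \<in> borel_measurable M"
  by (rule measurable_compose[where f = "initial_word n" and g = F, OF measurable_initial_word]) simp

text \<open>Gibbs' inequality with the summands of the partition function as trial weights;
  \<open>K\<close> pays for replacing \<open>pad (initial_word n x)\<close> by
  \<open>x\<close>.\<close>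

lemma initial_word_entropy_le:
  assumes K: "distortion_bound \<phi> K" and C: "weight_bound \<phi> C" and i: "integrable M \<phi>"
  shows "integrable M (info M (initial_word n))"
    and "(\<integral>x. info M (initial_word n) x \<partial>M) \<le> n * - (\<integral>x. \<phi> x \<partial>M) + (ln C + K)"
proof -
  define q where "q w = exp (shift_sum \<phi> n (pad w))" for w
  have C0: "0 < C" and Cn: "(\<integral>\<^sup>+w. ennreal (q w) \<partial>count_space (words n)) \<le> ennreal C"
    using C unfolding weight_bound_def q_def by blast+
  have near: "\<bar>ln (q (initial_word n x)) - shift_sum \<phi> n x\<bar> \<le> K" for x
  proof -
    have "\<bar>shift_sum \<phi> n (pad (initial_word n x)) - shift_sum \<phi> n x\<bar> \<le> K"
      using K[unfolded distortion_bound_def, rule_format, of n "pad (initial_word n x)" x]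
      by (simp add: pad_def nth_initial_word)
    then show ?thesis by (simp add: q_def)
  qed
  note iS = integrable_birkhoff_sum[OF i, of n]
  have int: "integrable M (\<lambda>x. ln (q (initial_word n x)))"
  proof (rule Bochner_Integration.integrable_bound)
    show "integrable M (\<lambda>x. \<bar>shift_sum \<phi> n x\<bar> + K)" using iS by simp
    show "(\<lambda>x. ln (q (initial_word n x))) \<in> borel_measurable M"
      by (rule borel_measurable_initial_word_compose)
    show "AE x in M. norm (ln (q (initial_word n x))) \<le> norm (\<bar>shift_sum \<phi> n x\<bar> + K)"
    proof (rule AE_I2)
      fix x
      show "norm (ln (q (initial_word n x))) \<le> norm (\<bar>shift_sum \<phi> n x\<bar> + K)"
        unfolding real_norm_def using near[of x] by linarith
    qed
  qed
  have q0: "0 \<le> q w" for w by (simp add: q_def)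
  have pos: "AE x in M. 0 < q (initial_word n x)" by (simp add: q_def)
  note G = Gibbs_inequality[OF measurable_initial_word initial_word_in_words q0 C0 Cn pos int]
  show "integrable M (info M (initial_word n))" by (rule G(1))
  have "n * (\<integral>x. \<phi> x \<partial>M) - K = (\<integral>x. shift_sum \<phi> n x - K \<partial>M)"
    using iS by (simp add: integral_birkhoff_sum[OF i] prob_space)
  also have "\<dots> \<le> (\<integral>x. ln (q (initial_word n x)) \<partial>M)"
  proof (rule integral_mono[OF _ int])
    show "integrable M (\<lambda>x. shift_sum \<phi> n x - K)" using iS by simp
    show "shift_sum \<phi> n x - K \<le> ln (q (initial_word n x))" for x using near[of x] by linarith
  qed
  finally show "(\<integral>x. info M (initial_word n) x \<partial>M) \<le> n * - (\<integral>x. \<phi> x \<partial>M) + (ln C + K)"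
    using G(2) by simp
qed

lemma integral_info_nonneg: "0 \<le> (\<integral>x. info M X x \<partial>M)"
  by (rule Bochner_Integration.integral_nonneg) (rule info_nonneg)

text \<open>The upper half of the variational principle at pressure at most 0. The sign of
  \<open>\<integral>\<phi>\<close> is recorded because \<open>ennreal\<close> sends negative reals
  to 0; it follows since block entropies are nonnegative while the error \<open>ln C + K\<close> is
  independent of \<open>n\<close>.\<close>

lemma variational_inequality:
  assumes K: "distortion_bound \<phi> K" and C: "weight_bound \<phi> C" and i: "integrable M \<phi>"
  shows "measure_entropy M shift_map \<le> ennreal (- (\<integral>x. \<phi> x \<partial>M))" and "(\<integral>x. \<phi> x \<partial>M) \<le> 0"
proof -
  note le = initial_word_entropy_le[OF K C i]
  show "measure_entropy M shift_map \<le> ennreal (- (\<integral>x. \<phi> x \<partial>M))"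
  proof (rule measure_entropy_le)
    show "(\<lambda>x. x 0) \<in> measurable M (count_space UNIV)" by (rule measurable_coordinate)
    show "integrable M (info M (\<lambda>x. x 0))" using le(1)[of "Suc 0"] by (simp add: info_initial_word_1)
    show "(\<integral>x. info M (itinerary shift_map (\<lambda>x. x 0) n) x \<partial>M) \<le> n * - (\<integral>x. \<phi> x \<partial>M) + (ln C + K)" for n
      unfolding itinerary_shift_map by (rule le(2))
    show "\<exists>k Y. prob {x \<in> space M. f x \<noteq> Y (itinerary shift_map (\<lambda>x. x 0) k x)} \<le> \<delta>"
      if "f \<in> measurable M (count_space UNIV)" "\<And>x. x \<in> space M \<Longrightarrow> f x < K" "0 < \<delta>" for f and K :: nat and \<delta>
      unfolding itinerary_shift_map by (rule finite_range_approximation) (use that in auto)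
  qed
  show "(\<integral>x. \<phi> x \<partial>M) \<le> 0"
  proof (rule ccontr)
    assume "\<not> (\<integral>x. \<phi> x \<partial>M) \<le> 0"
    then have pos: "0 < (\<integral>x. \<phi> x \<partial>M)" by simp
    obtain n :: nat where "(ln C + K) / (\<integral>x. \<phi> x \<partial>M) < n" using reals_Archimedean2 by blast
    then have "ln C + K < n * (\<integral>x. \<phi> x \<partial>M)" using pos by (simp add: field_simps)
    then show False using le(2)[of n] integral_info_nonneg[of "initial_word n"] by simp
  qed
qed

end

section \<open>Entropy rate of the ergodic measure and its Markov approximations\<close>

locale ergodic_shift = shift_invariant M \<Omega> + ergodic_map M shift_map for M \<Omega> +
  assumes finite_entropy: "integrable M (info M (\<lambda>x. x 0))"
begin

definition block_entropy :: "nat \<Rightarrow> real" where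
  "block_entropy n = (\<integral>x. info M (initial_word n) x \<partial>M)"

text \<open>The limit of \<open>block_entropy n / n\<close>, in the form of Fekete's infimum. This
  form directly gives a lower bound at every length and, by contradiction, a nearly minimal
  increment.\<close>

definition entropy_rate :: real where
  "entropy_rate = (INF n\<in>{1..}. block_entropy n / n)"

lemma integrable_info_initial_word: "integrable M (info M (initial_word n))"
  using integrable_info_itinerary[OF measurable_coordinate finite_entropy, of n]
  by (simp add: itinerary_shift_map)

lemma block_entropy_nonneg: "0 \<le> block_entropy n"
  unfolding block_entropy_def by (rule integral_info_nonneg)

lemma block_entropy_0: "block_entropy 0 = 0"
  using integral_info_itinerary_0[of "\<lambda>x. x 0"] by (simp add: block_entropy_def itinerary_shift_map)

lemma entropy_rate_le: "n * entropy_rate \<le> block_entropy n"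
proof (cases "n = 0")
  case False
  have "entropy_rate \<le> block_entropy n / n"
    unfolding entropy_rate_def
    by (rule cINF_lower) (use False in \<open>auto intro!: bdd_belowI[of _ 0] simp: block_entropy_nonneg\<close>)
  then show ?thesis using False by (simp add: field_simps)
qed (simp add: block_entropy_0)

lemma entropy_rate_nonneg: "0 \<le> entropy_rate"
  unfolding entropy_rate_def by (rule cINF_greatest) (auto simp: block_entropy_nonneg)

text \<open>If every increment exceeded \<open>entropy_rate + \<eta>\<close>, telescoping would push
  all quotients \<open>block_entropy n / n\<close> above their infimum.\<close>

lemma block_entropy_increment:
  assumes "0 < \<eta>"
  shows "\<exists>k. block_entropy (Suc k) - block_entropy k \<le> entropy_rate + \<eta>"
proof (rule ccontr)
  assume "\<not> ?thesis"
  then have inc: "entropy_rate + \<eta> \<le> block_entropy (Suc k) - block_entropy k" for k by (metis less_imp_le not_le)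
  have "n * (entropy_rate + \<eta>) \<le> block_entropy n" for n
  proof (induction n)
    case (Suc n)
    have "real (Suc n) * (entropy_rate + \<eta>) = n * (entropy_rate + \<eta>) + (entropy_rate + \<eta>)"
      by (simp add: algebra_simps)
    with Suc inc[of n] show ?case by linarith
  qed (simp add: block_entropy_0)
  then have "entropy_rate + \<eta> \<le> block_entropy n / n" if "1 \<le> n" for n
    using that by (simp add: field_simps)
  then have "entropy_rate + \<eta> \<le> (INF n\<in>{1..}. block_entropy n / n)" by (intro cINF_greatest) auto
  with assms show False by (simp add: entropy_rate_def)
qed

lemma sum_fiber_prob_snoc:
  assumes v: "length v = k"
  shows "(\<integral>\<^sup>+a. ennreal (fiber_prob M (initial_word (Suc k)) (v @ [a])) \<partial>count_space UNIV) \<le>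
    ennreal (fiber_prob M (initial_word k) v)"
proof -
  let ?A = "\<lambda>a. initial_word (Suc k) -` {v @ [a]} \<inter> space M"
  have A: "?A a \<in> sets M" for a by (rule measurable_sets[OF measurable_initial_word]) simp
  have "(\<integral>\<^sup>+a. ennreal (fiber_prob M (initial_word (Suc k)) (v @ [a])) \<partial>count_space UNIV) =
    (\<integral>\<^sup>+a. emeasure M (?A a) \<partial>count_space UNIV)"
    by (simp add: fiber_prob_def emeasure_eq_measure)
  also have "\<dots> = emeasure M (\<Union>a. ?A a)"
    by (rule emeasure_UN_countable[symmetric]) (use A in \<open>auto simp: disjoint_family_on_def\<close>)
  also have "\<dots> \<le> emeasure M (initial_word k -` {v} \<inter> space M)"
  proof (rule emeasure_mono)
    show "(\<Union>a. ?A a) \<subseteq> initial_word k -` {v} \<inter> space M"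
      using v by (auto simp: initial_word_def)
    show "initial_word k -` {v} \<inter> space M \<in> sets M"
      by (rule measurable_sets[OF measurable_initial_word]) simp
  qed
  also have "\<dots> = ennreal (fiber_prob M (initial_word k) v)"
    by (simp add: fiber_prob_def emeasure_eq_measure)
  finally show ?thesis .
qed

text \<open>
  The half of the Shannon--McMillan--Breiman theorem that is needed: the weights are those of the
  \<open>k\<close>-step Markov approximation of \<open>M\<close>, whose entropy is \<open>block_entropy (Suc k) - block_entropy k\<close>.
\<close>

lemma Markov_weights:
  assumes \<eta>: "0 < \<eta>"
  obtains q :: "nat list \<Rightarrow> real" where "\<And>w. 0 \<le> q w"
    "\<And>n. (\<integral>\<^sup>+w. ennreal (q w) \<partial>count_space (words n)) \<le> 1"
    "AE x in M. \<forall>\<^sub>F n in sequentially. exp (- (n * (entropy_rate + \<eta>))) \<le> q (initial_word n x)"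
proof -
  obtain k where k: "block_entropy (Suc k) - block_entropy k \<le> entropy_rate + \<eta> / 2"
    using block_entropy_increment[of "\<eta> / 2"] \<eta> by auto
  let ?r = "\<lambda>n. fiber_prob M (initial_word n)"
  \<comment> \<open>The conditional probability of the last letter given the \<open>k\<close> before
    it. Division by 0 gives 0 after a null word, so the total mass stays at most 1.\<close>
  define g where "g v = ?r (Suc k) v / ?r k (take k v)" for v
  define q where "q w = (if length w < k then 0 else
      ?r k (take k w) * (\<Prod>i<length w - k. g (take (Suc k) (drop i w))))" for w
  have g0: "0 \<le> g v" for v by (simp add: g_def)
  have q0: "0 \<le> q w" for w by (simp add: q_def g0 prod_nonneg)
  have sum_g: "(\<integral>\<^sup>+a. ennreal (g (v @ [a])) \<partial>count_space UNIV) \<le> 1" if v: "length v = k" for v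
  proof (cases "?r k v = 0")
    case False
    have "(\<integral>\<^sup>+a. ennreal (g (v @ [a])) \<partial>count_space UNIV) =
      (\<integral>\<^sup>+a. ennreal (1 / ?r k v) * ennreal (?r (Suc k) (v @ [a])) \<partial>count_space UNIV)"
      by (intro nn_integral_cong) (simp add: g_def v ennreal_mult[symmetric])
    also have "\<dots> = ennreal (1 / ?r k v) * (\<integral>\<^sup>+a. ennreal (?r (Suc k) (v @ [a])) \<partial>count_space UNIV)"
      by (simp add: nn_integral_cmult)
    also have "\<dots> \<le> ennreal (1 / ?r k v) * ennreal (?r k v)"
      by (intro mult_left_mono sum_fiber_prob_snoc v) simp
    also have "\<dots> = 1" using False by (simp add: ennreal_mult[symmetric])
    finally show ?thesis .
  qed (simp add: g_def v)
  have sum_q': "(\<integral>\<^sup>+w. ennreal (q w) \<partial>count_space (words (k + m))) \<le> 1" for m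
  proof (induction m)
    case 0
    have "(\<integral>\<^sup>+w. ennreal (q w) \<partial>count_space (words k)) = (\<integral>\<^sup>+w. ennreal (?r k w) \<partial>count_space (words k))"
      by (intro nn_integral_cong) (simp add: q_def words_def)
    also have "\<dots> \<le> 1" by (rule sum_fiber_prob[OF measurable_initial_word])
    finally show ?case by simp
  next
    case (Suc m)
    have "(\<integral>\<^sup>+w. ennreal (q w) \<partial>count_space (words (k + Suc m))) =
      (\<integral>\<^sup>+u. \<integral>\<^sup>+a. ennreal (q (u @ [a])) \<partial>count_space UNIV \<partial>count_space (words (k + m)))"
      by (simp add: nn_integral_words_snoc)
    also have "\<dots> = (\<integral>\<^sup>+u. ennreal (q u) * (\<integral>\<^sup>+a. ennreal (g (drop m u @ [a])) \<partial>count_space UNIV)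
        \<partial>count_space (words (k + m)))"
    proof (rule nn_integral_cong)
      fix u assume "u \<in> space (count_space (words (k + m)))"
      then have l: "length u = k + m" by (simp add: words_def)
      have "q (u @ [a]) = q u * g (drop m u @ [a])" for a
      proof -
        have "(\<Prod>i<m. g (take (Suc k) (drop i (u @ [a])))) = (\<Prod>i<m. g (take (Suc k) (drop i u)))"
          by (rule prod.cong) (auto simp: l)
        moreover have "take (Suc k) (drop m (u @ [a])) = drop m u @ [a]" by (simp add: l)
        ultimately show ?thesis by (simp add: q_def l Suc_diff_le)
      qed
      then show "(\<integral>\<^sup>+a. ennreal (q (u @ [a])) \<partial>count_space UNIV) =
          ennreal (q u) * (\<integral>\<^sup>+a. ennreal (g (drop m u @ [a])) \<partial>count_space UNIV)"
        by (simp add: ennreal_mult q0 g0 nn_integral_cmult)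
    qed
    also have "\<dots> \<le> (\<integral>\<^sup>+u. ennreal (q u) * 1 \<partial>count_space (words (k + m)))"
      by (intro nn_integral_mono mult_left_mono sum_g) (auto simp: words_def)
    also have "\<dots> \<le> 1" using Suc by simp
    finally show ?case .
  qed
  have sum_q: "(\<integral>\<^sup>+w. ennreal (q w) \<partial>count_space (words n)) \<le> 1" for n
  proof (cases "n < k")
    case True
    have "(\<integral>\<^sup>+w. ennreal (q w) \<partial>count_space (words n)) = (\<integral>\<^sup>+w. 0 \<partial>count_space (words n))"
      by (rule nn_integral_cong) (use True in \<open>simp add: q_def words_def\<close>)
    then show ?thesis by simp
  next
    case False
    with sum_q'[of "n - k"] show ?thesis by simp
  qed
  \<comment> \<open>The conditional information of one more letter after \<open>k\<close> letters.
    Almost surely \<open>- ln q\<close> is a Birkhoff sum of \<open>G\<close> plus the information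
    of the first \<open>k\<close> letters.\<close>
  define G where "G x = info M (initial_word (Suc k)) x - info M (initial_word k) x" for x
  have iG: "integrable M G" unfolding G_def[abs_def] by (intro Bochner_Integration.integrable_diff integrable_info_initial_word)
  have intG: "(\<integral>x. G x \<partial>M) \<le> entropy_rate + \<eta> / 2"
    using k unfolding G_def block_entropy_def by (simp add: integrable_info_initial_word)
  have pos: "AE x in M. 0 < ?r n (initial_word n x)" for n by (rule AE_fiber_prob_pos[OF measurable_initial_word])
  have "AE x in M. \<forall>i. 0 < ?r (Suc k) (initial_word (Suc k) ((shift_map ^^ i) x)) \<and>
      0 < ?r k (initial_word k ((shift_map ^^ i) x))"
    unfolding AE_all_countable by (intro allI AE_funpow AE_conjI pos)
  \<comment> \<open>The margin \<open>\<eta>\<close> is split: one half was spent on choosing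
    \<open>k\<close>, a quarter goes to the ergodic theorem and a quarter to the first
    \<open>k\<close> letters.\<close>
  moreover have "AE x in M. \<forall>\<^sub>F n in sequentially. shift_sum G n x \<le> n * ((\<integral>x. G x \<partial>M) + \<eta> / 4)"
    using \<eta> by (intro AE_birkhoff_sum_le iG) simp
  ultimately have "AE x in M. \<forall>\<^sub>F n in sequentially. exp (- (n * (entropy_rate + \<eta>))) \<le> q (initial_word n x)"
  proof eventually_elim
    case (elim x)
    have pos': "0 < ?r (Suc k) (initial_word (Suc k) ((shift_map ^^ i) x))"
      "0 < ?r k (initial_word k ((shift_map ^^ i) x))" for i
      using elim(1) by blast+
    have tk: "take k (initial_word (Suc k) y) = initial_word k y" for y by (simp add: take_initial_word)
    have q_exp: "q (initial_word (k + m) x) = exp (- info M (initial_word k) x - shift_sum G m x)" for m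
    proof -
      have "g (take (Suc k) (drop i (initial_word (k + m) x))) = exp (- G ((shift_map ^^ i) x))" if "i < m" for i
      proof -
        have "take (Suc k) (drop i (initial_word (k + m) x)) = initial_word (Suc k) ((shift_map ^^ i) x)"
          using take_drop_itinerary[of i "Suc k" "k + m" shift_map "\<lambda>x. x 0" x] that
          by (simp add: itinerary_shift_map)
        then show ?thesis using pos'[of i] by (simp add: g_def tk G_def info_def exp_diff exp_minus field_simps exp_add)
      qed
      then have "(\<Prod>i<m. g (take (Suc k) (drop i (initial_word (k + m) x)))) = exp (- shift_sum G m x)"
        by (simp add: birkhoff_sum_def exp_sum sum_negf[symmetric])
      moreover have "?r k (initial_word k x) = exp (- info M (initial_word k) x)"
        using pos'(2)[of 0] by (simp add: info_def)
      ultimately show ?thesis by (simp add: q_def take_initial_word mult_exp_exp)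
    qed
    obtain n0 where n0: "\<And>n. n0 \<le> n \<Longrightarrow> shift_sum G n x \<le> n * ((\<integral>x. G x \<partial>M) + \<eta> / 4)"
      using elim(2) by (auto simp: eventually_sequentially)
    obtain m0 :: nat where m0: "info M (initial_word k) x * 4 / \<eta> \<le> m0" using real_arch_simple by blast
    have "exp (- (n * (entropy_rate + \<eta>))) \<le> q (initial_word n x)" if n: "k + n0 + m0 \<le> n" for n
    proof -
      define m where "m = n - k"
      have m: "n = k + m" "n0 \<le> m" "m0 \<le> m" using n by (auto simp: m_def)
      have "info M (initial_word k) x * 4 / \<eta> \<le> m" using m0 m(3) by linarith
      then have "info M (initial_word k) x \<le> m * (\<eta> / 4)" using \<eta> by (simp add: field_simps)
      moreover have "shift_sum G m x \<le> m * (entropy_rate + \<eta> / 2 + \<eta> / 4)"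
        using n0[OF m(2)] intG by (meson add_right_mono mult_left_mono of_nat_0_le_iff order_trans)
      ultimately have "info M (initial_word k) x + shift_sum G m x \<le> m * (entropy_rate + \<eta>)"
        by (simp add: algebra_simps)
      also have "\<dots> \<le> n * (entropy_rate + \<eta>)"
        using \<eta> entropy_rate_nonneg m(1) by (intro mult_right_mono) auto
      finally show ?thesis unfolding m(1) q_exp by simp
    qed
    then show ?case by (auto simp: eventually_sequentially)
  qed
  with q0 sum_q show thesis by (rule that)
qed

end

section \<open>Reducing the defect of a potential\<close>

lemma tendsto_exp_neg_mult:
  fixes c :: real
  assumes "0 < c"
  shows "(\<lambda>n. exp (- (real n * c))) \<longlonglongrightarrow> 0"
proof -
  have "(\<lambda>n. exp (- c) ^ n) \<longlonglongrightarrow> 0" by (rule LIMSEQ_realpow_zero) (use assms in auto)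
  then show ?thesis by (simp add: exp_of_nat_mult[symmetric])
qed

context ergodic_shift
begin

text \<open>Block entropies are at least \<open>n * entropy_rate\<close>, while the error
  \<open>ln C + K\<close> in Gibbs' bound does not depend on \<open>n\<close>. Hence the defect is
  nonnegative.\<close>

lemma entropy_rate_le_integral:
  assumes K: "distortion_bound \<phi> K" and C: "weight_bound \<phi> C" and i: "integrable M \<phi>"
  shows "entropy_rate \<le> - (\<integral>x. \<phi> x \<partial>M)"
proof (rule ccontr)
  assume "\<not> ?thesis"
  then have pos: "0 < entropy_rate + (\<integral>x. \<phi> x \<partial>M)" by simp
  obtain n :: nat where "(ln C + K) / (entropy_rate + (\<integral>x. \<phi> x \<partial>M)) < n" using reals_Archimedean2 by blast
  then have "ln C + K < n * (entropy_rate + (\<integral>x. \<phi> x \<partial>M))" using pos by (simp add: field_simps)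
  moreover have "n * entropy_rate \<le> n * - (\<integral>x. \<phi> x \<partial>M) + (ln C + K)"
    using entropy_rate_le[of n] initial_word_entropy_le(2)[OF K C i, of n]
    unfolding block_entropy_def by linarith
  ultimately show False by (simp add: algebra_simps)
qed

text \<open>
  Raises \<open>\<phi>\<close> by almost all of its defect \<open>- entropy_rate - \<integral>\<phi>\<close> on words that are typical
  for \<open>M\<close>, and lowers it slightly on all others: there are at most \<open>exp (N * (entropy_rate + \<eta>))\<close>
  typical words, and \<open>shift_sum \<phi> N\<close> is close to \<open>N * \<integral>\<phi>\<close> on them.
\<close>

lemma defect_reduction:
  assumes K: "distortion_bound \<phi> K" and C: "weight_bound \<phi> C" and i: "integrable M \<phi>"
    and \<tau>: "0 < \<tau>" and \<epsilon>: "0 < \<epsilon>" and F: "finite F"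
    and Fi: "\<And>f. f \<in> F \<Longrightarrow> integrable M f" and FK: "\<And>f. f \<in> F \<Longrightarrow> \<exists>K. distortion_bound f K"
  obtains N T b where "0 < N" "- \<epsilon> \<le> b" "b \<le> - entropy_rate - (\<integral>x. \<phi> x \<partial>M)"
    "\<exists>C'. weight_bound (\<lambda>x. \<phi> x + (if initial_word N x \<in> T then b else - \<tau>)) C'"
    "- entropy_rate - (\<integral>x. \<phi> x + (if initial_word N x \<in> T then b else - (2 * \<tau>)) \<partial>M) \<le> \<epsilon>"
    "\<And>f x. f \<in> F \<Longrightarrow> initial_word N x \<in> T \<Longrightarrow> shift_sum f N x \<le> N * ((\<integral>x. f x \<partial>M) + \<epsilon>)"
proof -
  define D where "D = - entropy_rate - (\<integral>x. \<phi> x \<partial>M)"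
  have D0: "0 \<le> D" using entropy_rate_le_integral[OF K C i] by (simp add: D_def)
  have C0: "0 < C" using C by (simp add: weight_bound_def)
  \<comment> \<open>Half of \<open>\<epsilon>\<close> is \<open>3 * \<eta>\<close>, by which
    \<open>b\<close> falls short of \<open>D\<close>; the other half is for the non-typical words
    and fixes \<open>\<delta>\<close>.\<close>
  define \<eta> where "\<eta> = \<epsilon> / 6"
  have \<eta>: "0 < \<eta>" using \<epsilon> by (simp add: \<eta>_def)
  obtain q where q0: "\<And>w. 0 \<le> q w"
    and sum_q: "\<And>n. (\<integral>\<^sup>+w. ennreal (q w) \<partial>count_space (words n)) \<le> 1"
    and q_ge: "AE x in M. \<forall>\<^sub>F n in sequentially. exp (- (n * (entropy_rate + \<eta>))) \<le> q (initial_word n x)"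
    using Markov_weights[OF \<eta>] by blast
  have "\<forall>f\<in>insert \<phi> F. \<exists>K. distortion_bound f K" using FK K by blast
  then obtain Kf where Kf: "\<And>f. f \<in> insert \<phi> F \<Longrightarrow> distortion_bound f (Kf f)" by metis
  have Kn: "\<forall>\<^sub>F n in sequentially. Kf f \<le> n * (\<eta> / 2)" for f
  proof -
    obtain n0 :: nat where n0: "Kf f / (\<eta> / 2) \<le> n0" using real_arch_simple by blast
    have "Kf f \<le> n * (\<eta> / 2)" if "n0 \<le> n" for n
    proof -
      have "Kf f / (\<eta> / 2) \<le> n" using n0 that by linarith
      then show ?thesis using \<eta> by (simp add: field_simps)
    qed
    then show ?thesis by (auto simp: eventually_sequentially)
  qed
  have pad_le: "shift_sum f n (pad (initial_word n x)) \<le> shift_sum f n x + Kf f"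
    and pad_ge: "shift_sum f n x \<le> shift_sum f n (pad (initial_word n x)) + Kf f"
    if "f \<in> insert \<phi> F" for f n x
    by (rule distortion_boundD[OF Kf[OF that]], simp add: pad_def nth_initial_word)+
  \<comment> \<open>Typicality has to be a property of the word alone, hence the padding. The lower
    bound on \<open>q\<close> stands in for a bound on the number of typical words.\<close>
  define good where "good n w \<longleftrightarrow> exp (- (n * (entropy_rate + \<eta>))) \<le> q w \<and>
      (\<forall>f\<in>insert \<phi> F. shift_sum f n (pad w) \<le> n * ((\<integral>x. f x \<partial>M) + \<eta>))" for n :: nat and w
  have ev_f: "AE x in M. \<forall>\<^sub>F n in sequentially. shift_sum f n (pad (initial_word n x)) \<le> n * ((\<integral>x. f x \<partial>M) + \<eta>)"
    if f: "f \<in> insert \<phi> F" for f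
  proof -
    have "integrable M f" using f i Fi by blast
    then have "AE x in M. \<forall>\<^sub>F n in sequentially. shift_sum f n x \<le> n * ((\<integral>x. f x \<partial>M) + \<eta> / 2)"
      using \<eta> by (intro AE_birkhoff_sum_le) auto
    then show ?thesis
    proof eventually_elim
      case (elim x)
      then show ?case using Kn[of f]
      proof eventually_elim
        case (elim n)
        then show ?case using pad_le[OF f, of n x] by (simp add: algebra_simps)
      qed
    qed
  qed
  have "AE x in M. \<forall>f\<in>insert \<phi> F. \<forall>\<^sub>F n in sequentially.
      shift_sum f n (pad (initial_word n x)) \<le> n * ((\<integral>x. f x \<partial>M) + \<eta>)"
    by (rule AE_finite_allI) (use F ev_f in auto)
  with q_ge have AE_good: "AE x in M. \<forall>\<^sub>F n in sequentially. good n (initial_word n x)"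
  proof eventually_elim
    case (elim x)
    then have "\<forall>\<^sub>F n in sequentially. \<forall>f\<in>insert \<phi> F.
        shift_sum f n (pad (initial_word n x)) \<le> n * ((\<integral>x. f x \<partial>M) + \<eta>)"
      using F by (intro eventually_ball_finite) auto
    with elim(1) show ?case unfolding good_def by (rule eventually_conj)
  qed
  have good_set: "{x \<in> space M. good n (initial_word n x)} \<in> sets M" for n
  proof -
    have "{x \<in> space M. good n (initial_word n x)} = initial_word n -` {w. good n w} \<inter> space M" by auto
    also have "\<dots> \<in> sets M" by (rule measurable_sets[OF measurable_initial_word]) simp
    finally show ?thesis .
  qed
  have lim1: "(\<lambda>n. prob {x \<in> space M. good n (initial_word n x)}) \<longlonglongrightarrow> 1"
    by (rule prob_tendsto_1[OF _ AE_good]) (simp add: pred_def good_set)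
  \<comment> \<open>A point outside the typical set contributes \<open>D + 2 * \<tau>\<close> to the
    new defect.\<close>
  define \<delta> where "\<delta> = \<epsilon> / (2 * (D + 2 * \<tau>))"
  have \<delta>: "0 < \<delta>" using \<epsilon> \<tau> D0 by (simp add: \<delta>_def)
  have "\<forall>\<^sub>F n in sequentially. 1 - \<delta> < prob {x \<in> space M. good n (initial_word n x)}"
    by (rule order_tendstoD(1)[OF lim1]) (use \<delta> in simp)
  \<comment> \<open>The two terms bound the block sum over typical and over other words: the first
    decays through the margin \<open>\<eta>\<close>, the second through the lowering by
    \<open>\<tau>\<close>. Together they have to stay below 1.\<close>
  moreover have "\<forall>\<^sub>F n in sequentially. exp K * exp (- (real n * \<eta>)) + exp K * exp (- (real n * \<tau>)) * C < 1"
  proof (rule order_tendstoD(2))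
    show "(\<lambda>n. exp K * exp (- (real n * \<eta>)) + exp K * exp (- (real n * \<tau>)) * C) \<longlonglongrightarrow>
        exp K * 0 + exp K * 0 * C"
      by (intro tendsto_add tendsto_mult tendsto_const tendsto_exp_neg_mult \<eta> \<tau>)
  qed simp
  moreover have "\<forall>\<^sub>F n in sequentially. \<forall>f\<in>F. Kf f \<le> n * (\<eta> / 2)"
    by (rule eventually_ball_finite[OF F]) (use Kn in auto)
  moreover have "\<forall>\<^sub>F n in sequentially. 0 < (n :: nat)" by (rule eventually_gt_at_top)
  ultimately have "\<forall>\<^sub>F n in sequentially. 1 - \<delta> < prob {x \<in> space M. good n (initial_word n x)} \<and>
      exp K * exp (- (real n * \<eta>)) + exp K * exp (- (real n * \<tau>)) * C < 1 \<and>
      (\<forall>f\<in>F. Kf f \<le> n * (\<eta> / 2)) \<and> 0 < n"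
    by eventually_elim blast
  then obtain N where prob_N: "1 - \<delta> < prob {x \<in> space M. good N (initial_word N x)}"
    and small: "exp K * exp (- (real N * \<eta>)) + exp K * exp (- (real N * \<tau>)) * C < 1"
    and KN: "\<And>f. f \<in> F \<Longrightarrow> Kf f \<le> N * (\<eta> / 2)" and N: "0 < N"
    unfolding eventually_sequentially by blast
  define T where "T = {w. good N w}"
  \<comment> \<open>One \<open>\<eta>\<close> pays for the deviation of the sums of
    \<open>\<phi>\<close>, one for the lower bound on \<open>q\<close>, and the third is left to
    beat \<open>exp K\<close>.\<close>
  define b where "b = D - 3 * \<eta>"
  define \<beta> where "\<beta> w = (if w \<in> T then b else - \<tau>)" for w
  show thesis
  proof (rule that)
    show "0 < N" by (rule N)
    show "- \<epsilon> \<le> b" using D0 \<epsilon> by (simp add: b_def \<eta>_def)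
    show "b \<le> - entropy_rate - (\<integral>x. \<phi> x \<partial>M)" using \<eta> by (simp add: b_def D_def)
    have "\<exists>C'. weight_bound (\<lambda>x. \<phi> x + \<beta> (initial_word N x)) C'"
    proof (rule weight_bound_block_modification[OF K C N])
      show "\<bar>\<beta> w\<bar> \<le> \<bar>b\<bar> + \<bar>\<tau>\<bar>" for w by (simp add: \<beta>_def)
      have "(\<integral>\<^sup>+u. ennreal (exp (shift_sum \<phi> N (pad u) + K + N * \<beta> u)) \<partial>count_space (words N)) \<le>
        (\<integral>\<^sup>+u. ennreal (exp K * exp (- (real N * \<eta>))) * ennreal (q u) +
          ennreal (exp K * exp (- (real N * \<tau>))) * ennreal (exp (shift_sum \<phi> N (pad u))) \<partial>count_space (words N))"
      proof (rule nn_integral_mono)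
        fix u
        have "exp (shift_sum \<phi> N (pad u) + K + N * \<beta> u) \<le> exp K * exp (- (real N * \<eta>)) * q u +
          exp K * exp (- (real N * \<tau>)) * exp (shift_sum \<phi> N (pad u))"
        proof (cases "u \<in> T")
          case True
          then have qu: "exp (- (N * (entropy_rate + \<eta>))) \<le> q u"
            and "shift_sum \<phi> N (pad u) \<le> N * ((\<integral>x. \<phi> x \<partial>M) + \<eta>)"
            by (simp_all add: T_def good_def)
          then have "shift_sum \<phi> N (pad u) + K + N * \<beta> u \<le>
              K + (- (real N * \<eta>)) + (- (N * (entropy_rate + \<eta>)))"
            using True by (simp add: \<beta>_def b_def D_def algebra_simps)
          then have "exp (shift_sum \<phi> N (pad u) + K + N * \<beta> u) \<le>
              exp K * exp (- (real N * \<eta>)) * exp (- (N * (entropy_rate + \<eta>)))"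
            by (simp add: mult_exp_exp)
          also have "\<dots> \<le> exp K * exp (- (real N * \<eta>)) * q u" by (rule mult_left_mono[OF qu]) simp
          finally show ?thesis by (rule add_increasing2[rotated]) simp
        next
          case False
          then have "exp (shift_sum \<phi> N (pad u) + K + N * \<beta> u) =
              exp K * exp (- (real N * \<tau>)) * exp (shift_sum \<phi> N (pad u))"
            by (simp add: \<beta>_def mult_exp_exp algebra_simps)
          then show ?thesis using q0[of u] by simp
        qed
        then have "ennreal (exp (shift_sum \<phi> N (pad u) + K + N * \<beta> u)) \<le>
          ennreal (exp K * exp (- (real N * \<eta>)) * q u +
          exp K * exp (- (real N * \<tau>)) * exp (shift_sum \<phi> N (pad u)))" by (rule ennreal_leI)
        also have "\<dots> = ennreal (exp K * exp (- (real N * \<eta>))) * ennreal (q u) +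
          ennreal (exp K * exp (- (real N * \<tau>))) * ennreal (exp (shift_sum \<phi> N (pad u)))"
          by (simp add: ennreal_plus ennreal_mult q0 del: ennreal_plus[symmetric])
        finally show "ennreal (exp (shift_sum \<phi> N (pad u) + K + N * \<beta> u)) \<le>
          ennreal (exp K * exp (- (real N * \<eta>))) * ennreal (q u) +
          ennreal (exp K * exp (- (real N * \<tau>))) * ennreal (exp (shift_sum \<phi> N (pad u)))" .
      qed
      also have "\<dots> = ennreal (exp K * exp (- (real N * \<eta>))) * (\<integral>\<^sup>+u. ennreal (q u) \<partial>count_space (words N)) +
          ennreal (exp K * exp (- (real N * \<tau>))) *
            (\<integral>\<^sup>+u. ennreal (exp (shift_sum \<phi> N (pad u))) \<partial>count_space (words N))"
        by (simp add: nn_integral_add nn_integral_cmult)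
      also have "\<dots> \<le> ennreal (exp K * exp (- (real N * \<eta>))) * 1 +
          ennreal (exp K * exp (- (real N * \<tau>))) * ennreal C"
        using C by (intro add_mono mult_left_mono sum_q) (auto simp: weight_bound_def)
      also have "\<dots> = ennreal (exp K * exp (- (real N * \<eta>)) + exp K * exp (- (real N * \<tau>)) * C)"
        using C0 by (simp add: ennreal_mult)
      also have "\<dots> \<le> 1" using small by simp
      finally show "(\<integral>\<^sup>+u. ennreal (exp (shift_sum \<phi> N (pad u) + K + N * \<beta> u)) \<partial>count_space (words N)) \<le> 1" .
    qed
    then show "\<exists>C'. weight_bound (\<lambda>x. \<phi> x + (if initial_word N x \<in> T then b else - \<tau>)) C'"
      by (simp add: \<beta>_def)
    define A where "A = {x \<in> space M. good N (initial_word N x)}"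
    have A [measurable]: "A \<in> sets M" unfolding A_def by (rule good_set)
    have "(\<integral>x. \<phi> x + (if initial_word N x \<in> T then b else - (2 * \<tau>)) \<partial>M) =
        (\<integral>x. \<phi> x + ((b + 2 * \<tau>) * indicator A x + - (2 * \<tau>)) \<partial>M)"
      by (rule Bochner_Integration.integral_cong) (auto simp: A_def T_def)
    also have "\<dots> = (\<integral>x. \<phi> x \<partial>M) + ((b + 2 * \<tau>) * prob A + - (2 * \<tau>))"
    proof -
      have "integrable M (\<lambda>x. (b + 2 * \<tau>) * indicator A x)" by (simp add: emeasure_eq_measure)
      then show ?thesis
        by (subst Bochner_Integration.integral_add, use i in simp, simp, subst Bochner_Integration.integral_add)
          (auto simp: prob_space)
    qed
    finally have "- entropy_rate - (\<integral>x. \<phi> x + (if initial_word N x \<in> T then b else - (2 * \<tau>)) \<partial>M) =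
        (D + 2 * \<tau>) * (1 - prob A) + 3 * \<eta> * prob A"
      by (simp add: D_def b_def algebra_simps)
    also have "(D + 2 * \<tau>) * (1 - prob A) \<le> (D + 2 * \<tau>) * \<delta>"
      using prob_N D0 \<tau> by (intro mult_left_mono) (auto simp: A_def)
    also have "\<dots> = \<epsilon> / 2"
    proof -
      have "D + 2 * \<tau> \<noteq> 0" using D0 \<tau> by simp
      then show ?thesis unfolding \<delta>_def by (simp add: divide_simps)
    qed
    also have "3 * \<eta> * prob A \<le> \<epsilon> / 2"
      using mult_left_mono[OF prob_le_1[of A], of "3 * \<eta>"] \<eta> by (simp add: \<eta>_def)
    finally show "- entropy_rate - (\<integral>x. \<phi> x + (if initial_word N x \<in> T then b else - (2 * \<tau>)) \<partial>M) \<le> \<epsilon>"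
      by simp
    fix f x assume f: "f \<in> F" and x: "initial_word N x \<in> T"
    have "shift_sum f N x \<le> shift_sum f N (pad (initial_word N x)) + Kf f" by (rule pad_ge) (use f in simp)
    also have "\<dots> \<le> N * ((\<integral>x. f x \<partial>M) + \<eta>) + N * (\<eta> / 2)"
      using x f KN[OF f] by (intro add_mono) (auto simp: T_def good_def)
    also have "\<dots> \<le> N * ((\<integral>x. f x \<partial>M) + \<epsilon>)"
      unfolding distrib_left[symmetric] using \<epsilon> by (intro mult_left_mono) (auto simp: \<eta>_def)
    finally show "shift_sum f N x \<le> N * ((\<integral>x. f x \<partial>M) + \<epsilon>)" .
  qed
qed

end

lemma convergent_if_increments_summable:
  fixes a :: "nat \<Rightarrow> real"
  assumes "\<And>n. 1 \<le> n \<Longrightarrow> \<bar>a (Suc n) - a n\<bar> \<le> r n" and "summable r"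
  shows "convergent a"
proof -
  have "summable (\<lambda>n. a (Suc n) - a n)"
    by (rule summable_comparison_test'[OF assms(2), of 1]) (use assms(1) in auto)
  then have "convergent (\<lambda>n. \<Sum>k<n. a (Suc k) - a k)" by (simp add: summable_iff_convergent)
  then have "convergent (\<lambda>n. (a n - a 0) + a 0)"
    unfolding sum_lessThan_telescope by (intro convergent_add convergent_const)
  then show ?thesis by simp
qed

text \<open>Telescoping against \<open>c * d\<close>, dropping the nonnegative last term. The bound
  is one-sided because the potentials move upwards far less than downwards.\<close>

lemma limit_le_if_increments_le:
  fixes a :: "nat \<Rightarrow> real"
  assumes lim: "a \<longlonglongrightarrow> l" and inc: "\<And>n. m \<le> n \<Longrightarrow> a (Suc n) - a n \<le> c * (d n - d (Suc n))"
    and d: "\<And>n. 0 \<le> d n" and c: "0 \<le> c"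
  shows "l \<le> a m + c * d m"
proof (rule LIMSEQ_le_const2[OF lim], intro exI allI impI)
  fix n assume "m \<le> n"
  then have "a n \<le> a m + c * (d m - d n)"
  proof (induction n rule: dec_induct)
    case (step n)
    then show ?case using inc[of n] by (simp add: algebra_simps)
  qed simp
  moreover have "0 \<le> c * d n" using c d by simp
  ultimately show "a n \<le> a m + c * d m" by (simp add: algebra_simps)
qed

text \<open>Defined on all sequences and not only on the shift space, because
  \<open>distortion_bound\<close> compares arbitrary sequences.\<close>

definition cylinder_indicator :: "nat list \<Rightarrow> (nat \<Rightarrow> nat) \<Rightarrow> real" where
  "cylinder_indicator w x = of_bool (initial_word (length w) x = w)"

lemma depends_on_first_cylinder_indicator: "depends_on_first (length w) (cylinder_indicator w)"
  using depends_on_first_initial_word[of "length w" "\<lambda>v. of_bool (v = w)"]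
  by (simp add: cylinder_indicator_def[abs_def])

lemma distortion_bound_bounded:
  assumes "depends_on_first L f" "\<And>x. \<bar>f x\<bar> \<le> c"
  shows "distortion_bound f (L * (2 * c))"
proof (rule distortion_bound_if_depends_on_first[OF assms(1)])
  show "\<bar>f x - f y\<bar> \<le> 2 * c" for x y using assms(2)[of x] assms(2)[of y] by linarith
qed

lemma (in shift_invariant) integral_cylinder_indicator:
  "integrable M (cylinder_indicator w)" "(\<integral>x. cylinder_indicator w x \<partial>M) = prob (cylinder w)"
proof -
  have eq: "x \<in> space M \<Longrightarrow> cylinder_indicator w x = indicator (cylinder w) x" for x
    by (simp add: cylinder_indicator_def cylinder_def)
  have "integrable M (cylinder_indicator w) \<longleftrightarrow> integrable M (indicator (cylinder w) :: _ \<Rightarrow> real)"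
    by (rule Bochner_Integration.integrable_cong) (simp_all add: eq)
  then show "integrable M (cylinder_indicator w)" by (simp add: emeasure_eq_measure)
  have "(\<integral>x. cylinder_indicator w x \<partial>M) = (\<integral>x. indicator (cylinder w) x \<partial>M)"
    by (rule Bochner_Integration.integral_cong) (simp_all add: eq)
  then show "(\<integral>x. cylinder_indicator w x \<partial>M) = prob (cylinder w)" by simp
qed

text \<open>Finite families that exhaust all words, enumerated by \<open>from_nat\<close>. With the
  negatives included, one-sided estimates yield equality of measures.\<close>

definition cylinder_tests :: "nat \<Rightarrow> ((nat \<Rightarrow> nat) \<Rightarrow> real) set" where
  "cylinder_tests m = (\<Union>k\<le>m. {cylinder_indicator (from_nat k), \<lambda>x. - cylinder_indicator (from_nat k) x})"

lemma abs_cylinder_test_le: "f \<in> cylinder_tests m \<Longrightarrow> \<bar>f x\<bar> \<le> 1"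
  by (auto simp: cylinder_tests_def cylinder_indicator_def)

lemma distortion_bound_cylinder_test:
  assumes f: "f \<in> cylinder_tests m"
  shows "\<exists>K. distortion_bound f K"
proof -
  obtain k where "f = cylinder_indicator (from_nat k) \<or> f = (\<lambda>x. - cylinder_indicator (from_nat k) x)"
    using f by (auto simp: cylinder_tests_def)
  then have "depends_on_first (length (from_nat k :: nat list)) f"
    using depends_on_first_cylinder_indicator[of "from_nat k"] by (auto simp: depends_on_first_def)
  then have "distortion_bound f (real (length (from_nat k :: nat list)) * (2 * 1))"
    by (rule distortion_bound_bounded) (rule abs_cylinder_test_le[OF f])
  then show ?thesis ..
qed

lemma (in shift_invariant) integrable_cylinder_test: "f \<in> cylinder_tests m \<Longrightarrow> integrable M f"
  by (auto simp: cylinder_tests_def integral_cylinder_indicator(1))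

section \<open>The iteration and its typical words\<close>

context ergodic_shift
begin

text \<open>The partition functions are already bounded after a lowering by
  \<open>(1/4) ^ m\<close>, whereas \<open>\<phi>'\<close> is lowered by twice as much. This surplus
  penalises measures that charge non-typical words.\<close>

definition potential_step ::
  "nat \<Rightarrow> ((nat \<Rightarrow> nat) \<Rightarrow> real) \<Rightarrow> ((nat \<Rightarrow> nat) \<Rightarrow> real) \<Rightarrow> nat \<Rightarrow> nat list set \<Rightarrow> real \<Rightarrow> bool" where
  "potential_step m \<phi> \<phi>' N T b \<longleftrightarrow> 0 < N \<and> - ((1/8) ^ Suc m) \<le> b \<and>
    b \<le> - entropy_rate - (\<integral>x. \<phi> x \<partial>M) \<and>
    (\<exists>C. weight_bound (\<lambda>x. \<phi> x + (if initial_word N x \<in> T then b else - ((1/4) ^ m))) C) \<and>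
    \<phi>' = (\<lambda>x. \<phi> x + (if initial_word N x \<in> T then b else - (2 * (1/4) ^ m))) \<and>
    (\<forall>f\<in>cylinder_tests m. \<forall>x. initial_word N x \<in> T \<longrightarrow>
      shift_sum f N x \<le> N * ((\<integral>x. f x \<partial>M) + (1/8) ^ Suc m))"

lemma potential_sequence:
  assumes p: "\<And>a. 0 < p a" and sum_p: "(\<integral>\<^sup>+a. ennreal (p a) \<partial>count_space UNIV) \<le> 1"
    and ip: "integrable M (\<lambda>x. ln (p (x 0)))"
  obtains \<phi> where
    "\<And>m. \<exists>L. depends_on_first L (\<phi> m)" "\<And>m. \<exists>c. \<forall>x. \<bar>\<phi> m x - ln (p (x 0))\<bar> \<le> c"
    "\<And>m. integrable M (\<phi> m)" "\<And>m. 1 \<le> m \<Longrightarrow> - entropy_rate - (\<integral>x. \<phi> m x \<partial>M) \<le> (1/8) ^ m"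
    "\<And>m. \<exists>N T b. potential_step m (\<phi> m) (\<phi> (Suc m)) N T b"
proof -
  \<comment> \<open>Bounded distance from \<open>ln (p (x 0))\<close> yields both integrability and
    bounded distortion, and each step preserves it. The defect bound starts at \<open>m = 1\<close>
    because the initial defect is arbitrary.\<close>
  define P where "P m \<phi> \<longleftrightarrow> (\<exists>L. depends_on_first L \<phi>) \<and> (\<exists>c. \<forall>x. \<bar>\<phi> x - ln (p (x 0))\<bar> \<le> c) \<and>
    (\<exists>C. weight_bound \<phi> C) \<and> (1 \<le> m \<longrightarrow> - entropy_rate - (\<integral>x. \<phi> x \<partial>M) \<le> (1/8) ^ m)"
    for m :: nat and \<phi> :: "(nat \<Rightarrow> nat) \<Rightarrow> real"
  have int: "integrable M \<phi>" if L: "depends_on_first L \<phi>" and c: "\<And>x. \<bar>\<phi> x - ln (p (x 0))\<bar> \<le> c" for \<phi> L c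
  proof (rule Bochner_Integration.integrable_bound)
    show "integrable M (\<lambda>x. \<bar>ln (p (x 0))\<bar> + c)" using ip by simp
    show "\<phi> \<in> borel_measurable M" by (rule measurable_depends_on_first[OF L]) simp
    have "norm (\<phi> x) \<le> norm (\<bar>ln (p (x 0))\<bar> + c)" for x
      unfolding real_norm_def using c[of x] by linarith
    then show "AE x in M. norm (\<phi> x) \<le> norm (\<bar>ln (p (x 0))\<bar> + c)" by simp
  qed
  have "\<exists>\<phi>. \<forall>m. P m (\<phi> m) \<and> (\<exists>N T b. potential_step m (\<phi> m) (\<phi> (Suc m)) N T b)"
  proof (rule dependent_nat_choice)
    have "depends_on_first (Suc 0) (\<lambda>x. ln (p (x 0)))" by (simp add: depends_on_first_def)
    then show "\<exists>\<phi>. P 0 \<phi>"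
      unfolding P_def using weight_bound_ln[OF p sum_p] by (intro exI[of _ "\<lambda>x. ln (p (x 0))"]) auto
  next
    fix \<phi> m assume "P m \<phi>"
    then obtain L c C where L: "depends_on_first L \<phi>" and c: "\<And>x. \<bar>\<phi> x - ln (p (x 0))\<bar> \<le> c"
      and C: "weight_bound \<phi> C" by (auto simp: P_def)
    have K: "distortion_bound \<phi> (L * (2 * c))"
    proof (rule distortion_bound_if_depends_on_first[OF L])
      fix x y :: "nat \<Rightarrow> nat" assume "x 0 = y 0"
      then show "\<bar>\<phi> x - \<phi> y\<bar> \<le> 2 * c" using c[of x] c[of y] by simp
    qed
    have fin: "finite (cylinder_tests m)" by (simp add: cylinder_tests_def)
    have pos: "0 < (1/4 :: real) ^ m" "0 < (1/8 :: real) ^ Suc m" by simp_all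
    obtain N T b where step: "0 < N" "- ((1/8) ^ Suc m) \<le> b" "b \<le> - entropy_rate - (\<integral>x. \<phi> x \<partial>M)"
      "\<exists>C'. weight_bound (\<lambda>x. \<phi> x + (if initial_word N x \<in> T then b else - ((1/4) ^ m))) C'"
      "- entropy_rate - (\<integral>x. \<phi> x + (if initial_word N x \<in> T then b else - (2 * (1/4) ^ m)) \<partial>M) \<le> (1/8) ^ Suc m"
      "\<And>f x. f \<in> cylinder_tests m \<Longrightarrow> initial_word N x \<in> T \<Longrightarrow>
        shift_sum f N x \<le> N * ((\<integral>x. f x \<partial>M) + (1/8) ^ Suc m)"
    proof (rule defect_reduction[OF K C int[OF L c] pos fin])
      show "integrable M f" "\<exists>K. distortion_bound f K" if "f \<in> cylinder_tests m" for f
        using that by (rule integrable_cylinder_test distortion_bound_cylinder_test)+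
    qed (rule that)
    define \<phi>' where "\<phi>' = (\<lambda>x. \<phi> x + (if initial_word N x \<in> T then b else - (2 * (1/4) ^ m)))"
    have "potential_step m \<phi> \<phi>' N T b"
      unfolding potential_step_def \<phi>'_def by (intro conjI step(1-4) refl ballI allI impI) (rule step(6))
    moreover have "P (Suc m) \<phi>'"
      unfolding P_def
    proof (intro conjI)
      have "depends_on_first (max L N) \<phi>'"
        unfolding depends_on_first_def
      proof (intro allI impI)
        fix x y :: "nat \<Rightarrow> nat" assume xy: "\<forall>i<max L N. x i = y i"
        then have "initial_word N x = initial_word N y" by (intro initial_word_eqI) simp
        moreover have "\<phi> x = \<phi> y" by (rule depends_on_firstD[OF L]) (use xy in simp)
        ultimately show "\<phi>' x = \<phi>' y" by (simp add: \<phi>'_def)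
      qed
      then show "\<exists>L. depends_on_first L \<phi>'" by blast
      have "\<bar>\<phi>' x - ln (p (x 0))\<bar> \<le> c + (\<bar>b\<bar> + 2 * (1/4) ^ m)" for x
      proof -
        have "\<bar>\<phi>' x - \<phi> x\<bar> \<le> \<bar>b\<bar> + 2 * (1/4) ^ m" by (simp add: \<phi>'_def)
        then show ?thesis using c[of x] by linarith
      qed
      then show "\<exists>c. \<forall>x. \<bar>\<phi>' x - ln (p (x 0))\<bar> \<le> c" by blast
      obtain C' where C': "weight_bound (\<lambda>x. \<phi> x + (if initial_word N x \<in> T then b else - ((1/4) ^ m))) C'"
        using step(4) by blast
      have "weight_bound \<phi>' C'" by (rule weight_bound_mono[OF C']) (simp add: \<phi>'_def)
      then show "\<exists>C. weight_bound \<phi>' C" by blast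
      show "1 \<le> Suc m \<longrightarrow> - entropy_rate - (\<integral>x. \<phi>' x \<partial>M) \<le> (1/8) ^ Suc m"
        unfolding \<phi>'_def using step(5) by blast
    qed
    ultimately show "\<exists>\<phi>'. P (Suc m) \<phi>' \<and> (\<exists>N T b. potential_step m \<phi> \<phi>' N T b)" by blast
  qed
  then obtain \<phi> where P: "\<And>m. P m (\<phi> m)" and st: "\<And>m. \<exists>N T b. potential_step m (\<phi> m) (\<phi> (Suc m)) N T b"
    by blast
  show thesis
  proof (rule that[of \<phi>])
    show "integrable M (\<phi> m)" for m
    proof -
      obtain L c where "depends_on_first L (\<phi> m)" "\<And>x. \<bar>\<phi> m x - ln (p (x 0))\<bar> \<le> c"
        using P[of m] unfolding P_def by blast
      then show ?thesis by (rule int)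
    qed
    show "\<exists>L. depends_on_first L (\<phi> m)" "\<exists>c. \<forall>x. \<bar>\<phi> m x - ln (p (x 0))\<bar> \<le> c"
      "1 \<le> m \<Longrightarrow> - entropy_rate - (\<integral>x. \<phi> m x \<partial>M) \<le> (1/8) ^ m" for m
      using P[of m] unfolding P_def by simp_all
    show "\<exists>N T b. potential_step m (\<phi> m) (\<phi> (Suc m)) N T b" for m by (rule st)
  qed
qed

text \<open>By invariance the \<open>\<nu>\<close>-mean of a test is the mean of its Birkhoff
  averages of length \<open>N m\<close>. On \<open>T m\<close> these hardly exceed the
  \<open>M\<close>-mean; elsewhere they are at most 1, hence at most 2 above it, on a set of measure
  at most \<open>d m\<close>.\<close>

lemma eq_if_concentrated_on_typical_words:
  assumes \<nu>: "shift_invariant \<nu> \<Omega>"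
    and N: "\<And>m. 0 < N m"
    and test: "\<And>m f x. f \<in> cylinder_tests m \<Longrightarrow> initial_word (N m) x \<in> T m \<Longrightarrow>
      shift_sum f (N m) x \<le> N m * ((\<integral>x. f x \<partial>M) + e m)"
    and conc: "\<And>m. 1 \<le> m \<Longrightarrow> measure \<nu> {x \<in> space \<nu>. initial_word (N m) x \<notin> T m} \<le> d m"
    and e: "e \<longlonglongrightarrow> 0" "\<And>m. 0 \<le> e m" and d: "d \<longlonglongrightarrow> 0"
  shows "\<nu> = M"
proof (rule measure_eqI_cylinder[OF \<nu>])
  interpret \<nu>: shift_invariant \<nu> \<Omega> by (rule \<nu>)
  have le: "(\<integral>x. f x \<partial>\<nu>) \<le> (\<integral>x. f x \<partial>M)" if f: "f \<in> cylinder_tests k" for f k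
  proof -
    have bound: "(\<integral>x. f x \<partial>\<nu>) \<le> (\<integral>x. f x \<partial>M) + e m + 2 * d m" if m: "max 1 k \<le> m" for m
    proof -
      have fm: "f \<in> cylinder_tests m" using f m by (force simp: cylinder_tests_def)
      have f1: "\<bar>f x\<bar> \<le> 1" for x by (rule abs_cylinder_test_le[OF fm])
      note i\<nu> = \<nu>.integrable_cylinder_test[OF fm]
      define B where "B = {x \<in> space \<nu>. initial_word (N m) x \<notin> T m}"
      have [measurable]: "B \<in> sets \<nu>"
      proof -
        have "B = initial_word (N m) -` (- T m) \<inter> space \<nu>" by (auto simp: B_def)
        then show ?thesis using measurable_sets[OF \<nu>.measurable_initial_word, of "- T m"] by simp
      qed
      have iB: "integrable \<nu> (\<lambda>x. 2 * indicator B x :: real)" by (simp add: \<nu>.emeasure_eq_measure)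
      have ge: "-1 \<le> (\<integral>x. f x \<partial>M)"
      proof -
        have "(\<integral>x. -1 \<partial>M) \<le> (\<integral>x. f x \<partial>M)"
        proof (rule integral_mono)
          show "-1 \<le> f x" for x using f1[of x] by linarith
        qed (simp_all add: integrable_cylinder_test[OF fm])
        then show ?thesis by (simp add: prob_space)
      qed
      have "N m * (\<integral>x. f x \<partial>\<nu>) = (\<integral>x. shift_sum f (N m) x \<partial>\<nu>)" by (simp add: \<nu>.integral_birkhoff_sum[OF i\<nu>])
      also have "\<dots> \<le> (\<integral>x. N m * ((\<integral>x. f x \<partial>M) + e m + 2 * indicator B x) \<partial>\<nu>)"
      proof (rule integral_mono[OF \<nu>.integrable_birkhoff_sum[OF i\<nu>]])
        show "integrable \<nu> (\<lambda>x. N m * ((\<integral>x. f x \<partial>M) + e m + 2 * indicator B x))" using iB by simp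
        fix x assume x: "x \<in> space \<nu>"
        show "shift_sum f (N m) x \<le> N m * ((\<integral>x. f x \<partial>M) + e m + 2 * indicator B x)"
        proof (cases "initial_word (N m) x \<in> T m")
          case True
          then show ?thesis using test[OF fm True] by (simp add: B_def)
        next
          case False
          have "shift_sum f (N m) x \<le> (\<Sum>i<N m. 1)"
            unfolding birkhoff_sum_def by (intro sum_mono) (use f1 in \<open>simp add: abs_le_iff\<close>)
          also have "\<dots> = real (N m) * 1" by simp
          also have "\<dots> \<le> N m * ((\<integral>x. f x \<partial>M) + e m + 2 * indicator B x)"
            using False x ge e(2)[of m] by (intro mult_left_mono) (auto simp: B_def)
          finally show ?thesis .
        qed
      qed
      also have "\<dots> = N m * ((\<integral>x. f x \<partial>M) + e m + 2 * measure \<nu> B)"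
        using iB by (simp add: \<nu>.prob_space)
      finally have "(\<integral>x. f x \<partial>\<nu>) \<le> (\<integral>x. f x \<partial>M) + e m + 2 * measure \<nu> B" using N[of m] by simp
      moreover have "measure \<nu> B \<le> d m" unfolding B_def by (rule conc) (use m in simp)
      ultimately show ?thesis by linarith
    qed
    have lim: "(\<lambda>m. (\<integral>x. f x \<partial>M) + e m + 2 * d m) \<longlonglongrightarrow> (\<integral>x. f x \<partial>M) + 0 + 2 * 0"
      by (intro tendsto_add tendsto_mult tendsto_const e d)
    have "(\<integral>x. f x \<partial>\<nu>) \<le> (\<integral>x. f x \<partial>M) + 0 + 2 * 0"
      by (rule LIMSEQ_le_const[OF lim]) (use bound in blast)
    then show ?thesis by simp
  qed
  fix w
  have "cylinder_indicator w \<in> cylinder_tests (to_nat w)" "(\<lambda>x. - cylinder_indicator w x) \<in> cylinder_tests (to_nat w)"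
    by (auto simp: cylinder_tests_def intro!: bexI[of _ "to_nat w"])
  from this[THEN le] have "(\<integral>x. cylinder_indicator w x \<partial>\<nu>) = (\<integral>x. cylinder_indicator w x \<partial>M)" by simp
  moreover have "\<nu>.cylinder w = cylinder w" by (simp add: \<nu>.cylinder_def cylinder_def space_M \<nu>.space_M)
  ultimately show "measure \<nu> (cylinder w) = measure M (cylinder w)"
    by (simp add: integral_cylinder_indicator \<nu>.integral_cylinder_indicator)
qed

end

section \<open>The equilibrium potential\<close>

context ergodic_shift
begin

text \<open>The inequality for \<open>entropy_rate\<close> says that the defect has been used up.
  The remaining claims make \<open>h + \<integral>\<phi>\<close> at most 0 for every invariant
  measure with \<open>\<phi>\<close> integrable, with equality for \<open>M\<close> at most.\<close>

lemma equilibrium_potential: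
  assumes p: "\<And>a. 0 < p a" and sum_p: "(\<integral>\<^sup>+a. ennreal (p a) \<partial>count_space UNIV) \<le> 1"
    and ip: "integrable M (\<lambda>x. ln (p (x 0)))"
  obtains \<phi> c where
    "\<And>e. 0 < e \<Longrightarrow> \<exists>L. \<forall>x y. (\<forall>i<L. x i = y i) \<longrightarrow> \<bar>\<phi> x - \<phi> y\<bar> < e"
    "\<And>x. \<bar>\<phi> x - ln (p (x 0))\<bar> \<le> c"
    "\<And>\<nu>. shift_invariant \<nu> \<Omega> \<Longrightarrow> \<phi> \<in> borel_measurable \<nu>"
    "integrable M \<phi>" "0 \<le> entropy_rate + (\<integral>x. \<phi> x \<partial>M)"
    "\<And>\<nu>. shift_invariant \<nu> \<Omega> \<Longrightarrow> integrable \<nu> \<phi> \<Longrightarrow> (\<integral>x. \<phi> x \<partial>\<nu>) \<le> 0"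
    "\<And>\<nu>. shift_invariant \<nu> \<Omega> \<Longrightarrow> integrable \<nu> \<phi> \<Longrightarrow>
      measure_entropy \<nu> shift_map \<le> ennreal (- (\<integral>x. \<phi> x \<partial>\<nu>))"
    "\<And>\<nu>. shift_invariant \<nu> \<Omega> \<Longrightarrow> integrable \<nu> \<phi> \<Longrightarrow>
      measure_entropy \<nu> shift_map = ennreal (- (\<integral>x. \<phi> x \<partial>\<nu>)) \<Longrightarrow> \<nu> = M"
proof -
  obtain \<phi> where dep: "\<And>m. \<exists>L. depends_on_first L (\<phi> m)"
    and near_p: "\<And>m. \<exists>c. \<forall>x. \<bar>\<phi> m x - ln (p (x 0))\<bar> \<le> c"
    and i\<phi>: "\<And>m. integrable M (\<phi> m)"
    and defect: "\<And>m. 1 \<le> m \<Longrightarrow> - entropy_rate - (\<integral>x. \<phi> m x \<partial>M) \<le> (1/8) ^ m"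
    and step: "\<And>m. \<exists>N T b. potential_step m (\<phi> m) (\<phi> (Suc m)) N T b"
    by (rule potential_sequence[OF p sum_p ip]) (rule that)
  obtain N T b where step: "\<And>m. potential_step m (\<phi> m) (\<phi> (Suc m)) (N m) (T m) (b m)"
    using step by metis
  note st = step[unfolded potential_step_def]
  have b_le: "b m \<le> (1/8) ^ m" if "1 \<le> m" for m using st[of m] defect[OF that] by linarith
  have b_ge: "- ((1/8) ^ m) \<le> b m" for m
  proof -
    have "(1/8 :: real) ^ Suc m \<le> (1/8) ^ m" by (rule power_decreasing) simp_all
    then show ?thesis using st[of m] by linarith
  qed
  have pow: "(1/8 :: real) ^ m \<le> (1/4) ^ m" for m by (rule power_mono) simp_all
  have Suc_eq: "\<phi> (Suc m) x = \<phi> m x + (if initial_word (N m) x \<in> T m then b m else - (2 * (1/4) ^ m))" for m x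
  proof -
    have "\<phi> (Suc m) = (\<lambda>x. \<phi> m x + (if initial_word (N m) x \<in> T m then b m else - (2 * (1/4) ^ m)))"
      using st[of m] by (elim conjE)
    then show ?thesis by (rule fun_cong)
  qed
  have inc_upper: "\<phi> (Suc m) x - \<phi> m x \<le> (1/8) ^ m" if "1 \<le> m" for m x
  proof -
    have "(if initial_word (N m) x \<in> T m then b m else - (2 * (1/4) ^ m)) \<le> (1/8) ^ m"
    proof (cases "initial_word (N m) x \<in> T m")
      case False
      have "- (2 * (1/4) ^ m) \<le> (0 :: real)" by simp
      also have "\<dots> \<le> (1/8) ^ m" by simp
      finally show ?thesis using False by (simp only: if_False)
    qed (simp add: b_le[OF that])
    then show ?thesis unfolding Suc_eq by simp
  qed
  have inc_abs: "\<bar>\<phi> (Suc m) x - \<phi> m x\<bar> \<le> 2 * (1/4) ^ m" if "1 \<le> m" for m x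
  proof -
    have "0 \<le> (1/4 :: real) ^ m" by simp
    then show ?thesis unfolding Suc_eq using b_le[OF that] b_ge[of m] pow[of m] by (simp add: abs_le_iff)
  qed
  have "convergent (\<lambda>m. \<phi> m x)" for x
  proof (rule convergent_if_increments_summable)
    show "\<bar>\<phi> (Suc m) x - \<phi> m x\<bar> \<le> 2 * (1/4) ^ m" if "1 \<le> m" for m by (rule inc_abs[OF that])
    show "summable (\<lambda>m. 2 * (1/4) ^ m :: real)" by (intro summable_mult summable_geometric) simp
  qed
  then obtain \<Phi> where lim: "\<And>x. (\<lambda>m. \<phi> m x) \<longlonglongrightarrow> \<Phi> x" unfolding convergent_def by metis
  \<comment> \<open>The factors turn geometric terms into differences: \<open>(1/8) ^ n\<close> is
    8/7 times its own decrease, and \<open>2 * (1/4) ^ n\<close> is 8/3 times the decrease of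
    \<open>(1/4) ^ n\<close>. The upper bound uses the smaller scale, which the uniqueness argument
    needs.\<close>
  have \<Phi>_upper: "\<Phi> x \<le> \<phi> m x + (8/7) * (1/8) ^ m" if m: "1 \<le> m" for m x
  proof (rule limit_le_if_increments_le[OF lim[of x], where d = "\<lambda>m. (1/8) ^ m"])
    fix n assume "m \<le> n"
    then show "\<phi> (Suc n) x - \<phi> n x \<le> 8 / 7 * ((1/8) ^ n - (1/8) ^ Suc n)"
      using inc_upper[of n x] m by simp
  qed simp_all
  have \<Phi>_near: "\<bar>\<Phi> x - \<phi> m x\<bar> \<le> (8/3) * (1/4) ^ m" if m: "1 \<le> m" for m x
  proof -
    have inc: "\<bar>\<phi> (Suc n) x - \<phi> n x\<bar> \<le> 8 / 3 * ((1/4) ^ n - (1/4) ^ Suc n)" if "m \<le> n" for n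
      using inc_abs[of n x] m that by simp
    have "\<Phi> x \<le> \<phi> m x + (8/3) * (1/4) ^ m"
    proof (rule limit_le_if_increments_le[OF lim[of x], where d = "\<lambda>m. (1/4) ^ m"])
      show "\<phi> (Suc n) x - \<phi> n x \<le> 8 / 3 * ((1/4) ^ n - (1/4) ^ Suc n)" if "m \<le> n" for n
        using inc[OF that] by linarith
    qed simp_all
    moreover have "- \<Phi> x \<le> - \<phi> m x + (8/3) * (1/4) ^ m"
    proof (rule limit_le_if_increments_le[OF tendsto_minus[OF lim[of x]], where d = "\<lambda>m. (1/4) ^ m"])
      show "- \<phi> (Suc n) x - - \<phi> n x \<le> 8 / 3 * ((1/4) ^ n - (1/4) ^ Suc n)" if "m \<le> n" for n
        using inc[OF that] by linarith
    qed simp_all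
    ultimately show ?thesis by linarith
  qed
  have meas: "\<phi> m \<in> borel_measurable \<nu>" if "shift_invariant \<nu> \<Omega>" for m \<nu>
    using dep[of m] shift_invariant.measurable_depends_on_first[OF that] by (metis space_borel)
  have meas\<Phi>: "\<Phi> \<in> borel_measurable \<nu>" if "shift_invariant \<nu> \<Omega>" for \<nu>
    by (rule borel_measurable_LIMSEQ_real[OF lim]) (rule meas[OF that])
  have near1: "\<bar>\<Phi> x - \<phi> 1 x\<bar> \<le> 1" for x using \<Phi>_near[of 1 x] by simp
  have M: "shift_invariant M \<Omega>" by (rule shift_invariant_axioms)
  have i\<Phi>: "integrable M \<Phi>"
  proof (rule Bochner_Integration.integrable_bound)
    show "integrable M (\<lambda>x. \<bar>\<phi> 1 x\<bar> + 1)" using i\<phi> by simp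
    show "\<Phi> \<in> borel_measurable M" by (rule meas\<Phi>[OF M])
    have "norm (\<Phi> x) \<le> norm (\<bar>\<phi> 1 x\<bar> + 1)" for x unfolding real_norm_def using near1[of x] by linarith
    then show "AE x in M. norm (\<Phi> x) \<le> norm (\<bar>\<phi> 1 x\<bar> + 1)" by simp
  qed
  obtain c1 where c1: "\<And>x. \<bar>\<phi> 1 x - ln (p (x 0))\<bar> \<le> c1" using near_p by blast
  have uc: "\<exists>L. \<forall>x y. (\<forall>i<L. x i = y i) \<longrightarrow> \<bar>\<Phi> x - \<Phi> y\<bar> < e" if e: "0 < e" for e
  proof -
    have "(\<lambda>m. (8/3) * (1/4) ^ m) \<longlonglongrightarrow> (8/3) * (0 :: real)"
      by (intro tendsto_mult tendsto_const LIMSEQ_realpow_zero) auto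
    then have "\<forall>\<^sub>F m in sequentially. (8/3) * (1/4) ^ m < e / 2"
      by (rule order_tendstoD(2)) (use e in simp)
    then obtain m0 where m0: "\<And>m. m0 \<le> m \<Longrightarrow> (8/3) * (1/4) ^ m < e / 2"
      by (auto simp: eventually_sequentially)
    define m where "m = Suc m0"
    obtain L where L: "depends_on_first L (\<phi> m)" using dep by blast
    have "\<bar>\<Phi> x - \<Phi> y\<bar> < e" if xy: "\<forall>i<L. x i = y i" for x y
    proof -
      have "\<phi> m x = \<phi> m y" by (rule depends_on_firstD[OF L]) (use xy in simp)
      moreover have "\<bar>\<Phi> x - \<phi> m x\<bar> < e / 2" "\<bar>\<Phi> y - \<phi> m y\<bar> < e / 2"
        using \<Phi>_near[of m x] \<Phi>_near[of m y] m0[of m] by (simp_all add: m_def)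
      ultimately show ?thesis by linarith
    qed
    then show ?thesis by blast
  qed
  have rate: "0 \<le> entropy_rate + (\<integral>x. \<Phi> x \<partial>M)"
  proof -
    \<comment> \<open>The 4 covers 8/3 from the distance to the limit and 1 from the remaining
      defect.\<close>
    have le: "- (4 * (1/4) ^ m) \<le> entropy_rate + (\<integral>x. \<Phi> x \<partial>M)" if m: "1 \<le> m" for m
    proof -
      have "(\<integral>x. \<phi> m x - (8/3) * (1/4) ^ m \<partial>M) \<le> (\<integral>x. \<Phi> x \<partial>M)"
      proof (rule integral_mono[OF _ i\<Phi>])
        show "integrable M (\<lambda>x. \<phi> m x - (8/3) * (1/4) ^ m)" using i\<phi> by simp
        show "\<phi> m x - (8/3) * (1/4) ^ m \<le> \<Phi> x" for x using \<Phi>_near[OF m, of x] by linarith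
      qed
      also have "(\<integral>x. \<phi> m x - (8/3) * (1/4) ^ m \<partial>M) = (\<integral>x. \<phi> m x \<partial>M) - (8/3) * (1/4) ^ m"
        using i\<phi> by (simp add: prob_space)
      finally have "(\<integral>x. \<phi> m x \<partial>M) - (8/3) * (1/4) ^ m \<le> (\<integral>x. \<Phi> x \<partial>M)" .
      moreover have "(0 :: real) \<le> (1/4) ^ m" by simp
      ultimately show ?thesis using defect[OF m] pow[of m] by linarith
    qed
    have "(\<lambda>m. - (4 * (1/4) ^ m)) \<longlonglongrightarrow> - (4 * (0 :: real))"
      by (intro tendsto_minus tendsto_mult tendsto_const LIMSEQ_realpow_zero) auto
    then have "- (4 * (0 :: real)) \<le> entropy_rate + (\<integral>x. \<Phi> x \<partial>M)"
      by (rule LIMSEQ_le_const2) (use le in blast)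
    then show ?thesis by simp
  qed
  text \<open>
    The potential \<open>\<psi>\<close> before the last lowering on non-typical words has nonpositive pressure, and
    the later changes are much smaller than that lowering.
  \<close>
  have key: "\<exists>a\<ge>0. measure_entropy \<nu> shift_map \<le> ennreal a \<and>
      a \<le> - (\<integral>x. \<Phi> x \<partial>\<nu>) + (1/8) ^ m - (1/4) ^ m * measure \<nu> {x \<in> space \<nu>. initial_word (N m) x \<notin> T m}"
    if \<nu>: "shift_invariant \<nu> \<Omega>" and i\<nu>: "integrable \<nu> \<Phi>" for \<nu> m
  proof -
    interpret \<nu>: shift_invariant \<nu> \<Omega> by (rule \<nu>)
    define \<psi> where "\<psi> x = \<phi> m x + (if initial_word (N m) x \<in> T m then b m else - ((1/4) ^ m))" for x
    have \<psi>_Suc: "\<psi> x = \<phi> (Suc m) x + (if initial_word (N m) x \<in> T m then 0 else (1/4) ^ m)" for x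
      by (simp add: \<psi>_def Suc_eq)
    obtain C where C: "weight_bound \<psi> C" using st[of m] unfolding \<psi>_def by blast
    obtain L where L: "depends_on_first L (\<phi> m)" using dep by blast
    obtain c where c: "\<And>x. \<bar>\<phi> m x - ln (p (x 0))\<bar> \<le> c" using near_p by blast
    have L\<psi>: "depends_on_first (max L (N m)) \<psi>"
      unfolding depends_on_first_def
    proof (intro allI impI)
      fix x y :: "nat \<Rightarrow> nat" assume xy: "\<forall>i<max L (N m). x i = y i"
      then have "initial_word (N m) x = initial_word (N m) y" by (intro initial_word_eqI) simp
      moreover have "\<phi> m x = \<phi> m y" by (rule depends_on_firstD[OF L]) (use xy in simp)
      ultimately show "\<psi> x = \<psi> y" by (simp add: \<psi>_def)
    qed
    define c' where "c' = c + (\<bar>b m\<bar> + (1/4) ^ m)"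
    have c': "\<bar>\<psi> x - ln (p (x 0))\<bar> \<le> c'" for x
    proof -
      have "\<bar>\<psi> x - \<phi> m x\<bar> \<le> \<bar>b m\<bar> + (1/4) ^ m" by (simp add: \<psi>_def)
      then show ?thesis using c[of x] unfolding c'_def by linarith
    qed
    have K: "distortion_bound \<psi> (max L (N m) * (2 * c'))"
    proof (rule distortion_bound_if_depends_on_first[OF L\<psi>])
      fix x y :: "nat \<Rightarrow> nat" assume "x 0 = y 0"
      then show "\<bar>\<psi> x - \<psi> y\<bar> \<le> 2 * c'" using c'[of x] c'[of y] by simp
    qed
    have i\<psi>: "integrable \<nu> \<psi>"
    proof (rule Bochner_Integration.integrable_bound)
      show "integrable \<nu> (\<lambda>x. \<bar>\<Phi> x\<bar> + (1 + c1 + c'))" using i\<nu> by simp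
      show "\<psi> \<in> borel_measurable \<nu>" by (rule \<nu>.measurable_depends_on_first[OF L\<psi>]) simp
      have "norm (\<psi> x) \<le> norm (\<bar>\<Phi> x\<bar> + (1 + c1 + c'))" for x
        unfolding real_norm_def using near1[of x] c1[of x] c'[of x] by linarith
      then show "AE x in \<nu>. norm (\<psi> x) \<le> norm (\<bar>\<Phi> x\<bar> + (1 + c1 + c'))" by simp
    qed
    define B where "B = {x \<in> space \<nu>. initial_word (N m) x \<notin> T m}"
    have [measurable]: "B \<in> sets \<nu>"
    proof -
      have "B = initial_word (N m) -` (- T m) \<inter> space \<nu>" by (auto simp: B_def)
      then show ?thesis using measurable_sets[OF \<nu>.measurable_initial_word, of "- T m"] by simp
    qed
    have iB: "integrable \<nu> (\<lambda>x. (1/4) ^ m * indicator B x :: real)" by (simp add: \<nu>.emeasure_eq_measure)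
    have "(\<integral>x. \<Phi> x \<partial>\<nu>) + (- ((1/8) ^ m) + (1/4) ^ m * measure \<nu> B) =
        (\<integral>x. \<Phi> x + (- ((1/8) ^ m) + (1/4) ^ m * indicator B x) \<partial>\<nu>)"
      using i\<nu> iB by (simp add: \<nu>.prob_space)
    also have "\<dots> \<le> (\<integral>x. \<psi> x \<partial>\<nu>)"
    proof (rule integral_mono[OF _ i\<psi>])
      show "integrable \<nu> (\<lambda>x. \<Phi> x + (- ((1/8) ^ m) + (1/4) ^ m * indicator B x))" using i\<nu> iB by simp
      fix x assume x: "x \<in> space \<nu>"
      \<comment> \<open>All later raises together amount to at most \<open>(1/8) ^ m / 7\<close>.
        Starting at \<open>Suc m\<close> also covers \<open>m = 0\<close>.\<close>
      have "\<Phi> x \<le> \<phi> (Suc m) x + (1/8) ^ m / 7" using \<Phi>_upper[of "Suc m" x] by simp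
      moreover have "(0 :: real) \<le> (1/8) ^ m" by simp
      ultimately have "\<Phi> x \<le> \<phi> (Suc m) x + (1/8) ^ m" by linarith
      then show "\<Phi> x + (- ((1/8) ^ m) + (1/4) ^ m * indicator B x) \<le> \<psi> x"
        unfolding \<psi>_Suc using x by (simp add: B_def)
    qed
    finally have "- (\<integral>x. \<psi> x \<partial>\<nu>) \<le> - (\<integral>x. \<Phi> x \<partial>\<nu>) + (1/8) ^ m - (1/4) ^ m * measure \<nu> B" by simp
    then show ?thesis
      using \<nu>.variational_inequality[OF K C i\<psi>] unfolding B_def
      by (intro exI[of _ "- (\<integral>x. \<psi> x \<partial>\<nu>)"]) auto
  qed
  have bound: "(\<integral>x. \<Phi> x \<partial>\<nu>) \<le> (1/8) ^ m"
    "measure_entropy \<nu> shift_map \<le> ennreal (- (\<integral>x. \<Phi> x \<partial>\<nu>) + (1/8) ^ m)"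
    if \<nu>: "shift_invariant \<nu> \<Omega>" "integrable \<nu> \<Phi>" for \<nu> m
  proof -
    obtain a where a: "0 \<le> a" "measure_entropy \<nu> shift_map \<le> ennreal a"
      "a \<le> - (\<integral>x. \<Phi> x \<partial>\<nu>) + (1/8) ^ m - (1/4) ^ m * measure \<nu> {x \<in> space \<nu>. initial_word (N m) x \<notin> T m}"
      using key[OF \<nu>] by blast
    have "0 \<le> (1/4) ^ m * measure \<nu> {x \<in> space \<nu>. initial_word (N m) x \<notin> T m}" by simp
    then have "a \<le> - (\<integral>x. \<Phi> x \<partial>\<nu>) + (1/8) ^ m" using a(3) by linarith
    with a(1,2) show "(\<integral>x. \<Phi> x \<partial>\<nu>) \<le> (1/8) ^ m"
      "measure_entropy \<nu> shift_map \<le> ennreal (- (\<integral>x. \<Phi> x \<partial>\<nu>) + (1/8) ^ m)"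
      by (auto intro: order_trans ennreal_leI)
  qed
  have pow0: "(\<lambda>m. (1/8) ^ m) \<longlonglongrightarrow> (0 :: real)" "(\<lambda>m. (1/2) ^ m) \<longlonglongrightarrow> (0 :: real)"
    "(\<lambda>m. (1/8) ^ Suc m) \<longlonglongrightarrow> (0 :: real)"
    by (intro LIMSEQ_realpow_zero LIMSEQ_Suc; simp)+
  have nonpos: "(\<integral>x. \<Phi> x \<partial>\<nu>) \<le> 0" if \<nu>: "shift_invariant \<nu> \<Omega>" "integrable \<nu> \<Phi>" for \<nu>
    by (rule LIMSEQ_le_const[OF pow0(1)]) (use bound(1)[OF \<nu>] in blast)
  have entropy: "measure_entropy \<nu> shift_map \<le> ennreal (- (\<integral>x. \<Phi> x \<partial>\<nu>))"
    if \<nu>: "shift_invariant \<nu> \<Omega>" "integrable \<nu> \<Phi>" for \<nu>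
  proof (rule LIMSEQ_le_const)
    show "(\<lambda>m. ennreal (- (\<integral>x. \<Phi> x \<partial>\<nu>) + (1/8) ^ m)) \<longlonglongrightarrow> ennreal (- (\<integral>x. \<Phi> x \<partial>\<nu>))"
      using tendsto_ennrealI[OF tendsto_add[OF tendsto_const[of "- (\<integral>x. \<Phi> x \<partial>\<nu>)"] pow0(1)]] by simp
  qed (use bound(2)[OF \<nu>] in blast)
  have unique: "\<nu> = M" if \<nu>: "shift_invariant \<nu> \<Omega>" "integrable \<nu> \<Phi>"
    and eq: "measure_entropy \<nu> shift_map = ennreal (- (\<integral>x. \<Phi> x \<partial>\<nu>))" for \<nu>
  proof (rule eq_if_concentrated_on_typical_words[OF \<nu>(1), of N T "\<lambda>m. (1/8) ^ Suc m" "\<lambda>m. (1/2) ^ m"])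
    show "measure \<nu> {x \<in> space \<nu>. initial_word (N m) x \<notin> T m} \<le> (1/2) ^ m" for m
    proof -
      obtain a where a: "0 \<le> a" "measure_entropy \<nu> shift_map \<le> ennreal a"
        "a \<le> - (\<integral>x. \<Phi> x \<partial>\<nu>) + (1/8) ^ m - (1/4) ^ m * measure \<nu> {x \<in> space \<nu>. initial_word (N m) x \<notin> T m}"
        using key[OF \<nu>] by blast
      have "- (\<integral>x. \<Phi> x \<partial>\<nu>) \<le> a" using a(1,2) unfolding eq by (simp add: ennreal_le_iff)
      \<comment> \<open>Maximal entropy leaves only the room \<open>(1/8) ^ m\<close> for the
        penalty \<open>(1/4) ^ m\<close> times the non-typical mass, so that mass is at most
        \<open>(1/2) ^ m\<close>.\<close>
      with a(3) have "(1/4) ^ m * measure \<nu> {x \<in> space \<nu>. initial_word (N m) x \<notin> T m} \<le> (1/8) ^ m"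
        by linarith
      also have "(1/8 :: real) ^ m = (1/4) ^ m * (1/2) ^ m" by (simp add: power_mult_distrib[symmetric])
      finally show ?thesis by simp
    qed
    show "shift_sum f (N m) x \<le> N m * ((\<integral>x. f x \<partial>M) + (1/8) ^ Suc m)"
      if "f \<in> cylinder_tests m" "initial_word (N m) x \<in> T m" for m f x
      using st[of m] that by blast
    show "0 < N m" for m using st[of m] by (elim conjE)
    show "(\<lambda>m. (1/8) ^ Suc m) \<longlonglongrightarrow> (0 :: real)" "(\<lambda>m. (1/2) ^ m) \<longlonglongrightarrow> (0 :: real)"
      by (fact pow0)+
  qed simp
  have c: "\<bar>\<Phi> x - ln (p (x 0))\<bar> \<le> c1 + 1" for x using c1[of x] near1[of x] by linarith
  show thesis
    by (rule that[OF uc c meas\<Phi> i\<Phi> rate nonpos entropy unique])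
qed

end

section \<open>Free energy and the equilibrium measure\<close>

lemma free_energy_eq:
  assumes i: "integrable \<nu> \<phi>" and h: "measure_entropy \<nu> shift_map = ennreal h" "0 \<le> h"
  shows "free_energy \<nu> \<phi> = ereal (h + (\<integral>x. \<phi> x \<partial>\<nu>))"
proof -
  have fin: "(\<integral>\<^sup>+x. ennreal (\<phi> x) \<partial>\<nu>) \<noteq> \<infinity>" "(\<integral>\<^sup>+x. ennreal (- \<phi> x) \<partial>\<nu>) \<noteq> \<infinity>"
    using i by (auto simp: real_integrable_def)
  have "extended_integral \<nu> \<phi> = ereal (\<integral>x. \<phi> x \<partial>\<nu>)"
    unfolding extended_integral_def real_lebesgue_integral_def[OF i]
    using fin by (cases "\<integral>\<^sup>+x. ennreal (\<phi> x) \<partial>\<nu>"; cases "\<integral>\<^sup>+x. ennreal (- \<phi> x) \<partial>\<nu>") (auto simp: enn2ereal_ennreal)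
  then show ?thesis using h by (simp add: free_energy_def enn2ereal_ennreal)
qed

theorem theorem7p1:
  fixes M :: "nat \<Rightarrow> nat \<Rightarrow> nat" and \<mu> :: "(nat \<Rightarrow> nat) measure"
  assumes "\<And>i j. M i j \<in> {0, 1}"
    and "transitive_shift M"
    and "\<mu> \<in> invariant_measures M"
    and "ergodic_measure \<mu>"
    and "partition_entropy \<mu> (cylinder_partition M) < \<infinity>"
  shows "\<exists>\<phi>\<in>UC_shift M.
    equilibrium_measure M \<phi> \<mu> \<and> (\<forall>\<nu>. equilibrium_measure M \<phi> \<nu> \<longrightarrow> \<nu> = \<mu>)"
proof -
  interpret \<mu>: shift_invariant \<mu> "markov_shift M"
    using assms(3) by (simp add: invariant_measures_iff)
  have X: "(\<lambda>x. x 0) \<in> measurable \<mu> (count_space UNIV)" by (rule \<mu>.measurable_coordinate)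
  have "cylinder_partition M - {{}} = (\<lambda>c. (\<lambda>x. x 0) -` {c} \<inter> space \<mu>) ` (\<lambda>x. x 0) ` space \<mu>"
    unfolding cylinder_partition_def shift_cylinder_def \<mu>.space_M by auto
  from \<mu>.partition_entropy_fibers[OF X this] assms(5)
  have fin: "(\<integral>\<^sup>+x. ennreal (info \<mu> (\<lambda>x. x 0) x) \<partial>\<mu>) < \<infinity>" by simp
  have finite_entropy: "integrable \<mu> (info \<mu> (\<lambda>x. x 0))"
    by (rule integrableI_nonneg[OF \<mu>.borel_measurable_info[OF X] _ fin]) (simp add: \<mu>.info_nonneg)
  interpret \<mu>: ergodic_shift \<mu> "markov_shift M"
    by unfold_locales (use assms(4) finite_entropy in \<open>auto simp: ergodic_measure_def\<close>)
  \<comment> \<open>Mixing the law of the first letter with a geometric law makes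
    \<open>ln (p n)\<close> meaningful for letters of measure 0 too; compared with
    \<open>info\<close> this costs at most \<open>ln 2\<close>.\<close>
  define p where "p n = fiber_prob \<mu> (\<lambda>x. x 0) n / 2 + (1/2) ^ Suc n / 2" for n :: nat
  have p: "0 < p n" for n by (simp add: p_def add_nonneg_pos)
  have p1: "p n \<le> 1" for n
  proof -
    have "(1/2 :: real) ^ Suc n \<le> 1" by (rule power_le_one) simp_all
    then show ?thesis using \<mu>.fiber_prob_le_1[of "\<lambda>x. x 0" n] unfolding p_def by linarith
  qed
  have sum_p: "(\<integral>\<^sup>+n. ennreal (p n) \<partial>count_space UNIV) \<le> 1"
  proof -
    have "(\<integral>\<^sup>+n. ennreal (p n) \<partial>count_space UNIV) =
      (\<integral>\<^sup>+n. ennreal (1/2) * ennreal (fiber_prob \<mu> (\<lambda>x. x 0) n) + ennreal (1/2) * ennreal ((1/2) ^ Suc n) \<partial>count_space UNIV)"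
    proof (rule nn_integral_cong)
      have half: "ennreal (1/2) * ennreal a = ennreal (a / 2)" if "0 \<le> a" for a
        using that by (subst ennreal_mult[symmetric]) simp_all
      show "ennreal (p n) = ennreal (1/2) * ennreal (fiber_prob \<mu> (\<lambda>x. x 0) n) + ennreal (1/2) * ennreal ((1/2) ^ Suc n)" for n
        unfolding p_def by (subst (1 2) half) (simp_all flip: ennreal_plus)
    qed
    also have "\<dots> = ennreal (1/2) * (\<integral>\<^sup>+n. ennreal (fiber_prob \<mu> (\<lambda>x. x 0) n) \<partial>count_space UNIV) +
        ennreal (1/2) * (\<integral>\<^sup>+n. ennreal ((1/2) ^ Suc n) \<partial>count_space UNIV)"
      by (simp add: nn_integral_add nn_integral_cmult)
    also have "(\<integral>\<^sup>+n. ennreal ((1/2) ^ Suc n) \<partial>count_space UNIV) = ennreal 1"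
      unfolding nn_integral_count_space_nat by (rule suminf_ennreal_eq[OF _ power_half_series]) simp
    also have "ennreal (1/2) * (\<integral>\<^sup>+n. ennreal (fiber_prob \<mu> (\<lambda>x. x 0) n) \<partial>count_space UNIV) + ennreal (1/2) * ennreal 1
        \<le> ennreal (1/2) * 1 + ennreal (1/2) * ennreal 1"
      by (intro add_mono mult_left_mono \<mu>.sum_fiber_prob X) auto
    also have "\<dots> = ennreal (1/2 + 1/2)" by (subst ennreal_plus) simp_all
    also have "\<dots> = 1" by simp
    finally show ?thesis .
  qed
  have ip: "integrable \<mu> (\<lambda>x. ln (p (x 0)))"
  proof (rule Bochner_Integration.integrable_bound)
    show "integrable \<mu> (\<lambda>x. info \<mu> (\<lambda>x. x 0) x + ln 2)" using finite_entropy by simp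
    show "(\<lambda>x. ln (p (x 0))) \<in> borel_measurable \<mu>"
      by (rule measurable_compose[OF X, of "\<lambda>n. ln (p n)"]) simp
    show "AE x in \<mu>. norm (ln (p (x 0))) \<le> norm (info \<mu> (\<lambda>x. x 0) x + ln 2)"
      using \<mu>.AE_fiber_prob_pos[OF X]
    proof eventually_elim
      case (elim x)
      have "ln (fiber_prob \<mu> (\<lambda>x. x 0) (x 0) / 2) \<le> ln (p (x 0))"
        using elim p[of "x 0"] by (simp add: p_def)
      moreover have "ln (p (x 0)) \<le> 0" using p p1 by simp
      moreover have "ln (fiber_prob \<mu> (\<lambda>x. x 0) (x 0) / 2) = - (info \<mu> (\<lambda>x. x 0) x + ln 2)"
        using elim by (simp add: info_def ln_div)
      ultimately show ?case by simp
    qed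
  qed
  obtain \<phi> c where uc: "\<And>e. 0 < e \<Longrightarrow> \<exists>L. \<forall>x y. (\<forall>i<L. x i = y i) \<longrightarrow> \<bar>\<phi> x - \<phi> y\<bar> < e"
    and near: "\<And>x. \<bar>\<phi> x - ln (p (x 0))\<bar> \<le> c"
    and meas: "\<And>\<nu>. shift_invariant \<nu> (markov_shift M) \<Longrightarrow> \<phi> \<in> borel_measurable \<nu>"
    and i\<mu>: "integrable \<mu> \<phi>" and rate: "0 \<le> \<mu>.entropy_rate + (\<integral>x. \<phi> x \<partial>\<mu>)"
    and nonpos: "\<And>\<nu>. shift_invariant \<nu> (markov_shift M) \<Longrightarrow> integrable \<nu> \<phi> \<Longrightarrow> (\<integral>x. \<phi> x \<partial>\<nu>) \<le> 0"
    and entropy: "\<And>\<nu>. shift_invariant \<nu> (markov_shift M) \<Longrightarrow> integrable \<nu> \<phi> \<Longrightarrow>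
      measure_entropy \<nu> shift_map \<le> ennreal (- (\<integral>x. \<phi> x \<partial>\<nu>))"
    and unique: "\<And>\<nu>. shift_invariant \<nu> (markov_shift M) \<Longrightarrow> integrable \<nu> \<phi> \<Longrightarrow>
      measure_entropy \<nu> shift_map = ennreal (- (\<integral>x. \<phi> x \<partial>\<nu>)) \<Longrightarrow> \<nu> = \<mu>"
    by (rule \<mu>.equilibrium_potential[OF p sum_p ip]) (rule that)
  have UC: "\<phi> \<in> UC_shift M"
    unfolding UC_shift_iff
  proof (intro allI impI)
    fix e :: real assume "0 < e"
    then obtain L where L: "\<And>x y. (\<forall>i<L. x i = y i) \<Longrightarrow> \<bar>\<phi> x - \<phi> y\<bar> < e" using uc by blast
    have "\<bar>\<phi> y - \<phi> x\<bar> < e" if d: "shift_dist y x < 1 / 2 ^ L" for x y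
    proof (rule L, intro allI impI, rule ccontr)
      fix i assume "i < L" "y i \<noteq> x i"
      have "(1 :: real) / 2 ^ L \<le> 1 / 2 ^ i" using \<open>i < L\<close> by (intro divide_left_mono power_increasing) auto
      also have "\<dots> \<le> shift_dist y x" by (rule shift_dist_ge) fact
      finally show False using d by simp
    qed
    then show "\<exists>\<delta>>0. \<forall>x\<in>markov_shift M. \<forall>y\<in>markov_shift M. shift_dist y x < \<delta> \<longrightarrow> \<bar>\<phi> y - \<phi> x\<bar> < e"
      by (intro exI[of _ "1 / 2 ^ L"]) auto
  qed
  \<comment> \<open>With \<open>\<phi>\<close> bounded above, an integral greater than minus
    infinity already means integrability, so the infinite values of \<open>extended_integral\<close>
    do not occur.\<close>
  have \<phi>_le: "\<phi> x \<le> c" for x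
  proof -
    have "ln (p (x 0)) \<le> 0" using p p1 by simp
    then show ?thesis using near[of x] by linarith
  qed
  have integrable: "integrable \<nu> \<phi>"
    if \<nu>: "\<nu> \<in> invariant_measures M" "integral_gt_minus_infinity \<nu> \<phi>" for \<nu>
  proof -
    have inv: "shift_invariant \<nu> (markov_shift M)" using \<nu>(1) by (simp add: invariant_measures_iff)
    interpret \<nu>: shift_invariant \<nu> "markov_shift M" by (rule inv)
    have "(\<integral>\<^sup>+x. ennreal (\<phi> x) \<partial>\<nu>) \<le> (\<integral>\<^sup>+x. ennreal c \<partial>\<nu>)"
      by (intro nn_integral_mono ennreal_leI \<phi>_le)
    also have "\<dots> < \<infinity>" by (simp add: \<nu>.emeasure_space_1)
    finally show ?thesis
      using \<nu>(2) meas[OF inv] by (simp add: real_integrable_def integral_gt_minus_infinity_def less_top)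
  qed
  have energy: "free_energy \<nu> \<phi> \<le> 0"
    "free_energy \<nu> \<phi> = 0 \<longleftrightarrow> measure_entropy \<nu> shift_map = ennreal (- (\<integral>x. \<phi> x \<partial>\<nu>))"
    if \<nu>: "\<nu> \<in> invariant_measures M" "integral_gt_minus_infinity \<nu> \<phi>" for \<nu>
  proof -
    have inv: "shift_invariant \<nu> (markov_shift M)" using \<nu>(1) by (simp add: invariant_measures_iff)
    note i = integrable[OF \<nu>]
    have le: "measure_entropy \<nu> shift_map \<le> ennreal (- (\<integral>x. \<phi> x \<partial>\<nu>))" by (rule entropy[OF inv i])
    then have "measure_entropy \<nu> shift_map \<noteq> \<infinity>" by (auto simp: top_unique)
    then obtain h where h: "measure_entropy \<nu> shift_map = ennreal h" "0 \<le> h"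
      by (cases "measure_entropy \<nu> shift_map") auto
    note F = free_energy_eq[OF i h]
    have "h \<le> - (\<integral>x. \<phi> x \<partial>\<nu>)" using le nonpos[OF inv i] unfolding h(1) by (simp add: ennreal_le_iff)
    then show "free_energy \<nu> \<phi> \<le> 0" unfolding F by (simp flip: zero_ereal_def)
    show "free_energy \<nu> \<phi> = 0 \<longleftrightarrow> measure_entropy \<nu> shift_map = ennreal (- (\<integral>x. \<phi> x \<partial>\<nu>))"
      unfolding F h(1) using h(2) nonpos[OF inv i] by (auto simp flip: zero_ereal_def)
  qed
  have gt\<mu>: "integral_gt_minus_infinity \<mu> \<phi>"
    using i\<mu> by (simp add: integral_gt_minus_infinity_def real_integrable_def less_top)
  \<comment> \<open>The truncation argument bounds the entropy of \<open>\<mu>\<close> from below by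
    its entropy rate, and \<open>rate\<close> makes this meet the upper bound
    \<open>entropy\<close>.\<close>
  have "ennreal \<mu>.entropy_rate \<le> measure_entropy \<mu> shift_map"
    by (rule \<mu>.measure_entropy_ge[OF X p sum_p ip])
      (use \<mu>.entropy_rate_le in \<open>simp add: itinerary_shift_map \<mu>.block_entropy_def\<close>)
  then have "ennreal (- (\<integral>x. \<phi> x \<partial>\<mu>)) \<le> measure_entropy \<mu> shift_map"
    using rate by (elim order_trans[rotated]) (simp add: ennreal_leI)
  with entropy[OF \<mu>.shift_invariant_axioms i\<mu>]
  have eq\<mu>: "measure_entropy \<mu> shift_map = ennreal (- (\<integral>x. \<phi> x \<partial>\<mu>))" by (rule antisym)
  then have "free_energy \<mu> \<phi> = 0" using energy(2)[OF assms(3) gt\<mu>] by simp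
  moreover have "pressure M \<phi> = 0"
    unfolding pressure_def
  proof (rule antisym)
    show "(SUP \<nu>\<in>{\<nu> \<in> invariant_measures M. integral_gt_minus_infinity \<nu> \<phi>}. free_energy \<nu> \<phi>) \<le> 0"
      by (rule SUP_least) (use energy(1) in auto)
    show "0 \<le> (SUP \<nu>\<in>{\<nu> \<in> invariant_measures M. integral_gt_minus_infinity \<nu> \<phi>}. free_energy \<nu> \<phi>)"
      by (rule SUP_upper2[of \<mu>]) (use assms(3) gt\<mu> \<open>free_energy \<mu> \<phi> = 0\<close> in auto)
  qed
  ultimately have "equilibrium_measure M \<phi> \<mu>"
    using assms(3) gt\<mu> by (simp add: equilibrium_measure_def)
  moreover have "\<nu> = \<mu>" if "equilibrium_measure M \<phi> \<nu>" for \<nu>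
  proof -
    have \<nu>: "\<nu> \<in> invariant_measures M" "integral_gt_minus_infinity \<nu> \<phi>" "free_energy \<nu> \<phi> = 0"
      using that \<open>pressure M \<phi> = 0\<close> by (simp_all add: equilibrium_measure_def)
    show ?thesis
      by (rule unique) (use \<nu> energy(2)[OF \<nu>(1,2)] integrable[OF \<nu>(1,2)] in \<open>simp_all add: invariant_measures_iff\<close>)
  qed
  ultimately show ?thesis using UC by blast
qed

end
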